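(* Let $K$ be an even-dimensional compact connected Lie group with a Lie algebraic generalized Kähler structure $(K,\gamma;\mathbb J_\pm,\sigma)$. Then $\mathcal A_+$ is trivial as an $I_+$-holomorphic vector bundle and $\mathcal A_-$ is trivial as an $I_-$-holomorphic vector bundle.
   Context: Generalized geometry. For a manifold $M$ with closed $\gamma\in\Omega^3(M)$, $\mathbb TM=TM\oplus T^*M$ carries the pairing $\langle X+\xi,Y+\eta\rangle=\frac12(\iota_X\eta+\iota_Y\xi)$, the Dorfman bracket $(X+\xi)*(Y+\eta)=[X,Y]+\mathcal L_X\eta-\iota_Yd\xi+\iota_X\iota_Y\gamma$ and the projection $a:\mathbb TM\to TM$. A generalized complex structure is an orthogonal $\mathbb J:\mathbb TM\to\mathbb TM$ with $\mathbb J^2=-1$ whose $i$-eigenbundle $L\subset\mathbb TM\otimes\mathbb C$ is closed under $*$. A generalized Kähler structure $(M,\gamma;\mathbb J_\pm,g)$ is a pair of commuting generalized complex structures with $-\mathbb J_+\mathbb J_-=\begin{pmatrix}0&g^{-1}\\ g&0\end{pmatrix}$, $g$ a Riemannian metric. With $L_\pm$ the $i$-eigenbundle of $\mathbb J_\pm$, set $\ell_+=L_+\cap L_-$, $\ell_-=L_+\cap\bar L_-$, so $L_+=\ell_+\oplus\ell_-$. The formulas $I_\pm(X)=a(\mathbb J_+(X\pm g(X)))$ define integrable complex structures, and $a$ identifies $\bar\ell_\pm$ with the antiholomorphic tangent bundle $T^\pm_{0,1}M$ of $I_\pm$. Holomorphic reduction: $\mathcal A_+:=(\bar\ell_+\oplus\bar\ell_-)/\bar\ell_+$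 is an $I_+$-holomorphic vector bundle with $\bar\partial_{+,X}\mathfrak Y_A=(\mathfrak X*\mathfrak Y)_A$ for $\mathfrak X\in C^\infty(\bar\ell_+)$, $X=a(\mathfrak X)$, $\mathfrak Y\in C^\infty(\bar L_+)$, $(\cdot)_A$ denoting the class in $\mathcal A_+$; symmetrically $\mathcal A_-:=(\bar\ell_+\oplus\bar\ell_-)/\bar\ell_-$ is an $I_-$-holomorphic vector bundle, with $\bar\ell_+$ and $\bar\ell_-$ interchanged. Lie group setting. $\mathfrak k$ is the Lie algebra of $K$, $\mathfrak g=\mathfrak k\otimes\mathbb C$, identified with right invariant vector fields (so $[X_a^r,X_b^r]=X^r_{[a,b]}$); $X_a^r$, $X_a^l$ are the right, left invariant vector fields with value $a$ at the identity and $\theta^r,\theta^l$ the right, left invariant $\mathfrak g$-valued Cartan 1-forms. $\kappa$ is the invariant symmetric bilinear form on $\mathfrak g$ given by $-\mathrm{tr}(\mathrm{ad}_a\mathrm{ad}_b)$ on $[\mathfrak g,\mathfrak g]$, extended so that $\mathfrak g=[\mathfrak g,\mathfrak g]\oplus\mathfrak z$ ($\mathfrak z$ the center) is orthogonal and $\sigma(X_a^r,X_b^r)=\kappa(a,b)$ is a bi-invariant Riemannian metric on $K$; $\gamma(X_a^r,X_b^r,X_c^r)=\kappa(a,[b,c])$. Let $\mathfrak d=\mathfrak g\oplus\mathfrak g$ with quadratic form $-\kappa\oplus\kappa$; the Courant trivialization sends $\hat a=(a,a')\in\mathfrak d$ to $\mathfrak X_{\hat a}=X_{a'}^r-X_a^l+\kappa(\theta^r,a')+\kappa(\theta^l,a)$.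 A Lie algebraic generalized complex structure on $K$ is one whose $i$-eigenbundle is spanned by $\{\mathfrak X_{\hat a}:\hat a\in\mathfrak L\}$ for a complex Lagrangian subalgebra $\mathfrak L\subset\mathfrak d$ with $\mathfrak L\cap(\mathfrak k\oplus\mathfrak k)=\{0\}$. A generalized Kähler structure $(K,\gamma;\mathbb J_\pm,\sigma)$ is Lie algebraic if both $\mathbb J_\pm$ are. *)

theory Defs
  imports
    "HOL-Analysis.Analysis"
    "HOL-Algebra.Group"
    "HOL-Library.Function_Algebras"
    "HOL-Library.Product_Plus"
    "HOL-Library.Set_Algebras"
begin

section \<open>Smooth manifolds and Lie groups\<close>

text \<open>
  The model space is a finite-dimensional real normed space; unlike a Euclidean space in the
  sense of the library it may have dimension zero. The underlying set of a manifold is a whole type.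
\<close>

primrec Ck_on :: "nat \<Rightarrow> 'e::real_normed_vector set \<Rightarrow> ('e \<Rightarrow> 'f::real_normed_vector) \<Rightarrow> bool" where
  "Ck_on 0 S f \<longleftrightarrow> continuous_on S f"
| "Ck_on (Suc k) S f \<longleftrightarrow>
     (\<forall>x\<in>S. f differentiable (at x)) \<and> (\<forall>v. Ck_on k S (\<lambda>x. frechet_derivative f (at x) v))"

definition smooth_on :: "'e::real_normed_vector set \<Rightarrow> ('e \<Rightarrow> 'f::real_normed_vector) \<Rightarrow> bool" where
  "smooth_on S f \<longleftrightarrow> (\<forall>k. Ck_on k S f)"

type_synonym ('k, 'e) atlas = "('k set \<times> ('k \<Rightarrow> 'e)) set"

definition smooth_manifold ::
  "('k::{t2_space, second_countable_topology}, 'e::real_normed_vector) atlas \<Rightarrow> bool" where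
  "smooth_manifold A \<longleftrightarrow>
     (\<exists>B::'e set. finite B \<and> span B = UNIV) \<and>
     (\<Union>(U, \<phi>)\<in>A. U) = UNIV \<and>
     (\<forall>(U, \<phi>)\<in>A. open U \<and> open (\<phi> ` U) \<and> homeomorphism U (\<phi> ` U) \<phi> (inv_into U \<phi>)) \<and>
     (\<forall>(U, \<phi>)\<in>A. \<forall>(V, \<psi>)\<in>A. smooth_on (\<phi> ` (U \<inter> V)) (\<psi> \<circ> inv_into U \<phi>))"

definition smooth_map ::
  "('k::topological_space, 'e::real_normed_vector) atlas \<Rightarrow>
   ('l::topological_space, 'f::real_normed_vector) atlas \<Rightarrow> ('k \<Rightarrow> 'l) \<Rightarrow> bool" where
  "smooth_map A B F \<longleftrightarrow> continuous_on UNIV F \<and>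
     (\<forall>(U, \<phi>)\<in>A. \<forall>(V, \<psi>)\<in>B. smooth_on (\<phi> ` (U \<inter> F -` V)) (\<psi> \<circ> F \<circ> inv_into U \<phi>))"

definition prod_atlas :: "('k, 'e) atlas \<Rightarrow> ('l, 'f) atlas \<Rightarrow> ('k \<times> 'l, 'e \<times> 'f) atlas" where
  "prod_atlas A B = {(U \<times> V, map_prod \<phi> \<psi>) | U \<phi> V \<psi>. (U, \<phi>) \<in> A \<and> (V, \<psi>) \<in> B}"

definition lie_group ::
  "('k::{t2_space, second_countable_topology}, 'e::real_normed_vector) atlas \<Rightarrow> 'k monoid \<Rightarrow> bool" where
  "lie_group A K \<longleftrightarrow> smooth_manifold A \<and> group K \<and> carrier K = UNIV \<and>
     smooth_map (prod_atlas A A) A (\<lambda>(x, y). x \<otimes>\<^bsub>K\<^esub> y) \<and>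
     smooth_map A A (\<lambda>x. inv\<^bsub>K\<^esub> x)"

definition smooth_funs :: "('k, 'e::real_normed_vector) atlas \<Rightarrow> ('k \<Rightarrow> complex) set" where
  "smooth_funs A = {f. \<forall>(U, \<phi>)\<in>A. smooth_on (\<phi> ` U) (f \<circ> inv_into U \<phi>)}"


section \<open>The complexified generalized tangent bundle\<close>

text \<open>
  The fibre at \<open>p\<close> of the complexified tangent bundle consists of the complex-linear derivations at
  \<open>p\<close> of the algebra of complex-valued smooth functions; the real tangent vectors are those fixed by
  the conjugation \<open>tconj\<close>. The complexified cotangent fibre is its complex dual. Vectors and
  covectors are set to zero outside their natural domains, so that equality of functions is the
  intended equality. Addition of (pairs of) functions is pointwise.
\<close>

type_synonym 'k tvec = "('k \<Rightarrow> complex) \<Rightarrow> complex"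
type_synonym 'k covec = "'k tvec \<Rightarrow> complex"
type_synonym 'k gvec = "'k tvec \<times> 'k covec"
type_synonym 'k form3 = "'k \<Rightarrow> 'k tvec \<Rightarrow> 'k tvec \<Rightarrow> 'k tvec \<Rightarrow> complex"

definition cscale :: "complex \<Rightarrow> ('x \<Rightarrow> complex) \<Rightarrow> 'x \<Rightarrow> complex" where
  "cscale c f = (\<lambda>x. c * f x)"

definition gscale :: "complex \<Rightarrow> 'k gvec \<Rightarrow> 'k gvec" where
  "gscale c u = (cscale c (fst u), cscale c (snd u))"

global_interpretation fvec: vector_space "cscale :: complex \<Rightarrow> ('x \<Rightarrow> complex) \<Rightarrow> 'x \<Rightarrow> complex"
  by unfold_locales (auto simp: cscale_def fun_eq_iff algebra_simps)

global_interpretation gvec: vector_space "gscale :: complex \<Rightarrow> 'k gvec \<Rightarrow> 'k gvec"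
  by unfold_locales (auto simp: gscale_def cscale_def fun_eq_iff algebra_simps prod_eq_iff)

definition tangent :: "('k, 'e::real_normed_vector) atlas \<Rightarrow> 'k \<Rightarrow> 'k tvec set" where
  "tangent A p = {v.
     (\<forall>f. f \<notin> smooth_funs A \<longrightarrow> v f = 0) \<and>
     (\<forall>f\<in>smooth_funs A. \<forall>g\<in>smooth_funs A. v (f + g) = v f + v g) \<and>
     (\<forall>c. \<forall>f\<in>smooth_funs A. v (cscale c f) = c * v f) \<and>
     (\<forall>f\<in>smooth_funs A. \<forall>g\<in>smooth_funs A. v (\<lambda>x. f x * g x) = v f * g p + f p * v g)}"

definition cotangent :: "('k, 'e::real_normed_vector) atlas \<Rightarrow> 'k \<Rightarrow> 'k covec set" where
  "cotangent A p = {\<xi>.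
     (\<forall>v. v \<notin> tangent A p \<longrightarrow> \<xi> v = 0) \<and>
     (\<forall>u\<in>tangent A p. \<forall>v\<in>tangent A p. \<xi> (u + v) = \<xi> u + \<xi> v) \<and>
     (\<forall>c. \<forall>v\<in>tangent A p. \<xi> (cscale c v) = c * \<xi> v)}"

definition gtangent :: "('k, 'e::real_normed_vector) atlas \<Rightarrow> 'k \<Rightarrow> 'k gvec set" where
  "gtangent A p = tangent A p \<times> cotangent A p"

definition tconj :: "'k tvec \<Rightarrow> 'k tvec" where
  "tconj v = (\<lambda>f. cnj (v (\<lambda>x. cnj (f x))))"

definition gconj :: "'k gvec \<Rightarrow> 'k gvec" where
  "gconj u = (tconj (fst u), \<lambda>v. cnj (snd u (tconj v)))"

definition real_tangent :: "('k, 'e::real_normed_vector) atlas \<Rightarrow> 'k \<Rightarrow> 'k tvec set" where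
  "real_tangent A p = {v \<in> tangent A p. tconj v = v}"

definition gpair :: "'k gvec \<Rightarrow> 'k gvec \<Rightarrow> complex" where
  "gpair u w = (snd w (fst u) + snd u (fst w)) / 2"

definition vfields :: "('k, 'e::real_normed_vector) atlas \<Rightarrow> ('k \<Rightarrow> 'k tvec) set" where
  "vfields A = {X. (\<forall>p. X p \<in> tangent A p) \<and> (\<forall>f\<in>smooth_funs A. (\<lambda>p. X p f) \<in> smooth_funs A)}"

definition oneforms :: "('k, 'e::real_normed_vector) atlas \<Rightarrow> ('k \<Rightarrow> 'k covec) set" where
  "oneforms A = {\<xi>. (\<forall>p. \<xi> p \<in> cotangent A p) \<and>
     (\<forall>X\<in>vfields A. (\<lambda>p. \<xi> p (X p)) \<in> smooth_funs A)}"

definition gsections :: "('k, 'e::real_normed_vector) atlas \<Rightarrow> ('k \<Rightarrow> 'k gvec) set" where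
  "gsections A = {s. (\<lambda>p. fst (s p)) \<in> vfields A \<and> (\<lambda>p. snd (s p)) \<in> oneforms A}"

definition sections_in ::
  "('k, 'e::real_normed_vector) atlas \<Rightarrow> ('k \<Rightarrow> 'k gvec set) \<Rightarrow> ('k \<Rightarrow> 'k gvec) set" where
  "sections_in A E = {s \<in> gsections A. \<forall>p. s p \<in> E p}"


section \<open>The Dorfman bracket\<close>

definition lie_br :: "('k \<Rightarrow> 'k tvec) \<Rightarrow> ('k \<Rightarrow> 'k tvec) \<Rightarrow> 'k \<Rightarrow> 'k tvec" where
  "lie_br X Y p = (\<lambda>f. X p (\<lambda>q. Y q f) - Y p (\<lambda>q. X q f))"

text \<open>
  Lie derivative and exterior derivative are given by the usual invariant formulas. These are
  tensorial in the remaining arguments, so the choice of the extension of a tangent vector to a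
  vector field is immaterial.
\<close>

definition extension :: "('k, 'e::real_normed_vector) atlas \<Rightarrow> 'k \<Rightarrow> 'k tvec \<Rightarrow> 'k \<Rightarrow> 'k tvec" where
  "extension A p v = (SOME Z. Z \<in> vfields A \<and> Z p = v)"

definition lie_derivative ::
  "('k, 'e::real_normed_vector) atlas \<Rightarrow> ('k \<Rightarrow> 'k tvec) \<Rightarrow> ('k \<Rightarrow> 'k covec) \<Rightarrow> 'k \<Rightarrow> 'k covec" where
  "lie_derivative A X \<eta> p = (\<lambda>v. if v \<in> tangent A p
     then (let Z = extension A p v in X p (\<lambda>q. \<eta> q (Z q)) - \<eta> p (lie_br X Z p))
     else 0)"

definition ext_deriv ::
  "('k, 'e::real_normed_vector) atlas \<Rightarrow> ('k \<Rightarrow> 'k covec) \<Rightarrow> 'k \<Rightarrow> 'k tvec \<Rightarrow> 'k tvec \<Rightarrow> complex" where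
  "ext_deriv A \<xi> p = (\<lambda>u v. if u \<in> tangent A p \<and> v \<in> tangent A p
     then (let Y = extension A p u; Z = extension A p v in
       Y p (\<lambda>q. \<xi> q (Z q)) - Z p (\<lambda>q. \<xi> q (Y q)) - \<xi> p (lie_br Y Z p))
     else 0)"

text \<open>
  For \<open>s = X + \<xi>\<close> and \<open>t = Y + \<eta>\<close>; the term \<open>\<iota>\<^sub>X \<iota>\<^sub>Y \<gamma>\<close> is the 1-form \<open>\<gamma>(Y, X, -)\<close>.
\<close>

definition dorfman ::
  "('k, 'e::real_normed_vector) atlas \<Rightarrow> 'k form3 \<Rightarrow> ('k \<Rightarrow> 'k gvec) \<Rightarrow> ('k \<Rightarrow> 'k gvec) \<Rightarrow> 'k \<Rightarrow> 'k gvec" where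
  "dorfman A \<gamma> s t p =
     (let X = (\<lambda>q. fst (s q)); \<xi> = (\<lambda>q. snd (s q)); Y = (\<lambda>q. fst (t q)); \<eta> = (\<lambda>q. snd (t q)) in
      (lie_br X Y p,
       \<lambda>v. if v \<in> tangent A p
         then lie_derivative A X \<eta> p v - ext_deriv A \<xi> p (Y p) v + \<gamma> p (Y p) (X p) v
         else 0))"


section \<open>Generalized complex and generalized Kaehler structures\<close>

text \<open>
  Real bundle maps and real bilinear forms are represented by their complex-linear extensions.
\<close>

definition eigenbundle ::
  "('k, 'e::real_normed_vector) atlas \<Rightarrow> ('k \<Rightarrow> 'k gvec \<Rightarrow> 'k gvec) \<Rightarrow> 'k \<Rightarrow> 'k gvec set" where
  "eigenbundle A J p = {u \<in> gtangent A p. J p u = gscale \<i> u}"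

definition real_gendo ::
  "('k, 'e::real_normed_vector) atlas \<Rightarrow> ('k \<Rightarrow> 'k gvec \<Rightarrow> 'k gvec) \<Rightarrow> bool" where
  "real_gendo A J \<longleftrightarrow>
     (\<forall>p. \<forall>u\<in>gtangent A p. J p u \<in> gtangent A p \<and> J p (gconj u) = gconj (J p u) \<and>
        (\<forall>c. J p (gscale c u) = gscale c (J p u)) \<and>
        (\<forall>w\<in>gtangent A p. J p (u + w) = J p u + J p w)) \<and>
     (\<forall>s\<in>gsections A. (\<lambda>p. J p (s p)) \<in> gsections A)"

text \<open>
  Closedness of the 3-form is a standing requirement on \<open>\<gamma>\<close> rather than on \<open>J\<close>; below, \<open>\<gamma>\<close> is the
  Cartan 3-form of a Lie group, which is closed.
\<close>

definition generalized_complex ::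
  "('k, 'e::real_normed_vector) atlas \<Rightarrow> 'k form3 \<Rightarrow> ('k \<Rightarrow> 'k gvec \<Rightarrow> 'k gvec) \<Rightarrow> bool" where
  "generalized_complex A \<gamma> J \<longleftrightarrow> real_gendo A J \<and>
     (\<forall>p. \<forall>u\<in>gtangent A p. J p (J p u) = - u) \<and>
     (\<forall>p. \<forall>u\<in>gtangent A p. \<forall>w\<in>gtangent A p. gpair (J p u) (J p w) = gpair u w) \<and>
     (\<forall>s\<in>sections_in A (eigenbundle A J). \<forall>t\<in>sections_in A (eigenbundle A J).
        dorfman A \<gamma> s t \<in> sections_in A (eigenbundle A J))"

definition riemannian ::
  "('k, 'e::real_normed_vector) atlas \<Rightarrow> ('k \<Rightarrow> 'k tvec \<Rightarrow> 'k tvec \<Rightarrow> complex) \<Rightarrow> bool" where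
  "riemannian A g \<longleftrightarrow>
     (\<forall>p. \<forall>u\<in>tangent A p. \<forall>v\<in>tangent A p.
        g p u v = g p v u \<and> (\<forall>c. g p (cscale c u) v = c * g p u v) \<and>
        (\<forall>w\<in>tangent A p. g p (u + w) v = g p u v + g p w v)) \<and>
     (\<forall>p. \<forall>u\<in>real_tangent A p. \<forall>v\<in>real_tangent A p. g p u v \<in> \<real>) \<and>
     (\<forall>p. \<forall>v\<in>real_tangent A p. v \<noteq> 0 \<longrightarrow> Re (g p v v) > 0) \<and>
     (\<forall>X\<in>vfields A. \<forall>Y\<in>vfields A. (\<lambda>p. g p (X p) (Y p)) \<in> smooth_funs A)"

definition flat ::
  "('k, 'e::real_normed_vector) atlas \<Rightarrow> ('k \<Rightarrow> 'k tvec \<Rightarrow> 'k tvec \<Rightarrow> complex) \<Rightarrow> 'k \<Rightarrow> 'k tvec \<Rightarrow> 'k covec" where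
  "flat A g p v = (\<lambda>w. if w \<in> tangent A p then g p v w else 0)"

definition sharp ::
  "('k, 'e::real_normed_vector) atlas \<Rightarrow> ('k \<Rightarrow> 'k tvec \<Rightarrow> 'k tvec \<Rightarrow> complex) \<Rightarrow> 'k \<Rightarrow> 'k covec \<Rightarrow> 'k tvec" where
  "sharp A g p = inv_into (tangent A p) (flat A g p)"

definition generalized_kaehler ::
  "('k, 'e::real_normed_vector) atlas \<Rightarrow> 'k form3 \<Rightarrow>
   ('k \<Rightarrow> 'k gvec \<Rightarrow> 'k gvec) \<Rightarrow> ('k \<Rightarrow> 'k gvec \<Rightarrow> 'k gvec) \<Rightarrow>
   ('k \<Rightarrow> 'k tvec \<Rightarrow> 'k tvec \<Rightarrow> complex) \<Rightarrow> bool" where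
  "generalized_kaehler A \<gamma> Jp Jm g \<longleftrightarrow>
     generalized_complex A \<gamma> Jp \<and> generalized_complex A \<gamma> Jm \<and> riemannian A g \<and>
     (\<forall>p. \<forall>u\<in>gtangent A p. Jp p (Jm p u) = Jm p (Jp p u)) \<and>
     (\<forall>p. \<forall>v\<in>tangent A p. \<forall>\<xi>\<in>cotangent A p. - Jp p (Jm p (v, \<xi>)) = (sharp A g p \<xi>, flat A g p v))"

definition I_plus ::
  "('k, 'e::real_normed_vector) atlas \<Rightarrow> ('k \<Rightarrow> 'k gvec \<Rightarrow> 'k gvec) \<Rightarrow>
   ('k \<Rightarrow> 'k tvec \<Rightarrow> 'k tvec \<Rightarrow> complex) \<Rightarrow> 'k \<Rightarrow> 'k tvec \<Rightarrow> 'k tvec" where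
  "I_plus A Jp g p v = fst (Jp p (v, flat A g p v))"

definition I_minus ::
  "('k, 'e::real_normed_vector) atlas \<Rightarrow> ('k \<Rightarrow> 'k gvec \<Rightarrow> 'k gvec) \<Rightarrow>
   ('k \<Rightarrow> 'k tvec \<Rightarrow> 'k tvec \<Rightarrow> complex) \<Rightarrow> 'k \<Rightarrow> 'k tvec \<Rightarrow> 'k tvec" where
  "I_minus A Jp g p v = fst (Jp p (v, - flat A g p v))"

definition ell_plus_bar ::
  "('k, 'e::real_normed_vector) atlas \<Rightarrow> ('k \<Rightarrow> 'k gvec \<Rightarrow> 'k gvec) \<Rightarrow> ('k \<Rightarrow> 'k gvec \<Rightarrow> 'k gvec) \<Rightarrow>
   'k \<Rightarrow> 'k gvec set" where
  "ell_plus_bar A Jp Jm p = gconj ` (eigenbundle A Jp p \<inter> eigenbundle A Jm p)"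

definition ell_minus_bar ::
  "('k, 'e::real_normed_vector) atlas \<Rightarrow> ('k \<Rightarrow> 'k gvec \<Rightarrow> 'k gvec) \<Rightarrow> ('k \<Rightarrow> 'k gvec \<Rightarrow> 'k gvec) \<Rightarrow>
   'k \<Rightarrow> 'k gvec set" where
  "ell_minus_bar A Jp Jm p = gconj ` (eigenbundle A Jp p \<inter> gconj ` eigenbundle A Jm p)"


section \<open>Holomorphic vector bundles\<close>

text \<open>
  A smooth complex vector bundle is given by its fibres with their linear structure and its smooth
  global sections. A holomorphic structure over a complex manifold with complex structure \<open>I\<close> is a
  Dolbeault operator, which differentiates a section along a vector field of type \<open>(0,1)\<close>.
\<close>

record ('k, 'v) cbundle =
  fibre :: "'k \<Rightarrow> 'v set"
  fibre_add :: "'k \<Rightarrow> 'v \<Rightarrow> 'v \<Rightarrow> 'v"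
  fibre_scale :: "'k \<Rightarrow> complex \<Rightarrow> 'v \<Rightarrow> 'v"
  smooth_sections :: "('k \<Rightarrow> 'v) set"

type_synonym ('k, 'v) dolbeault = "('k \<Rightarrow> 'k tvec) \<Rightarrow> ('k \<Rightarrow> 'v) \<Rightarrow> 'k \<Rightarrow> 'v"

definition vfields01 ::
  "('k, 'e::real_normed_vector) atlas \<Rightarrow> ('k \<Rightarrow> 'k tvec \<Rightarrow> 'k tvec) \<Rightarrow> ('k \<Rightarrow> 'k tvec) set" where
  "vfields01 A I = {X \<in> vfields A. \<forall>p. I p (X p) = cscale (- \<i>) (X p)}"

definition holomorphic_iso ::
  "('k, 'e::real_normed_vector) atlas \<Rightarrow> ('k \<Rightarrow> 'k tvec \<Rightarrow> 'k tvec) \<Rightarrow>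
   ('k, 'v) cbundle \<Rightarrow> ('k, 'v) dolbeault \<Rightarrow> ('k, 'w) cbundle \<Rightarrow> ('k, 'w) dolbeault \<Rightarrow>
   ('k \<Rightarrow> 'v \<Rightarrow> 'w) \<Rightarrow> bool" where
  "holomorphic_iso A I E dE F dF \<Phi> \<longleftrightarrow>
     (\<forall>p. bij_betw (\<Phi> p) (fibre E p) (fibre F p)) \<and>
     (\<forall>p. \<forall>u\<in>fibre E p. \<forall>w\<in>fibre E p.
        \<Phi> p (fibre_add E p u w) = fibre_add F p (\<Phi> p u) (\<Phi> p w)) \<and>
     (\<forall>p c. \<forall>u\<in>fibre E p. \<Phi> p (fibre_scale E p c u) = fibre_scale F p c (\<Phi> p u)) \<and>
     (\<forall>s. (\<forall>p. s p \<in> fibre E p) \<longrightarrow>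
        (s \<in> smooth_sections E \<longleftrightarrow> (\<lambda>p. \<Phi> p (s p)) \<in> smooth_sections F)) \<and>
     (\<forall>X\<in>vfields01 A I. \<forall>s\<in>smooth_sections E.
        \<forall>p. \<Phi> p (dE X s p) = dF X (\<lambda>q. \<Phi> q (s q)) p)"

definition trivial_bundle ::
  "('k, 'e::real_normed_vector) atlas \<Rightarrow> nat \<Rightarrow> ('k, nat \<Rightarrow> complex) cbundle" where
  "trivial_bundle A r =
     \<lparr> fibre = (\<lambda>p. {x. \<forall>i\<ge>r. x i = 0}),
       fibre_add = (\<lambda>p x y. x + y),
       fibre_scale = (\<lambda>p. cscale),
       smooth_sections = {s. \<forall>i. (\<forall>p. i \<ge> r \<longrightarrow> s p i = 0) \<and> (\<lambda>p. s p i) \<in> smooth_funs A} \<rparr>"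

definition trivial_dolbeault :: "('k, nat \<Rightarrow> complex) dolbeault" where
  "trivial_dolbeault X s p = (\<lambda>i. X p (\<lambda>q. s q i))"

definition holomorphically_trivial ::
  "('k, 'e::real_normed_vector) atlas \<Rightarrow> ('k \<Rightarrow> 'k tvec \<Rightarrow> 'k tvec) \<Rightarrow>
   ('k, 'v) cbundle \<Rightarrow> ('k, 'v) dolbeault \<Rightarrow> bool" where
  "holomorphically_trivial A I E dE \<longleftrightarrow>
     (\<exists>r \<Phi>. holomorphic_iso A I E dE (trivial_bundle A r) trivial_dolbeault \<Phi>)"

text \<open>
  The quotient of a subbundle \<open>E\<close> of the complexified generalized tangent bundle by a subbundle
  \<open>F\<close> of \<open>E\<close>; elements of its fibres are cosets.
\<close>

definition coset :: "('k \<Rightarrow> 'k gvec set) \<Rightarrow> 'k \<Rightarrow> 'k gvec \<Rightarrow> 'k gvec set" where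
  "coset F p u = {u + w | w. w \<in> F p}"

definition quotient_bundle ::
  "('k, 'e::real_normed_vector) atlas \<Rightarrow> ('k \<Rightarrow> 'k gvec set) \<Rightarrow> ('k \<Rightarrow> 'k gvec set) \<Rightarrow>
   ('k, 'k gvec set) cbundle" where
  "quotient_bundle A E F =
     \<lparr> fibre = (\<lambda>p. coset F p ` E p),
       fibre_add = (\<lambda>p S T. S + T),
       fibre_scale = (\<lambda>p c S. gscale c ` S + F p),
       smooth_sections = {(\<lambda>p. coset F p (t p)) | t. t \<in> sections_in A E} \<rparr>"

text \<open>
  Here the anchor restricts to an isomorphism from \<open>F\<close> onto the antiholomorphic tangent bundle and
  \<open>E\<close>, \<open>F\<close> are closed under the Dorfman bracket, so the result does not depend on the choices.
\<close>

definition quotient_dolbeault ::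
  "('k, 'e::real_normed_vector) atlas \<Rightarrow> 'k form3 \<Rightarrow> ('k \<Rightarrow> 'k gvec set) \<Rightarrow> ('k \<Rightarrow> 'k gvec set) \<Rightarrow>
   ('k, 'k gvec set) dolbeault" where
  "quotient_dolbeault A \<gamma> E F X s p =
     (let \<XX> = (SOME \<XX>. \<XX> \<in> sections_in A F \<and> (\<forall>q. fst (\<XX> q) = X q));
          \<YY> = (SOME \<YY>. \<YY> \<in> sections_in A E \<and> (\<forall>q. s q = coset F q (\<YY> q)))
      in coset F p (dorfman A \<gamma> \<XX> \<YY> p))"

definition ell_sum_bar ::
  "('k, 'e::real_normed_vector) atlas \<Rightarrow> ('k \<Rightarrow> 'k gvec \<Rightarrow> 'k gvec) \<Rightarrow> ('k \<Rightarrow> 'k gvec \<Rightarrow> 'k gvec) \<Rightarrow>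
   'k \<Rightarrow> 'k gvec set" where
  "ell_sum_bar A Jp Jm p = ell_plus_bar A Jp Jm p + ell_minus_bar A Jp Jm p"

definition A_plus ::
  "('k, 'e::real_normed_vector) atlas \<Rightarrow> ('k \<Rightarrow> 'k gvec \<Rightarrow> 'k gvec) \<Rightarrow> ('k \<Rightarrow> 'k gvec \<Rightarrow> 'k gvec) \<Rightarrow>
   ('k, 'k gvec set) cbundle" where
  "A_plus A Jp Jm = quotient_bundle A (ell_sum_bar A Jp Jm) (ell_plus_bar A Jp Jm)"

definition A_minus ::
  "('k, 'e::real_normed_vector) atlas \<Rightarrow> ('k \<Rightarrow> 'k gvec \<Rightarrow> 'k gvec) \<Rightarrow> ('k \<Rightarrow> 'k gvec \<Rightarrow> 'k gvec) \<Rightarrow>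
   ('k, 'k gvec set) cbundle" where
  "A_minus A Jp Jm = quotient_bundle A (ell_sum_bar A Jp Jm) (ell_minus_bar A Jp Jm)"

definition dbar_plus ::
  "('k, 'e::real_normed_vector) atlas \<Rightarrow> 'k form3 \<Rightarrow> ('k \<Rightarrow> 'k gvec \<Rightarrow> 'k gvec) \<Rightarrow>
   ('k \<Rightarrow> 'k gvec \<Rightarrow> 'k gvec) \<Rightarrow> ('k, 'k gvec set) dolbeault" where
  "dbar_plus A \<gamma> Jp Jm = quotient_dolbeault A \<gamma> (ell_sum_bar A Jp Jm) (ell_plus_bar A Jp Jm)"

definition dbar_minus ::
  "('k, 'e::real_normed_vector) atlas \<Rightarrow> 'k form3 \<Rightarrow> ('k \<Rightarrow> 'k gvec \<Rightarrow> 'k gvec) \<Rightarrow>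
   ('k \<Rightarrow> 'k gvec \<Rightarrow> 'k gvec) \<Rightarrow> ('k, 'k gvec set) dolbeault" where
  "dbar_minus A \<gamma> Jp Jm = quotient_dolbeault A \<gamma> (ell_sum_bar A Jp Jm) (ell_minus_bar A Jp Jm)"


section \<open>Lie algebraic structures on a Lie group\<close>

text \<open>
  The Lie algebra is the tangent space at the identity; its bracket is that of the associated
  \<^emph>\<open>right\<close> invariant vector fields.
\<close>

definition push ::
  "('k, 'e::real_normed_vector) atlas \<Rightarrow> ('k \<Rightarrow> 'k) \<Rightarrow> 'k tvec \<Rightarrow> 'k tvec" where
  "push A F v = (\<lambda>f. if f \<in> smooth_funs A then v (f \<circ> F) else 0)"

definition lie_alg :: "('k, 'e::real_normed_vector) atlas \<Rightarrow> 'k monoid \<Rightarrow> 'k tvec set" where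
  "lie_alg A K = tangent A \<one>\<^bsub>K\<^esub>"

definition real_lie_alg :: "('k, 'e::real_normed_vector) atlas \<Rightarrow> 'k monoid \<Rightarrow> 'k tvec set" where
  "real_lie_alg A K = real_tangent A \<one>\<^bsub>K\<^esub>"

definition right_field ::
  "('k, 'e::real_normed_vector) atlas \<Rightarrow> 'k monoid \<Rightarrow> 'k tvec \<Rightarrow> 'k \<Rightarrow> 'k tvec" where
  "right_field A K a p = push A (\<lambda>x. x \<otimes>\<^bsub>K\<^esub> p) a"

definition left_field ::
  "('k, 'e::real_normed_vector) atlas \<Rightarrow> 'k monoid \<Rightarrow> 'k tvec \<Rightarrow> 'k \<Rightarrow> 'k tvec" where
  "left_field A K a p = push A (\<lambda>x. p \<otimes>\<^bsub>K\<^esub> x) a"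

definition theta_r ::
  "('k, 'e::real_normed_vector) atlas \<Rightarrow> 'k monoid \<Rightarrow> 'k \<Rightarrow> 'k tvec \<Rightarrow> 'k tvec" where
  "theta_r A K p v = push A (\<lambda>x. x \<otimes>\<^bsub>K\<^esub> inv\<^bsub>K\<^esub> p) v"

definition theta_l ::
  "('k, 'e::real_normed_vector) atlas \<Rightarrow> 'k monoid \<Rightarrow> 'k \<Rightarrow> 'k tvec \<Rightarrow> 'k tvec" where
  "theta_l A K p v = push A (\<lambda>x. inv\<^bsub>K\<^esub> p \<otimes>\<^bsub>K\<^esub> x) v"

definition lbr ::
  "('k, 'e::real_normed_vector) atlas \<Rightarrow> 'k monoid \<Rightarrow> 'k tvec \<Rightarrow> 'k tvec \<Rightarrow> 'k tvec" where
  "lbr A K a b = lie_br (right_field A K a) (right_field A K b) \<one>\<^bsub>K\<^esub>"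

definition derived_alg :: "('k, 'e::real_normed_vector) atlas \<Rightarrow> 'k monoid \<Rightarrow> 'k tvec set" where
  "derived_alg A K = fvec.span {lbr A K a b | a b. a \<in> lie_alg A K \<and> b \<in> lie_alg A K}"

definition center_alg :: "('k, 'e::real_normed_vector) atlas \<Rightarrow> 'k monoid \<Rightarrow> 'k tvec set" where
  "center_alg A K = {z \<in> lie_alg A K. \<forall>a\<in>lie_alg A K. lbr A K z a = 0}"

text \<open>For \<open>T\<close> preserving the finite-dimensional subspace \<open>V\<close>; the choice of basis is immaterial.\<close>

definition subspace_trace :: "'k tvec set \<Rightarrow> ('k tvec \<Rightarrow> 'k tvec) \<Rightarrow> complex" where
  "subspace_trace V T = (let B = (SOME B. fvec.independent B \<and> fvec.span B = V) in
     \<Sum>b\<in>B. fvec.representation B (T b) b)"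

definition sigma_metric ::
  "('k, 'e::real_normed_vector) atlas \<Rightarrow> 'k monoid \<Rightarrow> ('k tvec \<Rightarrow> 'k tvec \<Rightarrow> complex) \<Rightarrow>
   'k \<Rightarrow> 'k tvec \<Rightarrow> 'k tvec \<Rightarrow> complex" where
  "sigma_metric A K \<kappa> p u v = \<kappa> (theta_r A K p u) (theta_r A K p v)"

definition cartan_form ::
  "('k, 'e::real_normed_vector) atlas \<Rightarrow> 'k monoid \<Rightarrow> ('k tvec \<Rightarrow> 'k tvec \<Rightarrow> complex) \<Rightarrow> 'k form3" where
  "cartan_form A K \<kappa> p u v w = \<kappa> (theta_r A K p u) (lbr A K (theta_r A K p v) (theta_r A K p w))"

definition bi_invariant ::
  "('k, 'e::real_normed_vector) atlas \<Rightarrow> 'k monoid \<Rightarrow>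
   ('k \<Rightarrow> 'k tvec \<Rightarrow> 'k tvec \<Rightarrow> complex) \<Rightarrow> bool" where
  "bi_invariant A K g \<longleftrightarrow> (\<forall>h p. \<forall>u\<in>tangent A p. \<forall>v\<in>tangent A p.
     g (h \<otimes>\<^bsub>K\<^esub> p) (push A (\<lambda>x. h \<otimes>\<^bsub>K\<^esub> x) u) (push A (\<lambda>x. h \<otimes>\<^bsub>K\<^esub> x) v) = g p u v \<and>
     g (p \<otimes>\<^bsub>K\<^esub> h) (push A (\<lambda>x. x \<otimes>\<^bsub>K\<^esub> h) u) (push A (\<lambda>x. x \<otimes>\<^bsub>K\<^esub> h) v) = g p u v)"

definition kappa_form ::
  "('k, 'e::real_normed_vector) atlas \<Rightarrow> 'k monoid \<Rightarrow> ('k tvec \<Rightarrow> 'k tvec \<Rightarrow> complex) \<Rightarrow> bool" where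
  "kappa_form A K \<kappa> \<longleftrightarrow>
     (\<forall>a\<in>lie_alg A K. \<forall>b\<in>lie_alg A K. \<kappa> a b = \<kappa> b a \<and> (\<forall>c. \<kappa> (cscale c a) b = c * \<kappa> a b) \<and>
        (\<forall>c\<in>lie_alg A K. \<kappa> (a + c) b = \<kappa> a b + \<kappa> c b \<and> \<kappa> (lbr A K a b) c = \<kappa> a (lbr A K b c))) \<and>
     (\<forall>a\<in>derived_alg A K. \<forall>b\<in>derived_alg A K.
        \<kappa> a b = - subspace_trace (lie_alg A K) (\<lambda>c. lbr A K a (lbr A K b c))) \<and>
     (\<forall>a\<in>derived_alg A K. \<forall>z\<in>center_alg A K. \<kappa> a z = 0) \<and>
     riemannian A (sigma_metric A K \<kappa>) \<and> bi_invariant A K (sigma_metric A K \<kappa>)"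

definition courant_triv ::
  "('k, 'e::real_normed_vector) atlas \<Rightarrow> 'k monoid \<Rightarrow> ('k tvec \<Rightarrow> 'k tvec \<Rightarrow> complex) \<Rightarrow>
   'k tvec \<times> 'k tvec \<Rightarrow> 'k \<Rightarrow> 'k gvec" where
  "courant_triv A K \<kappa> x p =
     (right_field A K (snd x) p - left_field A K (fst x) p,
      \<lambda>v. if v \<in> tangent A p
        then \<kappa> (theta_r A K p v) (snd x) + \<kappa> (theta_l A K p v) (fst x) else 0)"

definition pair_form ::
  "('k tvec \<Rightarrow> 'k tvec \<Rightarrow> complex) \<Rightarrow> 'k tvec \<times> 'k tvec \<Rightarrow> 'k tvec \<times> 'k tvec \<Rightarrow> complex" where
  "pair_form \<kappa> x y = - \<kappa> (fst x) (fst y) + \<kappa> (snd x) (snd y)"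

definition lagrangian_subalgebra ::
  "('k, 'e::real_normed_vector) atlas \<Rightarrow> 'k monoid \<Rightarrow> ('k tvec \<Rightarrow> 'k tvec \<Rightarrow> complex) \<Rightarrow>
   ('k tvec \<times> 'k tvec) set \<Rightarrow> bool" where
  "lagrangian_subalgebra A K \<kappa> L \<longleftrightarrow>
     L \<subseteq> lie_alg A K \<times> lie_alg A K \<and> 0 \<in> L \<and>
     (\<forall>x\<in>L. \<forall>y\<in>L. x + y \<in> L) \<and>
     (\<forall>c. \<forall>x\<in>L. (cscale c (fst x), cscale c (snd x)) \<in> L) \<and>
     (\<forall>x\<in>L. \<forall>y\<in>L. (lbr A K (fst x) (fst y), lbr A K (snd x) (snd y)) \<in> L) \<and>
     L = {x \<in> lie_alg A K \<times> lie_alg A K. \<forall>y\<in>L. pair_form \<kappa> x y = 0}"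

definition lie_algebraic ::
  "('k, 'e::real_normed_vector) atlas \<Rightarrow> 'k monoid \<Rightarrow> ('k tvec \<Rightarrow> 'k tvec \<Rightarrow> complex) \<Rightarrow>
   ('k \<Rightarrow> 'k gvec \<Rightarrow> 'k gvec) \<Rightarrow> bool" where
  "lie_algebraic A K \<kappa> J \<longleftrightarrow> (\<exists>L. lagrangian_subalgebra A K \<kappa> L \<and>
     L \<inter> (real_lie_alg A K \<times> real_lie_alg A K) = {0} \<and>
     (\<forall>p. eigenbundle A J p = gvec.span {courant_triv A K \<kappa> x p | x. x \<in> L}))"

definition lie_algebraic_generalized_kaehler ::
  "('k, 'e::real_normed_vector) atlas \<Rightarrow> 'k monoid \<Rightarrow> ('k tvec \<Rightarrow> 'k tvec \<Rightarrow> complex) \<Rightarrow>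
   ('k \<Rightarrow> 'k gvec \<Rightarrow> 'k gvec) \<Rightarrow> ('k \<Rightarrow> 'k gvec \<Rightarrow> 'k gvec) \<Rightarrow> bool" where
  "lie_algebraic_generalized_kaehler A K \<kappa> Jp Jm \<longleftrightarrow>
     generalized_kaehler A (cartan_form A K \<kappa>) Jp Jm (sigma_metric A K \<kappa>) \<and>
     lie_algebraic A K \<kappa> Jp \<and> lie_algebraic A K \<kappa> Jm"

end

theory Submission
  imports Defs
begin

text \<open>
  A Lie algebraic structure makes \<open>L\<^sub>\<plusminus>\<close> the span of the images of constants under the Courant
  trivialization. On \<open>L\<^sub>+ \<inter> L\<^sub>-\<close> the product \<open>- J\<^sub>+ J\<^sub>-\<close> is \<open>1\<close> and on the intersection of \<open>L\<^sub>+\<close> with the conjugate of \<open>L\<^sub>-\<close>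
  it is \<open>-1\<close>, so these bundles lie on the graphs of \<open>\<sigma>\<close> and \<open>- \<sigma>\<close> and are spanned by images of
  constants of the form \<open>(0, b)\<close> and \<open>(a, 0)\<close>, respectively. Such constants commute: the anchors are right
  and left invariant vector fields, and the 1-form part of the Dorfman bracket vanishes by invariance of
  \<open>\<kappa>\<close>. Hence each of the two families is a holomorphic frame of the quotient by the span of the other.

  Tangent vectors being derivations, finiteness of the dimension, smoothness of invariant fields and
  commutation of left with right invariant fields rest on Hadamard's lemma: a derivation at a point is
  a directional derivative in a chart.
\<close>

section \<open>Smooth functions on finite-dimensional normed spaces\<close>

text \<open>The Dolbeault operator of the quotient is defined through arbitrarily chosen lifts, so
  computing brackets of invariant sections alone does not settle it: brackets of combinations with
  function coefficients must be known modulo the smaller bundle. Pairing with sections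
  \<open>C\<close> dual to the quotient frame achieves this. It annihilates the smaller bundle, and
  the identity \<open><s * u, C> = a(s) <u, C>\<close> says exactly that the coordinates of
  \<open>u\<close> are differentiated as functions. The constants that span the two bundles form
  \<open>\<kappa>\<close>-isotropic subspaces, so \<open>\<kappa>\<close> offers no dual basis
  inside them. Positivity of \<open>\<kappa> a (tconj a)\<close> offers one among the conjugates,
  hence the bases orthonormal for the Hermitian form. The dual sections lie in the conjugate
  bundles; they only serve to test. A second obstacle is that tangent vectors act on global
  functions only. Every local expansion must be cut off by a bump function, and extending by zero
  requires neighbourhoods whose closure stays inside a chart. These exist because a compact
  Hausdorff space is regular.\<close>

lemma Ck_on_cong:
  assumes "open S" "\<And>x. x \<in> S \<Longrightarrow> f x = g x" "Ck_on k S f"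
  shows "Ck_on k S g"
  using assms(2,3)
proof (induction k arbitrary: f g)
  case 0
  then show ?case using continuous_on_cong by fastforce
next
  case (Suc k)
  have d: "f differentiable (at x)" if "x \<in> S" for x using Suc.prems that by simp
  have d': "g differentiable (at x)" if "x \<in> S" for x
    using d[OF that] Suc.prems(1) \<open>open S\<close> that
    by (meson differentiable_def has_derivative_transform_within_open)
  have e: "frechet_derivative f (at x) = frechet_derivative g (at x)" if "x \<in> S" for x
    using frechet_derivative_transform_within_open[OF d[OF that] \<open>open S\<close> that] Suc.prems(1) by blast
  have "Ck_on k S (\<lambda>x. frechet_derivative g (at x) v)" for v
    using Suc.IH[of "\<lambda>x. frechet_derivative f (at x) v" "\<lambda>x. frechet_derivative g (at x) v"] Suc.prems(2) e by simp
  then show ?case using d' by simp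
qed

lemma Ck_on_Suc_imp: "Ck_on (Suc k) S f \<Longrightarrow> Ck_on k S f"
proof (induction k arbitrary: f)
  case 0
  then show ?case
    by (simp add: continuous_at_imp_continuous_on differentiable_imp_continuous_within)
next
  case (Suc k)
  then show ?case by (metis Ck_on.simps(2))
qed

lemma Ck_on_has_derivative:
  "Ck_on (Suc k) S f \<Longrightarrow> x \<in> S \<Longrightarrow> (f has_derivative frechet_derivative f (at x)) (at x)"
  using frechet_derivative_works by auto

text \<open>\<open>frechet_derivative\<close> is a choice operator. This rule accepts any explicit
  formula \<open>D\<close> for the derivative instead, and the product, sum and chain rules below
  are inductions through it.\<close>

lemma Ck_on_SucI:
  assumes "open S" "\<And>x. x \<in> S \<Longrightarrow> (f has_derivative (\<lambda>v. D v x)) (at x)" "\<And>v. Ck_on k S (D v)"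
  shows "Ck_on (Suc k) S f"
proof -
  have "D v x = frechet_derivative f (at x) v" if "x \<in> S" for x v
    using frechet_derivative_at[OF assms(2)[OF that]] by metis
  then have "Ck_on k S (\<lambda>x. frechet_derivative f (at x) v)" for v
    by (rule Ck_on_cong[OF \<open>open S\<close> _ assms(3)[of v]])
  moreover have "f differentiable (at x)" if "x \<in> S" for x
    using assms(2)[OF that] by (rule differentiableI)
  ultimately show ?thesis by simp
qed

lemma Ck_on_subset: "Ck_on k S f \<Longrightarrow> T \<subseteq> S \<Longrightarrow> Ck_on k T f"
  by (induction k arbitrary: f) (auto intro: continuous_on_subset)

lemma Ck_on_local:
  assumes "\<And>x. x \<in> S \<Longrightarrow> \<exists>T. open T \<and> x \<in> T \<and> Ck_on k T f"
  shows "Ck_on k S f"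
  using assms
proof (induction k arbitrary: f)
  case 0
  then show ?case
    by (metis Ck_on.simps(1) continuous_at_imp_continuous_on continuous_on_eq_continuous_at)
next
  case (Suc k)
  then have "\<forall>x\<in>S. f differentiable (at x)" by (metis Ck_on.simps(2))
  moreover have "Ck_on k S (\<lambda>x. frechet_derivative f (at x) v)" for v
    by (rule Suc.IH) (metis Ck_on.simps(2) Suc.prems)
  ultimately show ?case by simp
qed

lemma Ck_on_const: "Ck_on k S (\<lambda>x. c)"
  by (induction k arbitrary: c) (auto simp: frechet_derivative_const)

lemma Ck_on_bounded_linear: "bounded_linear f \<Longrightarrow> Ck_on k S f"
proof (cases k)
  case 0
  then show "bounded_linear f \<Longrightarrow> Ck_on k S f" by (simp add: linear_continuous_on)
next
  case (Suc j)
  assume f: "bounded_linear f"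
  then have "frechet_derivative f (at x) = f" for x
    by (metis bounded_linear_imp_has_derivative frechet_derivative_at)
  then show "Ck_on k S f" unfolding Suc using f
    by (simp add: Ck_on_const bounded_linear_imp_differentiable)
qed

lemma Ck_on_add:
  assumes "open S"
  shows "Ck_on k S f \<Longrightarrow> Ck_on k S g \<Longrightarrow> Ck_on k S (\<lambda>x. f x + g x)"
proof (induction k arbitrary: f g)
  case 0
  then show ?case by (auto intro: continuous_intros)
next
  case (Suc k)
  have *: "((\<lambda>x. f x + g x) has_derivative (\<lambda>v. frechet_derivative f (at x) v + frechet_derivative g (at x) v)) (at x)" if "x \<in> S" for x
    by (intro has_derivative_add) (use Suc.prems that Ck_on_has_derivative in blast)+
  have "Ck_on k S (\<lambda>x. frechet_derivative f (at x) v + frechet_derivative g (at x) v)" for v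
    using Suc by simp
  then show ?case using Ck_on_SucI[OF \<open>open S\<close> *] by blast
qed

lemma Ck_on_bilinear:
  assumes "bounded_bilinear h" "open S"
  shows "Ck_on k S f \<Longrightarrow> Ck_on k S g \<Longrightarrow> Ck_on k S (\<lambda>x. h (f x) (g x))"
proof (induction k arbitrary: f g)
  case 0
  then show ?case using bounded_bilinear.continuous_on[OF assms(1)] by auto
next
  case (Suc k)
  have *: "((\<lambda>x. h (f x) (g x)) has_derivative (\<lambda>v. h (f x) (frechet_derivative g (at x) v) + h (frechet_derivative f (at x) v) (g x))) (at x)" if "x \<in> S" for x
    by (intro bounded_bilinear.FDERIV[OF assms(1)]) (use Suc.prems that Ck_on_has_derivative in blast)+
  have "Ck_on k S (\<lambda>x. h (f x) (frechet_derivative g (at x) v) + h (frechet_derivative f (at x) v) (g x))" for v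
    by (intro Ck_on_add Suc.IH \<open>open S\<close>) (use Suc.prems Ck_on_Suc_imp in auto)
  then show ?case using Ck_on_SucI[OF \<open>open S\<close> *] by blast
qed

lemma Ck_on_linear_compose:
  assumes "bounded_linear h" "open S"
  shows "Ck_on k S f \<Longrightarrow> Ck_on k S (\<lambda>x. h (f x))"
proof (induction k arbitrary: f)
  case 0
  then show ?case using bounded_linear.continuous_on[OF assms(1)] by auto
next
  case (Suc k)
  have *: "((\<lambda>x. h (f x)) has_derivative (\<lambda>v. h (frechet_derivative f (at x) v))) (at x)" if "x \<in> S" for x
    by (intro bounded_linear.has_derivative[OF assms(1)]) (use Suc.prems that Ck_on_has_derivative in blast)+
  have "Ck_on k S (\<lambda>x. h (frechet_derivative f (at x) v))" for v
    by (intro Suc.IH) (use Suc.prems Ck_on_Suc_imp in auto)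
  then show ?case using Ck_on_SucI[OF \<open>open S\<close> *] by blast
qed

lemma Ck_on_sum:
  assumes "open S" "\<And>i. i \<in> I \<Longrightarrow> Ck_on k S (f i)"
  shows "Ck_on k S (\<lambda>x. \<Sum>i\<in>I. f i x)"
  using assms(2)
  by (induction I rule: infinite_finite_induct) (auto intro!: Ck_on_add assms(1) simp: Ck_on_const)

text \<open>The model space of a manifold is not of class \<open>euclidean_space\<close>, so its coordinates are carried explicitly.\<close>

definition coords :: "'e::real_normed_vector set \<Rightarrow> ('e \<Rightarrow> 'e \<Rightarrow> real) \<Rightarrow> bool" where
  "coords B c \<longleftrightarrow> finite B \<and> (\<forall>b\<in>B. bounded_linear (c b)) \<and> (\<forall>x. x = (\<Sum>b\<in>B. c b x *\<^sub>R b))"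

lemma coords_linear:
  assumes "coords B c" "linear f"
  shows "f x = (\<Sum>b\<in>B. c b x *\<^sub>R f b)"
proof -
  have "f x = f (\<Sum>b\<in>B. c b x *\<^sub>R b)" using assms(1) by (metis coords_def)
  also have "\<dots> = (\<Sum>b\<in>B. c b x *\<^sub>R f b)" using assms(2) by (simp add: linear_sum linear_cmul)
  finally show ?thesis .
qed

text \<open>The definition of \<open>Ck_on\<close> controls derivatives of \<open>g\<close> in fixed
  directions, while the chain rule applies the derivative of \<open>g\<close> to a direction that
  varies with \<open>x\<close>. Expanding this direction in coordinates leaves fixed basis
  directions with scalar coefficients, and to those the induction hypothesis applies.\<close>

lemma Ck_on_compose:
  fixes f :: "'a::real_normed_vector \<Rightarrow> 'e::real_normed_vector" and c :: "'e \<Rightarrow> 'e \<Rightarrow> real"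
  assumes c: "coords B c" and "open S" "open T" "f ` S \<subseteq> T"
  shows "Ck_on k T g \<Longrightarrow> Ck_on k S f \<Longrightarrow> Ck_on k S (\<lambda>x. g (f x))"
proof (induction k arbitrary: g)
  case 0
  then show ?case using continuous_on_compose2 assms(4) by auto
next
  case (Suc k)
  define F where "F = (\<lambda>v x. \<Sum>b\<in>B. c b (frechet_derivative f (at x) v) *\<^sub>R frechet_derivative g (at (f x)) b)"
  have *: "((\<lambda>x. g (f x)) has_derivative (\<lambda>v. F v x)) (at x)" if "x \<in> S" for x
  proof -
    have f: "(f has_derivative frechet_derivative f (at x)) (at x)"
      using Suc.prems that Ck_on_has_derivative by blast
    have g: "(g has_derivative frechet_derivative g (at (f x))) (at (f x))"
      using Suc.prems that assms(4) Ck_on_has_derivative by blast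
    have "F v x = frechet_derivative g (at (f x)) (frechet_derivative f (at x) v)" for v
      unfolding F_def using coords_linear[OF c has_derivative_linear[OF g]] by metis
    then show ?thesis using diff_chain_at[OF f g] by (simp add: o_def)
  qed
  have "Ck_on k S (F v)" for v
    unfolding F_def
  proof (intro Ck_on_sum \<open>open S\<close> Ck_on_bilinear[OF bounded_bilinear_scaleR])
    fix b assume b: "b \<in> B"
    show "Ck_on k S (\<lambda>x. c b (frechet_derivative f (at x) v))"
      by (rule Ck_on_linear_compose) (use Suc.prems b c \<open>open S\<close> coords_def in auto)
    show "Ck_on k S (\<lambda>x. frechet_derivative g (at (f x)) b)"
      by (rule Suc.IH) (use Suc.prems Ck_on_Suc_imp in auto)
  qed
  then show ?case using Ck_on_SucI[OF \<open>open S\<close> *] by blast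
qed

text \<open>This makes coordinate functionals bounded. Induction on the basis: if the new vector
  \<open>v\<close> could be approximated from the span of \<open>B\<close>, the approximants would
  form a Cauchy sequence, by the induction hypothesis their coordinates would converge, and
  \<open>v\<close> would lie in the span. So \<open>v\<close> has a positive distance
  \<open>d\<close> from it.\<close>

lemma basis_norm_bound:
  fixes B :: "'e::real_normed_vector set"
  assumes "finite B" "independent B"
  shows "\<exists>m>0. \<forall>c. m * (\<Sum>b\<in>B. \<bar>c b\<bar>) \<le> norm (\<Sum>b\<in>B. c b *\<^sub>R b)"
  using assms
proof (induction B rule: finite_induct)
  case empty
  then show ?case by (auto intro: exI[of _ 1])
next
  case (insert v B)
  then obtain m where m: "m > 0" "\<And>c. m * (\<Sum>b\<in>B. \<bar>c b\<bar>) \<le> norm (\<Sum>b\<in>B. c b *\<^sub>R b)"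
    by (metis independent_insert)
  have v: "v \<notin> span B" using insert by (simp add: independent_insert)
  have "\<exists>d>0. \<forall>c. d \<le> norm ((\<Sum>b\<in>B. c b *\<^sub>R b) + v)"
  proof (rule ccontr)
    assume "\<not> ?thesis"
    then have "\<exists>c. norm ((\<Sum>b\<in>B. c b *\<^sub>R b) + v) < inverse (real (Suc n))" for n
      by (metis inverse_positive_iff_positive not_le of_nat_0_less_iff zero_less_Suc)
    then obtain c where c: "\<And>n. norm ((\<Sum>b\<in>B. c n b *\<^sub>R b) + v) < inverse (real (Suc n))" by metis
    define w where "w = (\<lambda>n. \<Sum>b\<in>B. c n b *\<^sub>R b)"
    have "(\<lambda>n. w n + v) \<longlonglongrightarrow> 0"
      using c LIMSEQ_inverse_real_of_nat unfolding w_def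
      by (intro Lim_null_comparison[OF always_eventually LIMSEQ_inverse_real_of_nat]) (auto intro: less_imp_le)
    then have wv: "w \<longlonglongrightarrow> - v" using tendsto_add[OF _ tendsto_const[of "-v"], of "\<lambda>n. w n + v" 0] by simp
    then have wc: "Cauchy w" by (rule LIMSEQ_imp_Cauchy)
    have "Cauchy (\<lambda>n. c n b)" if b: "b \<in> B" for b
    proof (rule CauchyI)
      fix e :: real assume "e > 0"
      then obtain N where N: "\<And>i j. i \<ge> N \<Longrightarrow> j \<ge> N \<Longrightarrow> norm (w i - w j) < m * e"
        using wc m(1) by (meson CauchyD mult_pos_pos)
      have "norm (c i b - c j b) < e" if "i \<ge> N" "j \<ge> N" for i j
      proof -
        have "m * norm (c i b - c j b) \<le> m * (\<Sum>b\<in>B. \<bar>c i b - c j b\<bar>)"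
          using m(1) b \<open>finite B\<close> by (intro mult_left_mono) (auto intro!: member_le_sum[of b B "\<lambda>b. \<bar>c i b - c j b\<bar>"])
        also have "\<dots> \<le> norm (w i - w j)" using m(2)[of "\<lambda>b. c i b - c j b"]
          by (simp add: w_def scaleR_diff_left sum_subtractf)
        also have "\<dots> < m * e" using N that by blast
        finally show ?thesis using m(1) by simp
      qed
      then show "\<exists>M. \<forall>i\<ge>M. \<forall>j\<ge>M. norm (c i b - c j b) < e" by blast
    qed
    then have "\<forall>b\<in>B. \<exists>l. (\<lambda>n. c n b) \<longlonglongrightarrow> l" by (simp add: real_Cauchy_convergent convergentD)
    then obtain l where l: "\<And>b. b \<in> B \<Longrightarrow> (\<lambda>n. c n b) \<longlonglongrightarrow> l b" by metis
    have "w \<longlonglongrightarrow> (\<Sum>b\<in>B. l b *\<^sub>R b)" unfolding w_def by (intro tendsto_intros l)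
    then have "- v = (\<Sum>b\<in>B. l b *\<^sub>R b)" using wv LIMSEQ_unique by blast
    then have "- v \<in> span B" by (auto intro: span_sum span_scale span_base)
    then show False using v span_neg by fastforce
  qed
  then obtain d where d: "d > 0" "\<And>c. d \<le> norm ((\<Sum>b\<in>B. c b *\<^sub>R b) + v)" by blast
  \<comment> \<open>The distance \<open>d\<close> bounds the coefficient of \<open>v\<close> by
    \<open>N / d\<close>, where \<open>N\<close> is the norm of the combination. The remaining
    coefficients then sum to at most \<open>N * (1 + norm v / d) / m\<close>. The inverse of
    \<open>e\<close> is the total of the two factors.\<close>
  define e where "e = inverse (inverse d + (1 + norm v / d) / m)"
  have pos: "inverse d + (1 + norm v / d) / m > 0" using d(1) m(1) by (simp add: add_pos_nonneg)
  have "e * (\<Sum>b\<in>insert v B. \<bar>c b\<bar>) \<le> norm (\<Sum>b\<in>insert v B. c b *\<^sub>R b)" for c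
  proof -
    define N where "N = norm (\<Sum>b\<in>insert v B. c b *\<^sub>R b)"
    have N: "N = norm (c v *\<^sub>R v + (\<Sum>b\<in>B. c b *\<^sub>R b))" using insert by (simp add: N_def)
    have 1: "\<bar>c v\<bar> * d \<le> N"
    proof (cases "c v = 0")
      case False
      have "d \<le> norm ((\<Sum>b\<in>B. (c b / c v) *\<^sub>R b) + v)" by (rule d(2))
      then have "\<bar>c v\<bar> * d \<le> \<bar>c v\<bar> * norm ((\<Sum>b\<in>B. (c b / c v) *\<^sub>R b) + v)" by (simp add: mult_left_mono)
      also have "\<dots> = norm (c v *\<^sub>R ((\<Sum>b\<in>B. (c b / c v) *\<^sub>R b) + v))" by simp
      also have "\<dots> = N" using False by (simp add: N scaleR_add_right scaleR_sum_right add.commute)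
      finally show ?thesis .
    qed (simp add: N_def)
    have "norm (\<Sum>b\<in>B. c b *\<^sub>R b) \<le> N + \<bar>c v\<bar> * norm v"
      using norm_triangle_ineq4[of "c v *\<^sub>R v + (\<Sum>b\<in>B. c b *\<^sub>R b)" "c v *\<^sub>R v"] by (simp add: N)
    then have 2: "m * (\<Sum>b\<in>B. \<bar>c b\<bar>) \<le> N + \<bar>c v\<bar> * norm v" using m(2)[of c] by linarith
    have cv: "\<bar>c v\<bar> \<le> N / d" using 1 d(1) by (simp add: field_simps)
    then have "\<bar>c v\<bar> * norm v \<le> N / d * norm v" by (rule mult_right_mono) simp
    then have "m * (\<Sum>b\<in>B. \<bar>c b\<bar>) \<le> N * (1 + norm v / d)" using 2 by (simp add: algebra_simps)
    then have "(\<Sum>b\<in>B. \<bar>c b\<bar>) \<le> N * (1 + norm v / d) / m" using m(1) by (simp add: field_simps)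
    then have "(\<Sum>b\<in>insert v B. \<bar>c b\<bar>) \<le> N * (inverse d + (1 + norm v / d) / m)"
      using cv insert by (simp add: field_simps)
    then show ?thesis using pos unfolding e_def N_def[symmetric] by (simp add: field_simps)
  qed
  moreover have "e > 0" using pos by (simp add: e_def)
  ultimately show ?case by blast
qed

lemma coords_exist:
  assumes "finite B" "span B = (UNIV :: 'e::real_normed_vector set)"
  shows "\<exists>C c. coords C (c :: 'e \<Rightarrow> 'e \<Rightarrow> real)"
proof -
  obtain C where C: "C \<subseteq> B" "independent C" "span C = UNIV"
    using maximal_independent_subset[of B] span_mono[of B] assms(2)
    by (metis span_mono span_span top.extremum_uniqueI)
  have fC: "finite C" using C(1) assms(1) finite_subset by blast
  obtain m where m: "m > 0" "\<And>c. m * (\<Sum>b\<in>C. \<bar>c b\<bar>) \<le> norm (\<Sum>b\<in>C. c b *\<^sub>R b)"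
    using basis_norm_bound[OF fC C(2)] by blast
  define c where "c = (\<lambda>b x. representation C x b)"
  have rep: "(\<Sum>b\<in>C. c b x *\<^sub>R b) = x" for x
    unfolding c_def using sum_representation_eq[OF C(2) _ fC subset_refl, of x] C(3) by simp
  have "bounded_linear (c b)" if b: "b \<in> C" for b
  proof (rule bounded_linear_intro)
    show "c b (x + y) = c b x + c b y" for x y
      unfolding c_def using representation_add[OF C(2), of y x] C(3) by (simp add: add.commute)
    show "c b (r *\<^sub>R x) = r *\<^sub>R c b x" for x r
      unfolding c_def using representation_scale[OF C(2), of x r] C(3) by simp
    show "norm (c b x) \<le> norm x * inverse m" for x
    proof -
      have "m * norm (c b x) \<le> m * (\<Sum>b\<in>C. \<bar>c b x\<bar>)"
        using m(1) b fC by (intro mult_left_mono) (auto intro!: member_le_sum[of b C "\<lambda>b. \<bar>c b x\<bar>"])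
      also have "\<dots> \<le> norm x" using m(2)[of "\<lambda>b. c b x"] rep by simp
      finally show ?thesis using m(1) by (simp add: field_simps)
    qed
  qed
  then show ?thesis using rep fC unfolding coords_def by metis
qed

lemma coords_prod:
  assumes "coords B (c :: 'e::real_normed_vector \<Rightarrow> 'e \<Rightarrow> real)" "coords C (d :: 'f::real_normed_vector \<Rightarrow> 'f \<Rightarrow> real)"
  shows "\<exists>D e. coords D (e :: ('e \<times> 'f) \<Rightarrow> ('e \<times> 'f) \<Rightarrow> real)"
proof (rule coords_exist)
  let ?D = "(\<lambda>b. (b, 0 :: 'f)) ` B \<union> (\<lambda>b. (0 :: 'e, b)) ` C"
  show "finite ?D" using assms by (simp add: coords_def)
  have "(x, y) \<in> span ?D" for x y
  proof -
    have x: "x = (\<Sum>b\<in>B. c b x *\<^sub>R b)" and y: "y = (\<Sum>b\<in>C. d b y *\<^sub>R b)" using assms by (auto simp: coords_def)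
    have "(x, y) = (\<Sum>b\<in>B. c b x *\<^sub>R (b, 0)) + (\<Sum>b\<in>C. d b y *\<^sub>R (0, b))"
      using x y by (simp add: sum_prod prod_eq_iff fst_sum snd_sum)
    also have "\<dots> \<in> span ?D" by (intro span_add span_sum span_scale span_base) auto
    finally show ?thesis .
  qed
  then show "span ?D = UNIV" by auto
qed

section \<open>Closure properties of smooth maps\<close>

lemma smooth_onD: "smooth_on S f \<Longrightarrow> Ck_on k S f"
  by (simp add: smooth_on_def)

lemma smooth_on_cong: "open S \<Longrightarrow> (\<And>x. x \<in> S \<Longrightarrow> f x = g x) \<Longrightarrow> smooth_on S f \<Longrightarrow> smooth_on S g"
  unfolding smooth_on_def using Ck_on_cong by blast

lemma smooth_on_subset: "smooth_on S f \<Longrightarrow> T \<subseteq> S \<Longrightarrow> smooth_on T f"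
  unfolding smooth_on_def using Ck_on_subset by blast

lemma smooth_on_local:
  "(\<And>x. x \<in> S \<Longrightarrow> \<exists>T. open T \<and> x \<in> T \<and> smooth_on T f) \<Longrightarrow> smooth_on S f"
  unfolding smooth_on_def by (intro allI Ck_on_local) meson

lemma smooth_on_const: "smooth_on S (\<lambda>x. c)"
  by (simp add: smooth_on_def Ck_on_const)

lemma smooth_on_bounded_linear: "bounded_linear f \<Longrightarrow> smooth_on S f"
  by (simp add: smooth_on_def Ck_on_bounded_linear)

lemma smooth_on_add: "open S \<Longrightarrow> smooth_on S f \<Longrightarrow> smooth_on S g \<Longrightarrow> smooth_on S (\<lambda>x. f x + g x)"
  by (simp add: smooth_on_def Ck_on_add)

lemma smooth_on_sum:
  "open S \<Longrightarrow> (\<And>i. i \<in> I \<Longrightarrow> smooth_on S (f i)) \<Longrightarrow> smooth_on S (\<lambda>x. \<Sum>i\<in>I. f i x)"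
  by (simp add: smooth_on_def Ck_on_sum)

lemma smooth_on_bilinear:
  "bounded_bilinear h \<Longrightarrow> open S \<Longrightarrow> smooth_on S f \<Longrightarrow> smooth_on S g \<Longrightarrow> smooth_on S (\<lambda>x. h (f x) (g x))"
  by (simp add: smooth_on_def Ck_on_bilinear)

lemmas smooth_on_mult = smooth_on_bilinear[OF bounded_bilinear_mult]

lemma smooth_on_linear_compose:
  "bounded_linear h \<Longrightarrow> open S \<Longrightarrow> smooth_on S f \<Longrightarrow> smooth_on S (\<lambda>x. h (f x))"
  by (simp add: smooth_on_def Ck_on_linear_compose)

lemma smooth_on_compose:
  fixes c :: "'e::real_normed_vector \<Rightarrow> 'e \<Rightarrow> real" and f :: "'a::real_normed_vector \<Rightarrow> 'e"
  shows "coords B c \<Longrightarrow> open S \<Longrightarrow> open T \<Longrightarrow> f ` S \<subseteq> T \<Longrightarrow> smooth_on T g \<Longrightarrow> smooth_on S f \<Longrightarrow> smooth_on S (\<lambda>x. g (f x))"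
  unfolding smooth_on_def using Ck_on_compose[where B = B and c = c and S = S and T = T and f = f] by blast

lemma smooth_on_has_derivative:
  "smooth_on S f \<Longrightarrow> x \<in> S \<Longrightarrow> (f has_derivative frechet_derivative f (at x)) (at x)"
  by (rule Ck_on_has_derivative[of 0]) (auto dest: smooth_onD simp del: Ck_on.simps)

lemma smooth_on_derivative: "smooth_on S f \<Longrightarrow> smooth_on S (\<lambda>x. frechet_derivative f (at x) v)"
  unfolding smooth_on_def by (metis Ck_on.simps(2))

lemma smooth_on_continuous: "smooth_on S f \<Longrightarrow> continuous_on S f"
  using smooth_onD[of S f 0] by simp

lemma smooth_on_affine:
  assumes "bounded_linear f" "open S"
  shows "smooth_on S (\<lambda>x. f x + a)"
  by (intro smooth_on_add smooth_on_bounded_linear smooth_on_const assms)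

text \<open>Differentiation under the integral sign. The derivative of
  \<open>f (x0 + t *\<^sub>R (x - x0))\<close> in \<open>x\<close> carries a factor
  \<open>t\<close>, so the weight rises from \<open>t ^ m\<close> to \<open>t ^ Suc m\<close>; with
  \<open>m\<close> arbitrary the family of integrals is closed under differentiation. Derivatives of
  \<open>f\<close> are known to be continuous only in each fixed direction, so the uniform estimates
  are made on basis directions and recombined by coordinates.\<close>

lemma leibniz_rule_segment:
  fixes f :: "'e::real_normed_vector \<Rightarrow> complex" and c :: "'e \<Rightarrow> 'e \<Rightarrow> real"
  assumes c: "coords B c" and S: "open S" "\<And>x t. x \<in> S \<Longrightarrow> 0 \<le> t \<Longrightarrow> t \<le> 1 \<Longrightarrow> x0 + t *\<^sub>R (x - x0) \<in> S"
    and f: "Ck_on (Suc 0) S f" and x: "x \<in> S"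
  shows "((\<lambda>x. integral {0..1} (\<lambda>t. t ^ m *\<^sub>R f (x0 + t *\<^sub>R (x - x0)))) has_derivative
    (\<lambda>v. integral {0..1} (\<lambda>t. t ^ Suc m *\<^sub>R frechet_derivative f (at (x0 + t *\<^sub>R (x - x0))) v))) (at x)"
proof -
  define p where "p = (\<lambda>t y. x0 + t *\<^sub>R (y - x0))"
  define D where "D = (\<lambda>y. frechet_derivative f (at y))"
  have pS: "p t y \<in> S" if "y \<in> S" "t \<in> {0..1}" for t y using S(2) that by (simp add: p_def)
  have D: "(f has_derivative D y) (at y)" if "y \<in> S" for y
    unfolding D_def using Ck_on_has_derivative[OF f that] .
  have cf: "continuous_on S f" using Ck_on_Suc_imp[OF f] by simp
  have cD: "continuous_on S (\<lambda>y. D y v)" for v using f by (simp add: D_def)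
  have cp: "continuous_on {0..1} (\<lambda>t. p t y)" for y unfolding p_def by (intro continuous_intros)
  have cfp: "continuous_on {0..1} (\<lambda>t. f (p t y))" if "y \<in> S" for y
    by (rule continuous_on_compose2[OF cf cp]) (use pS that in auto)
  have cDp: "continuous_on {0..1} (\<lambda>t. D (p t y) v)" if "y \<in> S" for y v
    by (rule continuous_on_compose2[OF cD cp]) (use pS that in auto)
  define L where "L = (\<lambda>v. integral {0..1} (\<lambda>t. t ^ Suc m *\<^sub>R D (p t x) v))"
  have Lsum: "L v = (\<Sum>b\<in>B. c b v *\<^sub>R L b)" for v
  proof -
    have "L v = integral {0..1} (\<lambda>t. \<Sum>b\<in>B. c b v *\<^sub>R (t ^ Suc m *\<^sub>R D (p t x) b))"
      unfolding L_def
    proof (rule integral_cong)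
      fix t :: real assume t: "t \<in> {0..1}"
      have "D (p t x) v = (\<Sum>b\<in>B. c b v *\<^sub>R D (p t x) b)"
        by (rule coords_linear[OF c has_derivative_linear[OF D[OF pS[OF x t]]]])
      then show "t ^ Suc m *\<^sub>R D (p t x) v = (\<Sum>b\<in>B. c b v *\<^sub>R (t ^ Suc m *\<^sub>R D (p t x) b))"
        by (simp add: scaleR_sum_right mult.commute mult.left_commute)
    qed
    also have "\<dots> = (\<Sum>b\<in>B. integral {0..1} (\<lambda>t. c b v *\<^sub>R (t ^ Suc m *\<^sub>R D (p t x) b)))"
      by (rule integral_sum) (use c in \<open>auto simp: coords_def intro!: integrable_continuous_interval continuous_intros cDp x\<close>)
    also have "\<dots> = (\<Sum>b\<in>B. c b v *\<^sub>R L b)"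
      unfolding L_def by (simp only: integral_cmul)
    finally show ?thesis .
  qed
  have bL: "bounded_linear L"
  proof -
    have "bounded_linear (\<lambda>v. \<Sum>b\<in>B. c b v *\<^sub>R L b)"
      using c by (intro bounded_linear_sum bounded_linear_scaleR_const) (auto simp: coords_def)
    then show ?thesis using Lsum by (metis (no_types, lifting) ext)
  qed
  \<comment> \<open>A linear map of size at most \<open>e'\<close> on every basis vector has
    operator norm at most \<open>M * e'\<close>. Below, \<open>e' = e / (M + 1)\<close>, where the
    \<open>1\<close> keeps the denominator positive.\<close>
  define M where "M = (\<Sum>b\<in>B. onorm (c b))"
  have M0: "M \<ge> 0" unfolding M_def using c by (intro sum_nonneg onorm_pos_le) (auto simp: coords_def)
  have "\<exists>d>0. \<forall>y. norm (y - x) < d \<longrightarrow> norm (integral {0..1} (\<lambda>t. t ^ m *\<^sub>R f (p t y)) - integral {0..1} (\<lambda>t. t ^ m *\<^sub>R f (p t x)) - L (y - x)) \<le> e * norm (y - x)"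
    if "e > 0" for e
  proof -
    define e' where "e' = e / (M + 1)"
    have e': "e' > 0" "M * e' \<le> e" using that M0 by (auto simp: e'_def field_simps)
    \<comment> \<open>Compactness of the interval yields one neighbourhood of \<open>x\<close> that
      serves all \<open>t\<close>.\<close>
    have "\<exists>X. open X \<and> x \<in> X \<and> (\<forall>y\<in>X \<inter> S. \<forall>t\<in>{0..1}. dist (D (p t y) b) (D (p t x) b) \<le> e')" for b
    proof -
      have "continuous_on (S \<times> {0..1}) (\<lambda>z. D (p (snd z) (fst z)) b)"
        by (rule continuous_on_compose2[OF cD, of _ "\<lambda>z. p (snd z) (fst z)"])
          (use pS in \<open>auto simp: p_def intro!: continuous_intros\<close>)
      from continuous_on_prod_compactE[OF this compact_Icc x e'(1)] show ?thesis by (metis fst_conv snd_conv)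
    qed
    then obtain X where X: "\<And>b. open (X b)" "\<And>b. x \<in> X b"
      "\<And>b y t. y \<in> X b \<Longrightarrow> y \<in> S \<Longrightarrow> t \<in> {0..1} \<Longrightarrow> dist (D (p t y) b) (D (p t x) b) \<le> e'"
      by (metis IntI)
    have "open (S \<inter> (\<Inter>b\<in>B. X b))" using c X(1) by (intro open_Int S(1) open_INT) (auto simp: coords_def)
    moreover have "x \<in> S \<inter> (\<Inter>b\<in>B. X b)" using x X by auto
    ultimately obtain d where d: "d > 0" "ball x d \<subseteq> S \<inter> (\<Inter>b\<in>B. X b)"
      by (meson open_contains_ball)
    show ?thesis
    proof (intro exI conjI allI impI)
      fix y assume "norm (y - x) < d"
      then have y: "y \<in> ball x d" by (simp add: dist_norm norm_minus_commute)
      then have yS: "y \<in> S" using d by auto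
      have key: "norm (f (p t y) - f (p t x) - D (p t x) (t *\<^sub>R (y - x))) \<le> e * norm (y - x)" if t: "t \<in> {0..1}" for t
      proof -
        have "norm (f (p t y) - f (p t x) - D (p t x) (p t y - p t x)) \<le> norm (p t y - p t x) * (M * e')"
        proof (rule differentiable_bound_linearization[where S = "p t ` ball x d" and f' = D])
          fix s :: real assume s: "s \<in> {0..1}"
          have "p t x + s *\<^sub>R (p t y - p t x) = p t (x + s *\<^sub>R (y - x))"
            by (simp add: p_def algebra_simps)
          moreover have "x + s *\<^sub>R (y - x) \<in> ball x d"
          proof -
            have "norm (s *\<^sub>R (y - x)) \<le> norm (y - x)" using s by (simp add: mult_left_le_one_le)
            then show ?thesis using \<open>norm (y - x) < d\<close> by (simp add: dist_norm)
          qed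
          ultimately show "p t x + s *\<^sub>R (p t y - p t x) \<in> p t ` ball x d" by simp
        next
          fix z assume "z \<in> p t ` ball x d"
          then obtain w where w: "w \<in> ball x d" "z = p t w" by auto
          then have wS: "w \<in> S" using d by auto
          show "(f has_derivative D z) (at z within p t ` ball x d)"
            using D[OF pS[OF wS t]] w by (simp add: has_derivative_at_withinI)
          show "onorm (D z - D (p t x)) \<le> M * e'"
          proof (rule onorm_bound)
            show "0 \<le> M * e'" using M0 e'(1) by simp
            fix v
            have "(D z - D (p t x)) v = D z v - D (p t x) v" by simp
            also have "\<dots> = (\<Sum>b\<in>B. c b v *\<^sub>R (D z b - D (p t x) b))"
              using coords_linear[OF c has_derivative_linear[OF D[OF pS[OF wS t]]], of v]
                coords_linear[OF c has_derivative_linear[OF D[OF pS[OF x t]]], of v] w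
              by (simp add: sum_subtractf scaleR_diff_right)
            also have "norm \<dots> \<le> (\<Sum>b\<in>B. norm (c b v *\<^sub>R (D z b - D (p t x) b)))" by (rule norm_sum)
            also have "\<dots> \<le> (\<Sum>b\<in>B. (onorm (c b) * norm v) * e')"
            proof (rule sum_mono)
              fix b assume b: "b \<in> B"
              have "norm (c b v) \<le> onorm (c b) * norm v" using onorm[of "c b" v] b c by (auto simp: coords_def)
              moreover have "norm (D z b - D (p t x) b) \<le> e'"
                using X(3)[of w b t] w d b wS t by (auto simp: dist_norm)
              ultimately show "norm (c b v *\<^sub>R (D z b - D (p t x) b)) \<le> (onorm (c b) * norm v) * e'"
                unfolding norm_scaleR by (intro mult_mono) auto
            qed
            also have "\<dots> = M * e' * norm v" by (simp add: M_def sum_distrib_right sum_distrib_left mult_ac)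
            finally show "norm ((D z - D (p t x)) v) \<le> M * e' * norm v" .
          qed
        next
          show "p t x \<in> p t ` ball x d" using d by auto
        qed
        also have "p t y - p t x = t *\<^sub>R (y - x)" by (simp add: p_def algebra_simps)
        also have "norm (t *\<^sub>R (y - x)) * (M * e') \<le> norm (y - x) * e"
          using t e' M0 by (intro mult_mono) (auto simp: mult_left_le_one_le)
        finally show ?thesis by (simp add: mult.commute)
      qed
      have eq: "integral {0..1} (\<lambda>t. t ^ m *\<^sub>R f (p t y)) - integral {0..1} (\<lambda>t. t ^ m *\<^sub>R f (p t x)) - L (y - x)
         = integral {0..1} (\<lambda>t. t ^ m *\<^sub>R (f (p t y) - f (p t x) - D (p t x) (t *\<^sub>R (y - x))))"
      proof -
        have i: "(\<lambda>t. t ^ m *\<^sub>R f (p t y)) integrable_on {0..1}" "(\<lambda>t. t ^ m *\<^sub>R f (p t x)) integrable_on {0..1}"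
          "(\<lambda>t. t ^ Suc m *\<^sub>R D (p t x) (y - x)) integrable_on {0..1}"
          by (intro integrable_continuous_interval continuous_intros cfp cDp yS x)+
        have "integral {0..1} (\<lambda>t. t ^ m *\<^sub>R (f (p t y) - f (p t x) - D (p t x) (t *\<^sub>R (y - x))))
          = integral {0..1} (\<lambda>t. t ^ m *\<^sub>R f (p t y) - t ^ m *\<^sub>R f (p t x) - t ^ Suc m *\<^sub>R D (p t x) (y - x))"
        proof (rule integral_cong)
          fix t :: real assume "t \<in> {0..1}"
          then have "D (p t x) (t *\<^sub>R (y - x)) = t *\<^sub>R D (p t x) (y - x)"
            using linear_cmul[OF has_derivative_linear[OF D[OF pS[OF x]]]] by blast
          then show "t ^ m *\<^sub>R (f (p t y) - f (p t x) - D (p t x) (t *\<^sub>R (y - x)))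
            = t ^ m *\<^sub>R f (p t y) - t ^ m *\<^sub>R f (p t x) - t ^ Suc m *\<^sub>R D (p t x) (y - x)"
            by (simp add: scaleR_diff_right mult.commute)
        qed
        also have "\<dots> = integral {0..1} (\<lambda>t. t ^ m *\<^sub>R f (p t y)) - integral {0..1} (\<lambda>t. t ^ m *\<^sub>R f (p t x)) - L (y - x)"
          unfolding L_def using i by (simp only: integral_diff integrable_diff)
        finally show ?thesis by simp
      qed
      have "norm (integral {0..1} (\<lambda>t. t ^ m *\<^sub>R (f (p t y) - f (p t x) - D (p t x) (t *\<^sub>R (y - x))))) \<le> e * norm (y - x) * (1 - 0)"
      proof (rule integral_bound)
        have "continuous_on {0..1} (\<lambda>t. t ^ m *\<^sub>R (f (p t y) - f (p t x) - t *\<^sub>R D (p t x) (y - x)))"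
          by (intro continuous_intros cfp cDp yS x)
        moreover have "D (p t x) (t *\<^sub>R (y - x)) = t *\<^sub>R D (p t x) (y - x)" if "t \<in> {0..1}" for t
          using linear_cmul[OF has_derivative_linear[OF D[OF pS[OF x that]]]] by blast
        ultimately show "continuous_on {0..1} (\<lambda>t. t ^ m *\<^sub>R (f (p t y) - f (p t x) - D (p t x) (t *\<^sub>R (y - x))))"
          by (simp cong: continuous_on_cong_simp)
      next
        fix t :: real assume t: "t \<in> {0..1}"
        have "norm (t ^ m *\<^sub>R (f (p t y) - f (p t x) - D (p t x) (t *\<^sub>R (y - x)))) = \<bar>t ^ m\<bar> * norm (f (p t y) - f (p t x) - D (p t x) (t *\<^sub>R (y - x)))"
          by simp
        also have "\<dots> \<le> 1 * norm (f (p t y) - f (p t x) - D (p t x) (t *\<^sub>R (y - x)))"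
          using t by (intro mult_right_mono) (auto simp: power_le_one)
        finally show "norm (t ^ m *\<^sub>R (f (p t y) - f (p t x) - D (p t x) (t *\<^sub>R (y - x)))) \<le> e * norm (y - x)"
          using key[OF t] by simp
      qed simp
      then show "norm (integral {0..1} (\<lambda>t. t ^ m *\<^sub>R f (p t y)) - integral {0..1} (\<lambda>t. t ^ m *\<^sub>R f (p t x)) - L (y - x)) \<le> e * norm (y - x)"
        using eq by simp
    qed (fact d(1))
  qed
  then have "((\<lambda>y. integral {0..1} (\<lambda>t. t ^ m *\<^sub>R f (p t y))) has_derivative L) (at x)"
    using bL unfolding has_derivative_at_alt by blast
  then show ?thesis unfolding L_def D_def p_def .
qed

lemma Ck_on_segment_integral:
  fixes f :: "'e::real_normed_vector \<Rightarrow> complex" and c :: "'e \<Rightarrow> 'e \<Rightarrow> real"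
  assumes c: "coords B c" and S: "open S" "\<And>x t. x \<in> S \<Longrightarrow> 0 \<le> t \<Longrightarrow> t \<le> 1 \<Longrightarrow> x0 + t *\<^sub>R (x - x0) \<in> S"
  shows "Ck_on k S f \<Longrightarrow> Ck_on k S (\<lambda>x. integral {0..1} (\<lambda>t. t ^ m *\<^sub>R f (x0 + t *\<^sub>R (x - x0))))"
proof (induction k arbitrary: f m)
  case 0
  have "continuous_on (S \<times> cbox 0 1) (\<lambda>(x, t). t ^ m *\<^sub>R f (x0 + t *\<^sub>R (x - x0)))"
    unfolding split_beta
    by (intro continuous_intros continuous_on_compose2[of S f _ "\<lambda>z. x0 + snd z *\<^sub>R (fst z - x0)"])
      (use 0 S in auto)
  from integral_continuous_on_param[OF this] show ?case by simp
next
  case (Suc k)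
  have "Ck_on (Suc 0) S f" using Suc.prems by (induction k) (auto dest: Ck_on_Suc_imp simp del: Ck_on.simps)
  note d = leibniz_rule_segment[OF c S this]
  show ?case
  proof (rule Ck_on_SucI[OF S(1) d])
    show "Ck_on k S (\<lambda>x. integral {0..1} (\<lambda>t. t ^ Suc m *\<^sub>R frechet_derivative f (at (x0 + t *\<^sub>R (x - x0))) v))" for v
      by (rule Suc.IH) (use Suc.prems in simp)
  qed
qed

text \<open>Integrate the derivative of \<open>f\<close> along the segment from \<open>x0\<close> to
  \<open>x\<close> and expand the direction \<open>x - x0\<close> in coordinates. The functions
  \<open>g b\<close> are the averages of the partial derivatives over the segment; at
  \<open>x0\<close> the segment is a point.\<close>

lemma hadamard:
  fixes f :: "'e::real_normed_vector \<Rightarrow> complex" and c :: "'e \<Rightarrow> 'e \<Rightarrow> real"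
  assumes c: "coords B c" and S: "open S" "convex S" "x0 \<in> S" and f: "smooth_on S f"
  shows "\<exists>g. (\<forall>b\<in>B. smooth_on S (g b) \<and> g b x0 = frechet_derivative f (at x0) b) \<and>
    (\<forall>x\<in>S. f x = f x0 + (\<Sum>b\<in>B. c b (x - x0) *\<^sub>R g b x))"
proof -
  have star: "x0 + t *\<^sub>R (x - x0) \<in> S" if "x \<in> S" "0 \<le> t" "t \<le> 1" for x t
    using convexD_alt[OF S(2,3) that] by (simp add: algebra_simps)
  \<comment> \<open>The factor \<open>t ^ 0\<close> brings the average into the form of
    \<open>Ck_on_segment_integral\<close>.\<close>
  define g where "g = (\<lambda>b x. integral {0..1} (\<lambda>t::real. t ^ 0 *\<^sub>R frechet_derivative f (at (x0 + t *\<^sub>R (x - x0))) b))"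
  have 1: "smooth_on S (g b)" for b
    unfolding smooth_on_def g_def
    using Ck_on_segment_integral[OF c S(1) star smooth_onD[OF smooth_on_derivative[OF f]]] by blast
  have 2: "g b x0 = frechet_derivative f (at x0) b" for b by (simp add: g_def)
  have 3: "f x = f x0 + (\<Sum>b\<in>B. c b (x - x0) *\<^sub>R g b x)" if x: "x \<in> S" for x
  proof -
    let ?p = "\<lambda>t. x0 + t *\<^sub>R (x - x0)"
    have D: "(f has_derivative frechet_derivative f (at (?p t))) (at (?p t))" if "t \<in> {0..1}" for t
      using smooth_on_has_derivative[OF f] star x that by simp
    have "((\<lambda>t. f (?p t)) has_vector_derivative frechet_derivative f (at (?p t)) (x - x0)) (at t within {0..1})" if t: "t \<in> {0..1}" for t
    proof -
      have "(?p has_derivative (\<lambda>s. s *\<^sub>R (x - x0))) (at t within {0..1})"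
        by (auto intro!: derivative_eq_intros)
      from has_derivative_in_compose[OF this has_derivative_at_withinI[OF D[OF t]]]
      show ?thesis unfolding has_vector_derivative_def
        by (simp add: linear_cmul[OF has_derivative_linear[OF D[OF t]]])
    qed
    then have "((\<lambda>t. frechet_derivative f (at (?p t)) (x - x0)) has_integral (f (?p 1) - f (?p 0))) {0..1}"
      by (intro fundamental_theorem_of_calculus) auto
    then have "f x - f x0 = integral {0..1} (\<lambda>t. frechet_derivative f (at (?p t)) (x - x0))"
      by (simp add: integral_unique)
    also have "\<dots> = integral {0..1} (\<lambda>t. \<Sum>b\<in>B. c b (x - x0) *\<^sub>R frechet_derivative f (at (?p t)) b)"
      by (intro integral_cong coords_linear[OF c has_derivative_linear[OF D]])
    also have "\<dots> = (\<Sum>b\<in>B. c b (x - x0) *\<^sub>R g b x)"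
    proof (subst integral_sum)
      have "continuous_on {0..1} (\<lambda>t. frechet_derivative f (at (?p t)) b)" for b
        by (rule continuous_on_compose2[OF smooth_on_continuous[OF smooth_on_derivative[OF f]], of _ ?p])
          (use star x in \<open>auto intro!: continuous_intros\<close>)
      then show "(\<lambda>t. c b (x - x0) *\<^sub>R frechet_derivative f (at (?p t)) b) integrable_on {0..1}" for b
        by (intro integrable_continuous_interval continuous_intros)
    qed (use c in \<open>auto simp: g_def coords_def\<close>)
    finally show ?thesis by (simp add: algebra_simps)
  qed
  show ?thesis using 1 2 3 by blast
qed

text \<open>Restrict \<open>f\<close> to the plane \<open>p s t\<close>. By the fundamental theorem
  \<open>f (p s t)\<close> is an integral in the direction \<open>u\<close>; differentiating under
  the integral in the direction \<open>v\<close> writes \<open>D v (p s 0)\<close> as the integral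
  of the mixed derivative \<open>A\<close>. Differentiating this integral in \<open>s\<close> at
  \<open>0\<close> gives back \<open>A\<close>.\<close>

lemma second_derivative_commute:
  fixes f :: "'e::real_normed_vector \<Rightarrow> complex"
  assumes S: "open S" "x \<in> S" and f: "smooth_on S f"
  shows "frechet_derivative (\<lambda>y. frechet_derivative f (at y) v) (at x) u
    = frechet_derivative (\<lambda>y. frechet_derivative f (at y) u) (at x) v"
proof -
  define p where "p = (\<lambda>s t. x + s *\<^sub>R u + t *\<^sub>R v)"
  define D where "D = (\<lambda>w y. frechet_derivative f (at y) w)"
  have sD: "smooth_on S (D w)" for w unfolding D_def by (rule smooth_on_derivative[OF f])
  obtain d where d: "d > 0" "ball x d \<subseteq> S" using S by (meson open_contains_ball)
  \<comment> \<open>Parameters smaller than \<open>e\<close> keep \<open>p s t\<close> in the ball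
    of radius \<open>d\<close>. The summand \<open>1\<close> makes the bound strict and covers the
    case where both vectors vanish.\<close>
  define e where "e = d / (norm u + norm v + 1)"
  have e: "e > 0" using d(1) by (simp add: e_def add_nonneg_pos)
  have pS: "p s t \<in> S" if "s \<in> {-e<..<e}" "t \<in> {-e<..<e}" for s t
  proof -
    have "norm (s *\<^sub>R u + t *\<^sub>R v) \<le> \<bar>s\<bar> * norm u + \<bar>t\<bar> * norm v"
      by (metis norm_scaleR norm_triangle_ineq)
    also have "\<dots> \<le> e * norm u + e * norm v" using that by (intro add_mono mult_right_mono) auto
    also have "\<dots> < e * (norm u + norm v + 1)" using e by (simp add: algebra_simps)
    also have "\<dots> = d" by (simp add: e_def add_nonneg_eq_0_iff)
    finally have "norm (p s t - x) < d" by (simp add: p_def add.assoc)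
    then have "p s t \<in> ball x d" by (simp add: dist_norm norm_minus_commute)
    then show ?thesis using d(2) by blast
  qed
  have der_s: "((\<lambda>s. g (p s t)) has_vector_derivative frechet_derivative g (at (p s t)) u) (at s within T)"
    if "smooth_on S g" "s \<in> {-e<..<e}" "t \<in> {-e<..<e}" for s t T and g :: "'e \<Rightarrow> complex"
  proof -
    note D = smooth_on_has_derivative[OF that(1) pS[OF that(2,3)]]
    have "((\<lambda>s. p s t) has_derivative (\<lambda>r. r *\<^sub>R u)) (at s within T)"
      unfolding p_def by (auto intro!: derivative_eq_intros)
    from has_derivative_in_compose[OF this has_derivative_at_withinI[OF D]]
    show ?thesis unfolding has_vector_derivative_def
      by (simp add: linear_cmul[OF has_derivative_linear[OF D]])
  qed
  have der_t: "((\<lambda>t. g (p s t)) has_vector_derivative frechet_derivative g (at (p s t)) v) (at t within T)"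
    if "smooth_on S g" "s \<in> {-e<..<e}" "t \<in> {-e<..<e}" for s t T and g :: "'e \<Rightarrow> complex"
  proof -
    note D = smooth_on_has_derivative[OF that(1) pS[OF that(2,3)]]
    have "((\<lambda>t. p s t) has_derivative (\<lambda>r. r *\<^sub>R v)) (at t within T)"
      unfolding p_def by (auto intro!: derivative_eq_intros)
    from has_derivative_in_compose[OF this has_derivative_at_withinI[OF D]]
    show ?thesis unfolding has_vector_derivative_def
      by (simp add: linear_cmul[OF has_derivative_linear[OF D]])
  qed
  \<comment> \<open>Half of \<open>e\<close>, so that the closed interval \<open>{0..h}\<close> fits
    into the open parameter range.\<close>
  define h where "h = e / 2"
  have h: "0 < h" "{0..h} \<subseteq> {-e<..<e}" "{-h<..<h} \<subseteq> {-e<..<e}" "h < e" using e by (auto simp: h_def)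
  define A where "A = (\<lambda>y. frechet_derivative (D u) (at y) v)"
  have sA: "smooth_on S A" unfolding A_def by (rule smooth_on_derivative[OF sD])
  have cont: "continuous_on (T1 \<times> T2) (\<lambda>z. g (p (snd z) (fst z)))"
    if "smooth_on S g" "T1 \<subseteq> {-e<..<e}" "T2 \<subseteq> {-e<..<e}" for g :: "'e \<Rightarrow> complex" and T1 T2
  proof (rule continuous_on_compose2[OF smooth_on_continuous[OF that(1)], of _ "\<lambda>z. p (snd z) (fst z)"])
    show "continuous_on (T1 \<times> T2) (\<lambda>z. p (snd z) (fst z))" unfolding p_def by (intro continuous_intros)
    show "(\<lambda>z. p (snd z) (fst z)) ` (T1 \<times> T2) \<subseteq> S"
      using pS subsetD[OF that(2)] subsetD[OF that(3)] by fastforce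
  qed
  have cont1: "continuous_on T (\<lambda>s. g (p s t))"
    if "smooth_on S g" "T \<subseteq> {-e<..<e}" "t \<in> {-e<..<e}" for g :: "'e \<Rightarrow> complex" and T t
    by (rule continuous_on_compose2[OF smooth_on_continuous[OF that(1)], of _ "\<lambda>s. p s t"])
      (use pS that(2,3) in \<open>auto simp: p_def intro!: continuous_intros\<close>)
  have I1: "f (p s t) = f (p 0 t) + integral {0..s} (\<lambda>r. D u (p r t))" if s: "s \<in> {0..h}" and t: "t \<in> {-h<..<h}" for s t
  proof -
    have "((\<lambda>r. D u (p r t)) has_integral (f (p s t) - f (p 0 t))) {0..s}"
      unfolding D_def using s h t
      by (intro fundamental_theorem_of_calculus der_s[OF f]) auto
    then show ?thesis by (simp add: integral_unique)
  qed
  have I2: "D v (p s 0) = D v (p 0 0) + integral {0..s} (\<lambda>r. A (p r 0))" if s: "s \<in> {0..h}" for s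
  proof -
    have s': "{0..s} \<subseteq> {-e<..<e}" using s h by auto
    have "((\<lambda>t. integral (cbox 0 s) (\<lambda>r. D u (p r t))) has_vector_derivative integral (cbox 0 s) (\<lambda>r. A (p r 0))) (at 0 within {-h<..<h})"
    proof (rule leibniz_rule_vector_derivative[where U = "{-h<..<h}" and fx = "\<lambda>t r. A (p r t)"])
      show "((\<lambda>t. D u (p r t)) has_vector_derivative A (p r t)) (at t within {-h<..<h})"
        if "t \<in> {-h<..<h}" "r \<in> cbox 0 s" for t r
        unfolding A_def using that s' h by (intro der_t[OF sD]) auto
      show "(\<lambda>r. D u (p r t)) integrable_on cbox 0 s" if "t \<in> {-h<..<h}" for t
        unfolding cbox_interval
        using that s' h by (intro integrable_continuous_interval cont1[OF sD]) auto
      show "continuous_on ({-h<..<h} \<times> cbox 0 s) (\<lambda>(t, r). A (p r t))"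
        unfolding split_beta using cont[OF sA h(3) s'] by simp
    qed (use h in auto)
    moreover have "((\<lambda>t. f (p 0 t)) has_vector_derivative D v (p 0 0)) (at 0 within {-h<..<h})"
      unfolding D_def using e by (intro der_t[OF f]) auto
    ultimately have "((\<lambda>t. f (p 0 t) + integral {0..s} (\<lambda>r. D u (p r t))) has_vector_derivative D v (p 0 0) + integral {0..s} (\<lambda>r. A (p r 0))) (at 0 within {-h<..<h})"
      by (auto intro: has_vector_derivative_add)
    then have "((\<lambda>t. f (p s t)) has_vector_derivative D v (p 0 0) + integral {0..s} (\<lambda>r. A (p r 0))) (at 0 within {-h<..<h})"
      using I1[OF s] h(1) by (rule_tac has_vector_derivative_transform[rotated 2]) auto
    moreover have "((\<lambda>t. f (p s t)) has_vector_derivative D v (p s 0)) (at 0 within {-h<..<h})"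
      unfolding D_def using s h by (intro der_t[OF f]) auto
    ultimately show ?thesis
      using h(1) by (metis at_within_open[of 0 "{-h<..<h}"] greaterThanLessThan_iff neg_less_0_iff_less open_greaterThanLessThan vector_derivative_at)
  qed
  \<comment> \<open>The integral starts at \<open>0\<close>, so its derivative there is one-sided.
    Derivatives within \<open>{0..h}\<close> are still unique, which is enough to compare the
    two.\<close>
  have "((\<lambda>s. integral {0..s} (\<lambda>r. A (p r 0))) has_vector_derivative A (p 0 0)) (at 0 within {0..h})"
    using h e by (intro integral_has_vector_derivative cont1[OF sA]) auto
  then have "((\<lambda>s. D v (p 0 0) + integral {0..s} (\<lambda>r. A (p r 0))) has_vector_derivative 0 + A (p 0 0)) (at 0 within {0..h})"
    by (intro has_vector_derivative_add has_vector_derivative_const)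
  from has_vector_derivative_transform[OF _ I2 this] h(1)
  have "((\<lambda>s. D v (p s 0)) has_vector_derivative A (p 0 0)) (at 0 within {0..h})" by simp
  moreover have "((\<lambda>s. D v (p s 0)) has_vector_derivative frechet_derivative (D v) (at (p 0 0)) u) (at 0 within {0..h})"
    using e by (intro der_s[OF sD]) auto
  ultimately have "A (p 0 0) = frechet_derivative (D v) (at (p 0 0)) u"
    using h(1) by (intro vector_derivative_unique_within_closed_interval[of 0 h 0 "\<lambda>s. D v (p s 0)"]) auto
  then show ?thesis by (simp add: A_def p_def D_def)
qed

section \<open>Flat functions and bump functions\<close>

definition poly_exp :: "real poly \<Rightarrow> real \<Rightarrow> real" where
  "poly_exp P t = (if t > 0 then poly P (inverse t) * exp (- inverse t) else 0)"

lemma poly_exp_tendsto_0: "(poly_exp P \<longlongrightarrow> 0) (at 0)"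
proof -
  have "((\<lambda>s. \<Sum>i\<le>degree P. coeff P i * (s ^ i / exp s)) \<longlongrightarrow> (\<Sum>i\<le>degree P. coeff P i * 0)) at_top"
    by (intro tendsto_intros tendsto_power_div_exp_0)
  then have "((\<lambda>s. poly P s * exp (- s)) \<longlongrightarrow> 0) at_top"
    by (simp add: poly_altdef sum_distrib_right sum_divide_distrib exp_minus field_simps)
  from filterlim_compose[OF this filterlim_inverse_at_top_right]
  have "((\<lambda>t. poly P (inverse t) * exp (- inverse t)) \<longlongrightarrow> 0) (at_right 0)" .
  then have "(poly_exp P \<longlongrightarrow> 0) (at_right 0)"
    by (rule Lim_transform_eventually) (auto simp: poly_exp_def eventually_at_filter)
  moreover have "(poly_exp P \<longlongrightarrow> 0) (at_left 0)"
    by (rule Lim_transform_eventually[OF tendsto_const]) (auto simp: poly_exp_def eventually_at_filter)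
  ultimately show ?thesis using filterlim_split_at by blast
qed

text \<open>In the variable \<open>s = 1 / t\<close> the operator \<open>d/dt\<close> is
  \<open>- s^2 d/ds\<close>, and it sends \<open>P(s) exp(-s)\<close> to
  \<open>s^2 (P - P')(s) exp(-s)\<close>; the polynomial \<open>[:0, 0, 1:]\<close> is
  \<open>s^2\<close>.\<close>

lemma poly_exp_has_derivative:
  "(poly_exp P has_field_derivative poly_exp ([:0, 0, 1:] * (P - pderiv P)) t) (at t)"
proof (cases t "0::real" rule: linorder_cases)
  case less
  have "((\<lambda>t. 0) has_field_derivative 0) (at t)" by simp
  then have "(poly_exp P has_field_derivative 0) (at t)"
    by (rule has_field_derivative_transform_within_open[of _ _ _ "{..<0}"]) (use less in \<open>auto simp: poly_exp_def\<close>)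
  then show ?thesis using less by (simp add: poly_exp_def)
next
  case equal
  \<comment> \<open>Dividing by \<open>h\<close> multiplies the polynomial by its variable, so the
    difference quotient is again a member of the family, namely
    \<open>poly_exp (pCons 0 P)\<close>.\<close>
  have "((\<lambda>h. (poly_exp P (0 + h) - poly_exp P 0) / h) \<longlongrightarrow> 0) (at 0)"
    by (rule Lim_transform_eventually[OF poly_exp_tendsto_0[of "pCons 0 P"]])
      (auto simp: poly_exp_def eventually_at_filter field_simps)
  then show ?thesis using equal by (simp add: DERIV_def poly_exp_def)
next
  case greater
  have "((\<lambda>t. poly P (inverse t) * exp (- inverse t)) has_field_derivative poly_exp ([:0, 0, 1:] * (P - pderiv P)) t) (at t)"
    using greater
    by (auto intro!: derivative_eq_intros simp: poly_exp_def power2_eq_square algebra_simps)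
  then show ?thesis
    by (rule has_field_derivative_transform_within_open[of _ _ _ "{0<..}"]) (use greater in \<open>auto simp: poly_exp_def\<close>)
qed

text \<open>The family is closed under differentiation, up to constant factors from the direction,
  so one induction on the order with \<open>P\<close> arbitrary is enough. For \<open>P = 1\<close>
  it is the usual \<open>exp (- 1 / t)\<close>.\<close>

lemma smooth_on_poly_exp: "smooth_on S (poly_exp P)"
proof -
  have "Ck_on k UNIV (poly_exp P)" for k
  proof (induction k arbitrary: P)
    case 0
    then show ?case using DERIV_isCont[OF poly_exp_has_derivative]
      by (auto intro!: continuous_at_imp_continuous_on)
  next
    case (Suc k)
    let ?Q = "[:0, 0, 1:] * (P - pderiv P)"
    show ?case
    proof (rule Ck_on_SucI[where D = "\<lambda>v t. poly_exp ?Q t * v"])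
      show "(poly_exp P has_derivative (\<lambda>v. poly_exp ?Q t * v)) (at t)" for t
        using poly_exp_has_derivative[of P t] by (simp add: has_field_derivative_def)
      show "Ck_on k UNIV (\<lambda>t. poly_exp ?Q t * v)" for v
        by (rule Ck_on_bilinear[OF bounded_bilinear_mult open_UNIV Suc.IH Ck_on_const])
    qed simp
  qed
  then have "smooth_on UNIV (poly_exp P)" by (simp add: smooth_on_def)
  then show ?thesis by (rule smooth_on_subset) simp
qed

lemma coords_real: "coords {1} (\<lambda>b x. x :: real)"
  by (simp add: coords_def bounded_linear_ident)

text \<open>A norm is in general not smooth, so the distance from \<open>x0\<close> is measured by
  the sum of the squares of the coordinates, and the flat function is composed with
  \<open>r\<^sup>2\<close> minus this sum. The closed set \<open>D\<close> containing the support is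
  what is later transported to the manifold.\<close>

lemma smooth_bump:
  fixes x0 :: "'e::real_normed_vector" and c :: "'e \<Rightarrow> 'e \<Rightarrow> real"
  assumes c: "coords B c" and T: "open T" "x0 \<in> T"
  shows "\<exists>(h :: 'e \<Rightarrow> complex) D. smooth_on UNIV h \<and> h x0 \<noteq> 0 \<and> closed D \<and> D \<subseteq> T \<and> (\<forall>x. x \<notin> D \<longrightarrow> h x = 0)"
proof -
  have bl: "bounded_linear (c b)" if "b \<in> B" for b using c that by (simp add: coords_def)
  have fB: "finite B" using c by (simp add: coords_def)
  obtain e where e: "e > 0" "ball x0 e \<subseteq> T" using T by (meson open_contains_ball)
  \<comment> \<open>Coordinates of absolute value at most \<open>r\<close> give a vector of norm at
    most \<open>r\<close> times the sum of the \<open>norm b\<close>. The summand \<open>1\<close>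
    makes this strictly smaller than \<open>e\<close>, and the denominator positive.\<close>
  define r where "r = e / ((\<Sum>b\<in>B. norm b) + 1)"
  have r: "r > 0" using e by (simp add: r_def add_nonneg_pos sum_nonneg)
  define q where "q = (\<lambda>x. r\<^sup>2 - (\<Sum>b\<in>B. (c b (x - x0)) * (c b (x - x0))))"
  define D where "D = {x. (\<Sum>b\<in>B. (c b (x - x0)) * (c b (x - x0))) \<le> r\<^sup>2}"
  have sc: "smooth_on UNIV (\<lambda>x. c b (x - x0))" if "b \<in> B" for b
    using smooth_on_affine[OF bl[OF that] open_UNIV, of "- c b x0"] bl[OF that]
    by (simp add: linear_diff bounded_linear.linear)
  have ss: "smooth_on UNIV (\<lambda>x. \<Sum>b\<in>B. (c b (x - x0)) * (c b (x - x0)))"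
    by (intro smooth_on_sum smooth_on_mult sc open_UNIV)
  have sq: "smooth_on UNIV q"
    using smooth_on_add[OF open_UNIV smooth_on_const[of UNIV "r\<^sup>2"] smooth_on_linear_compose[OF bounded_linear_minus[OF bounded_linear_ident] open_UNIV ss]]
    unfolding q_def by simp
  have "smooth_on UNIV (\<lambda>x. complex_of_real (poly_exp 1 (q x)))"
    by (intro smooth_on_linear_compose[OF bounded_linear_of_real open_UNIV]
        smooth_on_compose[OF coords_real open_UNIV open_UNIV _ smooth_on_poly_exp sq]) simp
  moreover have "complex_of_real (poly_exp 1 (q x0)) \<noteq> 0"
    using r bl by (simp add: poly_exp_def q_def linear_0 bounded_linear.linear)
  moreover have "closed D" unfolding D_def
    by (intro closed_Collect_le continuous_on_const) (use smooth_on_continuous[OF ss] in simp)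
  moreover have "D \<subseteq> T"
  proof
    fix x assume "x \<in> D"
    then have le: "(\<Sum>b\<in>B. (c b (x - x0)) * (c b (x - x0))) \<le> r\<^sup>2" by (simp add: D_def)
    have "\<bar>c b (x - x0)\<bar> \<le> r" if "b \<in> B" for b
    proof -
      have "(c b (x - x0))\<^sup>2 \<le> (\<Sum>b\<in>B. (c b (x - x0)) * (c b (x - x0)))"
        unfolding power2_eq_square using fB that
        by (intro member_le_sum[of b B "\<lambda>b. c b (x - x0) * c b (x - x0)"]) auto
      then have "(c b (x - x0))\<^sup>2 \<le> r\<^sup>2" using le by linarith
      then show ?thesis using r by (simp add: abs_le_square_iff[symmetric])
    qed
    then have "norm (\<Sum>b\<in>B. c b (x - x0) *\<^sub>R b) \<le> (\<Sum>b\<in>B. r * norm b)"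
      by (intro sum_norm_le) (auto intro: mult_right_mono)
    moreover have "(\<Sum>b\<in>B. c b (x - x0) *\<^sub>R b) = x - x0" using c by (metis coords_def)
    moreover have "(\<Sum>b\<in>B. r * norm b) < r * ((\<Sum>b\<in>B. norm b) + 1)" using r by (simp add: sum_distrib_left algebra_simps)
    moreover have "r * ((\<Sum>b\<in>B. norm b) + 1) = e"
      by (simp add: r_def add_nonneg_eq_0_iff sum_nonneg)
    ultimately have "norm (x - x0) < e" by simp
    then show "x \<in> T" using e by (auto simp: dist_norm norm_minus_commute)
  qed
  moreover have "complex_of_real (poly_exp 1 (q x)) = 0" if "x \<notin> D" for x
    using that by (simp add: D_def q_def poly_exp_def)
  ultimately show ?thesis by blast
qed

section \<open>Tangent vectors as derivations\<close>

lemma smooth_on_Pair: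
  assumes "open S" "smooth_on S f" "smooth_on S g"
  shows "smooth_on S (\<lambda>x. (f x, g x))"
proof -
  have "bounded_linear (\<lambda>a. (a, 0))" "bounded_linear (\<lambda>a. (0, a))"
    by (intro bounded_linear_Pair bounded_linear_ident bounded_linear_zero)+
  from smooth_on_add[OF assms(1) smooth_on_linear_compose[OF this(1) assms(1,2)] smooth_on_linear_compose[OF this(2) assms(1,3)]]
  show ?thesis by simp
qed

lemma smooth_manifoldD:
  assumes "smooth_manifold A" "(U, \<phi>) \<in> A"
  shows "open U" "open (\<phi> ` U)" "homeomorphism U (\<phi> ` U) \<phi> (inv_into U \<phi>)" "inj_on \<phi> U"
    "continuous_on U \<phi>" "continuous_on (\<phi> ` U) (inv_into U \<phi>)"
proof -
  have "\<forall>x\<in>A. open (fst x) \<and> open (snd x ` fst x) \<and> homeomorphism (fst x) (snd x ` fst x) (snd x) (inv_into (fst x) (snd x))"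
    using assms(1) unfolding smooth_manifold_def split_beta by (elim conjE)
  from bspec[OF this assms(2)]
  show "open U" "open (\<phi> ` U)" and h: "homeomorphism U (\<phi> ` U) \<phi> (inv_into U \<phi>)" by simp_all
  show "continuous_on U \<phi>" "continuous_on (\<phi> ` U) (inv_into U \<phi>)"
    using h by (simp_all add: homeomorphism_def)
  show "inj_on \<phi> U" by (rule inj_on_inverseI) (rule homeomorphism_apply1[OF h])
qed

lemma smooth_manifold_chart:
  assumes "smooth_manifold A"
  shows "\<exists>U \<phi>. (U, \<phi>) \<in> A \<and> p \<in> U"
proof -
  have "p \<in> (\<Union>(U, \<phi>)\<in>A. U)" using assms unfolding smooth_manifold_def by simp
  then obtain x where "x \<in> A" "p \<in> fst x" unfolding split_beta by (rule UN_E)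
  then show ?thesis by (intro exI[of _ "fst x"] exI[of _ "snd x"]) simp
qed

lemma smooth_manifold_transition:
  assumes "smooth_manifold A" "(U, \<phi>) \<in> A" "(V, \<psi>) \<in> A"
  shows "smooth_on (\<phi> ` (U \<inter> V)) (\<psi> \<circ> inv_into U \<phi>)"
proof -
  have "\<forall>x\<in>A. \<forall>y\<in>A. smooth_on (snd x ` (fst x \<inter> fst y)) (snd y \<circ> inv_into (fst x) (snd x))"
    using assms(1) unfolding smooth_manifold_def split_beta by (elim conjE)
  from bspec[OF bspec[OF this assms(2)] assms(3)] show ?thesis by simp
qed

lemma smooth_manifold_coords:
  fixes A :: "('k::{t2_space, second_countable_topology}, 'e::real_normed_vector) atlas"
  assumes "smooth_manifold A"
  shows "\<exists>B (c :: 'e \<Rightarrow> 'e \<Rightarrow> real). coords B c"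
proof -
  have "\<exists>B::'e set. finite B \<and> span B = UNIV"
    using assms unfolding smooth_manifold_def by (elim conjE)
  then show ?thesis using coords_exist by metis
qed

lemma open_chart_image:
  assumes "smooth_manifold A" "(U, \<phi>) \<in> A" "open W"
  shows "open (\<phi> ` (U \<inter> W))"
proof -
  note D = smooth_manifoldD[OF assms(1,2)]
  have "\<phi> ` (U \<inter> W) = inv_into U \<phi> -` W \<inter> \<phi> ` U"
    using D(4) by (auto simp: inv_into_f_f)
  then show ?thesis using continuous_open_vimage D continuous_on_open_vimage[OF D(2)] assms(3) by metis
qed

lemma smooth_funsD:
  "f \<in> smooth_funs A \<Longrightarrow> (U, \<phi>) \<in> A \<Longrightarrow> smooth_on (\<phi> ` U) (f \<circ> inv_into U \<phi>)"
  unfolding smooth_funs_def by blast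

lemma smooth_funsI:
  "(\<And>U \<phi>. (U, \<phi>) \<in> A \<Longrightarrow> smooth_on (\<phi> ` U) (f \<circ> inv_into U \<phi>)) \<Longrightarrow> f \<in> smooth_funs A"
  unfolding smooth_funs_def by blast

lemma smooth_funs_const: "(\<lambda>x. c) \<in> smooth_funs A"
  by (intro smooth_funsI) (simp add: o_def smooth_on_const)

lemma smooth_funs_add:
  assumes "smooth_manifold A" "f \<in> smooth_funs A" "g \<in> smooth_funs A"
  shows "(\<lambda>x. f x + g x) \<in> smooth_funs A"
proof (rule smooth_funsI)
  fix U \<phi> assume U: "(U, \<phi>) \<in> A"
  show "smooth_on (\<phi> ` U) ((\<lambda>x. f x + g x) \<circ> inv_into U \<phi>)"
    using smooth_on_add[OF smooth_manifoldD(2)[OF assms(1) U] smooth_funsD[OF assms(2) U] smooth_funsD[OF assms(3) U]]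
    by (simp add: o_def)
qed

lemma smooth_funs_mult:
  assumes "smooth_manifold A" "f \<in> smooth_funs A" "g \<in> smooth_funs A"
  shows "(\<lambda>x. f x * g x) \<in> smooth_funs A"
proof (rule smooth_funsI)
  fix U \<phi> assume U: "(U, \<phi>) \<in> A"
  show "smooth_on (\<phi> ` U) ((\<lambda>x. f x * g x) \<circ> inv_into U \<phi>)"
    using smooth_on_mult[OF smooth_manifoldD(2)[OF assms(1) U] smooth_funsD[OF assms(2) U] smooth_funsD[OF assms(3) U]]
    by (simp add: o_def)
qed

lemma smooth_funs_cscale: "smooth_manifold A \<Longrightarrow> f \<in> smooth_funs A \<Longrightarrow> cscale c f \<in> smooth_funs A"
  unfolding cscale_def by (intro smooth_funs_mult smooth_funs_const)

lemma smooth_funs_sum: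
  assumes "smooth_manifold A" "\<And>i. i \<in> I \<Longrightarrow> f i \<in> smooth_funs A"
  shows "(\<lambda>x. \<Sum>i\<in>I. f i x) \<in> smooth_funs A"
  using assms(2)
  by (induction I rule: infinite_finite_induct) (auto intro!: smooth_funs_add assms(1) smooth_funs_const)

lemma smooth_funs_minus: "smooth_manifold A \<Longrightarrow> f \<in> smooth_funs A \<Longrightarrow> (\<lambda>x. - f x) \<in> smooth_funs A"
  using smooth_funs_cscale[of A f "-1"] by (simp add: cscale_def)

lemma smooth_funs_diff:
  "smooth_manifold A \<Longrightarrow> f \<in> smooth_funs A \<Longrightarrow> g \<in> smooth_funs A \<Longrightarrow> (\<lambda>x. f x - g x) \<in> smooth_funs A"
  using smooth_funs_add[of A f "\<lambda>x. - g x"] smooth_funs_minus by fastforce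

lemma smooth_funs_cnj: "smooth_manifold A \<Longrightarrow> f \<in> smooth_funs A \<Longrightarrow> (\<lambda>x. cnj (f x)) \<in> smooth_funs A"
  by (intro smooth_funsI)
    (auto simp: o_def intro!: smooth_on_linear_compose[OF bounded_linear_cnj] smooth_manifoldD(2) dest: smooth_funsD)

section \<open>Product manifolds and smooth maps\<close>

lemma inv_into_map_prod:
  assumes "inj_on \<phi> U" "inj_on \<psi> V" "x \<in> \<phi> ` U" "y \<in> \<psi> ` V"
  shows "inv_into (U \<times> V) (map_prod \<phi> \<psi>) (x, y) = (inv_into U \<phi> x, inv_into V \<psi> y)"
proof -
  obtain a b where ab: "a \<in> U" "x = \<phi> a" "b \<in> V" "y = \<psi> b" using assms by auto
  have "inj_on (map_prod \<phi> \<psi>) (U \<times> V)" using assms(1,2) by (rule map_prod_inj_on)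
  from inv_into_f_f[OF this, of "(a, b)"] show ?thesis using ab assms(1,2) by (simp add: inv_into_f_f)
qed

lemma smooth_manifold_prod:
  fixes A :: "('k::{t2_space, second_countable_topology}, 'e::real_normed_vector) atlas"
    and B :: "('l::{t2_space, second_countable_topology}, 'f::real_normed_vector) atlas"
  assumes A: "smooth_manifold A" and B: "smooth_manifold B"
  shows "smooth_manifold (prod_atlas A B)"
  unfolding smooth_manifold_def
proof (intro conjI)
  obtain D1 :: "'e set" and c1 where c1: "coords D1 c1" using smooth_manifold_coords[OF A] by blast
  obtain D2 :: "'f set" and c2 where c2: "coords D2 c2" using smooth_manifold_coords[OF B] by blast
  obtain D and c :: "'e \<times> 'f \<Rightarrow> 'e \<times> 'f \<Rightarrow> real" where D: "coords D c" using coords_prod[OF c1 c2] by blast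
  have "x \<in> span D" for x
  proof -
    have "x = (\<Sum>b\<in>D. c b x *\<^sub>R b)" using D by (metis coords_def)
    also have "\<dots> \<in> span D" by (intro span_sum span_scale span_base)
    finally show ?thesis .
  qed
  then show "\<exists>B::('e \<times> 'f) set. finite B \<and> span B = UNIV" using D unfolding coords_def by blast
  show "(\<Union>(U, \<phi>)\<in>prod_atlas A B. U) = UNIV"
  proof -
    have "(x, y) \<in> (\<Union>(U, \<phi>)\<in>prod_atlas A B. U)" for x y
    proof -
      obtain U \<phi> V \<psi> where "(U, \<phi>) \<in> A" "x \<in> U" "(V, \<psi>) \<in> B" "y \<in> V"
        using smooth_manifold_chart[OF A] smooth_manifold_chart[OF B] by metis
      then show ?thesis unfolding prod_atlas_def by blast
    qed
    then show ?thesis by auto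
  qed
  show "\<forall>(U, \<phi>)\<in>prod_atlas A B. open U \<and> open (\<phi> ` U) \<and> homeomorphism U (\<phi> ` U) \<phi> (inv_into U \<phi>)"
  proof (clarify, unfold prod_atlas_def, clarsimp)
    fix U \<phi> V \<psi> assume UV: "(U, \<phi>) \<in> A" "(V, \<psi>) \<in> B"
    note DU = smooth_manifoldD[OF A UV(1)] and DV = smooth_manifoldD[OF B UV(2)]
    have im: "map_prod \<phi> \<psi> ` (U \<times> V) = \<phi> ` U \<times> \<psi> ` V" by (rule map_prod_surj_on) auto
    have inj: "inj_on (map_prod \<phi> \<psi>) (U \<times> V)" by (intro map_prod_inj_on DU DV)
    have "continuous_on (U \<times> V) (\<lambda>z. (\<phi> (fst z), \<psi> (snd z)))"
      by (intro continuous_intros continuous_on_compose2[OF DU(5)] continuous_on_compose2[OF DV(5)]) auto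
    then have c1: "continuous_on (U \<times> V) (map_prod \<phi> \<psi>)" by (simp add: map_prod_def split_beta)
    have "continuous_on (\<phi> ` U \<times> \<psi> ` V) (\<lambda>z. (inv_into U \<phi> (fst z), inv_into V \<psi> (snd z)))"
      by (intro continuous_intros continuous_on_compose2[OF DU(6)] continuous_on_compose2[OF DV(6)]) auto
    then have c2: "continuous_on (\<phi> ` U \<times> \<psi> ` V) (inv_into (U \<times> V) (map_prod \<phi> \<psi>))"
      by (rule continuous_on_eq) (use inv_into_map_prod[OF DU(4) DV(4)] in auto)
    have "homeomorphism (U \<times> V) (map_prod \<phi> \<psi> ` (U \<times> V)) (map_prod \<phi> \<psi>) (inv_into (U \<times> V) (map_prod \<phi> \<psi>))"
      unfolding homeomorphism_def
      by (intro conjI ballI refl c1 c2[folded im] inv_into_f_f[OF inj] f_inv_into_f inv_into_image_cancel[OF inj subset_refl]; assumption)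
    then show "open (U \<times> V) \<and> open (map_prod \<phi> \<psi> ` (U \<times> V)) \<and>
       homeomorphism (U \<times> V) (map_prod \<phi> \<psi> ` (U \<times> V)) (map_prod \<phi> \<psi>) (inv_into (U \<times> V) (map_prod \<phi> \<psi>))"
      using DU DV im by (simp add: open_Times)
  qed
  show "\<forall>(U, \<phi>)\<in>prod_atlas A B. \<forall>(V, \<psi>)\<in>prod_atlas A B. smooth_on (\<phi> ` (U \<inter> V)) (\<psi> \<circ> inv_into U \<phi>)"
  proof (clarify, unfold prod_atlas_def, clarsimp)
    fix U \<phi> V \<psi> U' \<phi>' V' \<psi>' assume UV: "(U, \<phi>) \<in> A" "(V, \<psi>) \<in> B" "(U', \<phi>') \<in> A" "(V', \<psi>') \<in> B"
    note DU = smooth_manifoldD[OF A UV(1)] and DV = smooth_manifoldD[OF B UV(2)]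
    let ?S = "\<phi> ` (U \<inter> U') \<times> \<psi> ` (V \<inter> V')"
    have im: "map_prod \<phi> \<psi> ` (U \<times> V \<inter> U' \<times> V') = ?S" by (auto simp: image_iff)
    have o: "open (\<phi> ` (U \<inter> U'))" "open (\<psi> ` (V \<inter> V'))"
      by (intro open_chart_image[OF A UV(1)] open_chart_image[OF B UV(2)] smooth_manifoldD[OF A UV(3)] smooth_manifoldD[OF B UV(4)])+
    then have oS: "open ?S" by (rule open_Times)
    have "smooth_on ?S (\<lambda>z. ((\<phi>' \<circ> inv_into U \<phi>) (fst z), (\<psi>' \<circ> inv_into V \<psi>) (snd z)))"
      by (intro smooth_on_Pair oS smooth_on_compose[OF c1 oS o(1) _ smooth_manifold_transition[OF A UV(1,3)]]
          smooth_on_compose[OF c2 oS o(2) _ smooth_manifold_transition[OF B UV(2,4)]]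
          smooth_on_bounded_linear bounded_linear_fst bounded_linear_snd) auto
    then have "smooth_on ?S (map_prod \<phi>' \<psi>' \<circ> inv_into (U \<times> V) (map_prod \<phi> \<psi>))"
      by (rule smooth_on_cong[OF oS, rotated]) (use inv_into_map_prod[OF DU(4) DV(4)] in auto)
    then show "smooth_on (map_prod \<phi> \<psi> ` (U \<times> V \<inter> U' \<times> V')) (map_prod \<phi>' \<psi>' \<circ> inv_into (U \<times> V) (map_prod \<phi> \<psi>))"
      by (simp add: im)
  qed
qed

lemma smooth_mapD:
  "smooth_map A B F \<Longrightarrow> (U, \<phi>) \<in> A \<Longrightarrow> (V, \<psi>) \<in> B \<Longrightarrow> smooth_on (\<phi> ` (U \<inter> F -` V)) (\<psi> \<circ> F \<circ> inv_into U \<phi>)"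
  unfolding smooth_map_def by fastforce

lemma open_chart_vimage:
  assumes "smooth_manifold A" "(U, \<phi>) \<in> A" "continuous_on UNIV F" "open V"
  shows "open (\<phi> ` (U \<inter> F -` V))"
  using assms open_chart_image open_vimage by blast

text \<open>\<open>F\<close> need not map the domain of a chart into that of another, so smoothness
  is checked near each point, on the part of the domain that lands in one chart of
  \<open>B\<close>.\<close>

lemma smooth_funs_compose:
  fixes A :: "('k::{t2_space, second_countable_topology}, 'e::real_normed_vector) atlas"
    and B :: "('l::{t2_space, second_countable_topology}, 'f::real_normed_vector) atlas"
  assumes A: "smooth_manifold A" and B: "smooth_manifold B" and F: "smooth_map A B F" and f: "f \<in> smooth_funs B"
  shows "(\<lambda>x. f (F x)) \<in> smooth_funs A"
proof (rule smooth_funsI)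
  fix U \<phi> assume U: "(U, \<phi>) \<in> A"
  note DU = smooth_manifoldD[OF A U]
  obtain D and c :: "'f \<Rightarrow> 'f \<Rightarrow> real" where c: "coords D c" using smooth_manifold_coords[OF B] by blast
  have cF: "continuous_on UNIV F" using F by (simp add: smooth_map_def)
  show "smooth_on (\<phi> ` U) ((\<lambda>x. f (F x)) \<circ> inv_into U \<phi>)"
  proof (rule smooth_on_local)
    fix y assume "y \<in> \<phi> ` U"
    then obtain x where x: "x \<in> U" "y = \<phi> x" by auto
    obtain V \<psi> where V: "(V, \<psi>) \<in> B" "F x \<in> V" using smooth_manifold_chart[OF B] by blast
    note DV = smooth_manifoldD[OF B V(1)]
    let ?T = "\<phi> ` (U \<inter> F -` V)"
    have oT: "open ?T" by (rule open_chart_vimage[OF A U cF DV(1)])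
    have "smooth_on ?T (\<lambda>z. (f \<circ> inv_into V \<psi>) ((\<psi> \<circ> F \<circ> inv_into U \<phi>) z))"
      by (rule smooth_on_compose[OF c oT DV(2) _ smooth_funsD[OF f V(1)] smooth_mapD[OF F U V(1)]])
        (use DU(4) in \<open>auto simp: inv_into_f_f\<close>)
    then have "smooth_on ?T ((\<lambda>x. f (F x)) \<circ> inv_into U \<phi>)"
      by (rule smooth_on_cong[OF oT, rotated]) (use DU(4) DV(4) in \<open>auto simp: inv_into_f_f\<close>)
    then show "\<exists>T. open T \<and> y \<in> T \<and> smooth_on T ((\<lambda>x. f (F x)) \<circ> inv_into U \<phi>)"
      using oT x V by blast
  qed
qed

lemma smooth_map_id: "smooth_manifold A \<Longrightarrow> smooth_map A A (\<lambda>x. x)"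
  unfolding smooth_map_def using smooth_manifold_transition by (fastforce simp: o_def)

lemma smooth_map_const: "smooth_map A B (\<lambda>x. p)"
  unfolding smooth_map_def by (auto simp: o_def smooth_on_const)

lemma smooth_map_Pair:
  fixes A :: "('k::{t2_space, second_countable_topology}, 'e::real_normed_vector) atlas"
    and B :: "('l::{t2_space, second_countable_topology}, 'f::real_normed_vector) atlas"
    and C :: "('m::{t2_space, second_countable_topology}, 'g::real_normed_vector) atlas"
  assumes A: "smooth_manifold A" and BC: "smooth_manifold B" "smooth_manifold C"
    and F: "smooth_map A B F" and G: "smooth_map A C G"
  shows "smooth_map A (prod_atlas B C) (\<lambda>x. (F x, G x))"
  unfolding smooth_map_def
proof (intro conjI)
  have cF: "continuous_on UNIV F" and cG: "continuous_on UNIV G" using F G by (simp_all add: smooth_map_def)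
  then show "continuous_on UNIV (\<lambda>x. (F x, G x))" by (intro continuous_on_Pair)
  show "\<forall>(U, \<phi>)\<in>A. \<forall>(V, \<psi>)\<in>prod_atlas B C. smooth_on (\<phi> ` (U \<inter> (\<lambda>x. (F x, G x)) -` V)) (\<psi> \<circ> (\<lambda>x. (F x, G x)) \<circ> inv_into U \<phi>)"
  proof (clarify, unfold prod_atlas_def, clarsimp)
    fix U \<phi> V \<psi> W \<omega> assume U: "(U, \<phi>) \<in> A" and V: "(V, \<psi>) \<in> B" "(W, \<omega>) \<in> C"
    let ?S = "\<phi> ` (U \<inter> (\<lambda>x. (F x, G x)) -` (V \<times> W))"
    have oS: "open ?S"
      by (rule open_chart_vimage[OF A U])
        (intro continuous_on_Pair cF cG open_Times smooth_manifoldD[OF BC(1) V(1)] smooth_manifoldD[OF BC(2) V(2)])+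
    have "smooth_on ?S (\<lambda>z. ((\<psi> \<circ> F \<circ> inv_into U \<phi>) z, (\<omega> \<circ> G \<circ> inv_into U \<phi>) z))"
      by (intro smooth_on_Pair oS smooth_on_subset[OF smooth_mapD[OF F U V(1)]] smooth_on_subset[OF smooth_mapD[OF G U V(2)]]) auto
    then show "smooth_on ?S (map_prod \<psi> \<omega> \<circ> (\<lambda>x. (F x, G x)) \<circ> inv_into U \<phi>)"
      by (simp add: o_def)
  qed
qed

lemma smooth_map_fst:
  fixes A :: "('k::{t2_space, second_countable_topology}, 'e::real_normed_vector) atlas"
    and B :: "('l::{t2_space, second_countable_topology}, 'f::real_normed_vector) atlas"
  assumes A: "smooth_manifold A" and B: "smooth_manifold B"
  shows "smooth_map (prod_atlas A B) A fst" "smooth_map (prod_atlas A B) B snd"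
proof -
  obtain D1 and c1 :: "'e \<Rightarrow> 'e \<Rightarrow> real" where c1: "coords D1 c1" using smooth_manifold_coords[OF A] by blast
  obtain D2 and c2 :: "'f \<Rightarrow> 'f \<Rightarrow> real" where c2: "coords D2 c2" using smooth_manifold_coords[OF B] by blast
  show "smooth_map (prod_atlas A B) A fst"
    unfolding smooth_map_def
  proof (intro conjI continuous_on_fst continuous_on_id, clarify, unfold prod_atlas_def, clarsimp)
    fix U \<phi> V \<psi> W \<omega> assume U: "(U, \<phi>) \<in> A" "(V, \<psi>) \<in> B" "(W, \<omega>) \<in> A"
    note DU = smooth_manifoldD[OF A U(1)] and DV = smooth_manifoldD[OF B U(2)]
    let ?S = "\<phi> ` (U \<inter> W) \<times> \<psi> ` V"
    have im: "map_prod \<phi> \<psi> ` (U \<times> V \<inter> fst -` W) = ?S" by (auto simp: image_iff)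
    have oU: "open (\<phi> ` (U \<inter> W))" by (rule open_chart_image[OF A U(1) smooth_manifoldD(1)[OF A U(3)]])
    have oS: "open ?S" by (intro open_Times oU DV)
    have "smooth_on ?S (\<lambda>z. (\<omega> \<circ> inv_into U \<phi>) (fst z))"
      by (rule smooth_on_compose[OF c1 oS oU _ smooth_manifold_transition[OF A U(1,3)] smooth_on_bounded_linear[OF bounded_linear_fst]]) auto
    then show "smooth_on (map_prod \<phi> \<psi> ` (U \<times> V \<inter> fst -` W)) (\<omega> \<circ> fst \<circ> inv_into (U \<times> V) (map_prod \<phi> \<psi>))"
      unfolding im by (rule smooth_on_cong[OF oS, rotated]) (use inv_into_map_prod[OF DU(4) DV(4)] in auto)
  qed
  show "smooth_map (prod_atlas A B) B snd"
    unfolding smooth_map_def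
  proof (intro conjI continuous_on_snd continuous_on_id, clarify, unfold prod_atlas_def, clarsimp)
    fix U \<phi> V \<psi> W \<omega> assume U: "(U, \<phi>) \<in> A" "(V, \<psi>) \<in> B" "(W, \<omega>) \<in> B"
    note DU = smooth_manifoldD[OF A U(1)] and DV = smooth_manifoldD[OF B U(2)]
    let ?S = "\<phi> ` U \<times> \<psi> ` (V \<inter> W)"
    have im: "map_prod \<phi> \<psi> ` (U \<times> V \<inter> snd -` W) = ?S" by (auto simp: image_iff)
    have oV: "open (\<psi> ` (V \<inter> W))" by (rule open_chart_image[OF B U(2) smooth_manifoldD(1)[OF B U(3)]])
    have oS: "open ?S" by (intro open_Times oV DU)
    have "smooth_on ?S (\<lambda>z. (\<omega> \<circ> inv_into V \<psi>) (snd z))"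
      by (rule smooth_on_compose[OF c2 oS oV _ smooth_manifold_transition[OF B U(2,3)] smooth_on_bounded_linear[OF bounded_linear_snd]]) auto
    then show "smooth_on (map_prod \<phi> \<psi> ` (U \<times> V \<inter> snd -` W)) (\<omega> \<circ> snd \<circ> inv_into (U \<times> V) (map_prod \<phi> \<psi>))"
      unfolding im by (rule smooth_on_cong[OF oS, rotated]) (use inv_into_map_prod[OF DU(4) DV(4)] in auto)
  qed
qed

section \<open>Derivations at a point and their localization\<close>

lemma tangent_outside: "v \<in> tangent A p \<Longrightarrow> f \<notin> smooth_funs A \<Longrightarrow> v f = 0"
  by (simp add: tangent_def)

lemma tangent_add:
  "v \<in> tangent A p \<Longrightarrow> f \<in> smooth_funs A \<Longrightarrow> g \<in> smooth_funs A \<Longrightarrow> v (\<lambda>x. f x + g x) = v f + v g"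
  by (simp add: tangent_def plus_fun_def)

lemma tangent_cscale:
  "v \<in> tangent A p \<Longrightarrow> f \<in> smooth_funs A \<Longrightarrow> v (\<lambda>x. c * f x) = c * v f"
  by (simp add: tangent_def cscale_def)

lemma tangent_mult:
  "v \<in> tangent A p \<Longrightarrow> f \<in> smooth_funs A \<Longrightarrow> g \<in> smooth_funs A \<Longrightarrow> v (\<lambda>x. f x * g x) = v f * g p + f p * v g"
  by (simp add: tangent_def)

lemma tangent_const:
  assumes "v \<in> tangent A p"
  shows "v (\<lambda>x. c) = 0"
proof -
  have "v (\<lambda>x. 1 * 1) = v (\<lambda>x. 1) * 1 + 1 * v (\<lambda>x. 1)"
    by (rule tangent_mult[OF assms]) (rule smooth_funs_const)+
  then have "v (\<lambda>x. 1) = 0" by simp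
  then show ?thesis using tangent_cscale[OF assms smooth_funs_const[of 1], of c] by simp
qed

lemma tangent_sum:
  assumes "smooth_manifold A" "v \<in> tangent A p" "\<And>i. i \<in> I \<Longrightarrow> f i \<in> smooth_funs A"
  shows "v (\<lambda>x. \<Sum>i\<in>I. f i x) = (\<Sum>i\<in>I. v (f i))"
  using assms(3)
  by (induction I rule: infinite_finite_induct)
    (auto simp: tangent_const[OF assms(2)] tangent_add[OF assms(2)] smooth_funs_sum assms(1))

lemma tangent_diff:
  assumes "smooth_manifold A" "v \<in> tangent A p" "f \<in> smooth_funs A" "g \<in> smooth_funs A"
  shows "v (\<lambda>x. f x - g x) = v f - v g"
  using tangent_add[OF assms(2,3) smooth_funs_minus[OF assms(1,4)]] tangent_cscale[OF assms(2,4), of "-1"] by simp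

lemma tangentI:
  assumes "\<And>f. f \<notin> smooth_funs A \<Longrightarrow> v f = 0"
    "\<And>f g. f \<in> smooth_funs A \<Longrightarrow> g \<in> smooth_funs A \<Longrightarrow> v (\<lambda>x. f x + g x) = v f + v g"
    "\<And>c f. f \<in> smooth_funs A \<Longrightarrow> v (\<lambda>x. c * f x) = c * v f"
    "\<And>f g. f \<in> smooth_funs A \<Longrightarrow> g \<in> smooth_funs A \<Longrightarrow> v (\<lambda>x. f x * g x) = v f * g p + f p * v g"
  shows "v \<in> tangent A p"
  using assms unfolding tangent_def plus_fun_def cscale_def by blast

lemma tangent_subspace: "fvec.subspace (tangent A p)"
  unfolding fvec.subspace_def
  by (auto intro!: tangentI simp: cscale_def tangent_outside tangent_add tangent_cscale tangent_mult algebra_simps)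

text \<open>Compact Hausdorff spaces are regular: separate \<open>p\<close> from the closed
  complement of \<open>U\<close>.\<close>

lemma compact_closure_neighbourhood:
  assumes "compact (UNIV :: 'k::t2_space set)" "open U" "(p :: 'k) \<in> U"
  shows "\<exists>W. open W \<and> p \<in> W \<and> closure W \<subseteq> U"
proof -
  have "regular_space (euclidean :: 'k topology)"
  proof (rule compact_Hausdorff_imp_regular_space)
    show "compact_space (euclidean :: 'k topology)" using assms(1) by (simp add: compact_space_def)
    show "Hausdorff_space (euclidean :: 'k topology)"
      unfolding Hausdorff_space_def disjnt_def using hausdorff by auto
  qed
  then obtain W V where "open W" "open V" "p \<in> W" "- U \<subseteq> V" "disjnt W V"
    using assms(2,3) unfolding regular_space_def by (auto simp: closed_Compl dest!: spec[of _ "- U"] spec[of _ p])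
  moreover then have "closure W \<subseteq> - V" by (intro closure_minimal) (auto simp: disjnt_def closed_Compl)
  ultimately show ?thesis by blast
qed

text \<open>Makes functions given in a chart accessible to tangent vectors. The bump
  \<open>h\<close> is fixed before \<open>G\<close>, so that extensions of several functions share
  the same factor.\<close>

lemma chart_bump_extension:
  fixes A :: "('k::{t2_space, second_countable_topology}, 'e::real_normed_vector) atlas"
  assumes A: "smooth_manifold A" and K: "compact (UNIV :: 'k set)" and U: "(U, \<phi>) \<in> A"
    and T: "open T" "T \<subseteq> \<phi> ` U" "p \<in> U" "\<phi> p \<in> T"
  shows "\<exists>h :: 'e \<Rightarrow> complex. h (\<phi> p) \<noteq> 0 \<and>
    (\<forall>G. smooth_on T G \<longrightarrow> (\<lambda>q. if q \<in> U \<and> \<phi> q \<in> T then h (\<phi> q) * G (\<phi> q) else 0) \<in> smooth_funs A)"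
proof -
  note DU = smooth_manifoldD[OF A U]
  obtain B and c :: "'e \<Rightarrow> 'e \<Rightarrow> real" where c: "coords B c" using smooth_manifold_coords[OF A] by blast
  have "open (U \<inter> \<phi> -` T)" using DU T continuous_on_open_vimage[OF DU(1)] by (metis Int_commute)
  then obtain W where W: "open W" "p \<in> W" "closure W \<subseteq> U \<inter> \<phi> -` T"
    using compact_closure_neighbourhood[OF K, of "U \<inter> \<phi> -` T" p] T by auto
  have WU: "W \<subseteq> U" "\<phi> ` W \<subseteq> T" using W(3) closure_subset by blast+
  have oW: "open (\<phi> ` W)" using open_chart_image[OF A U W(1)] WU by (simp add: inf_absorb2)
  obtain h :: "'e \<Rightarrow> complex" and D where h: "smooth_on UNIV h" "h (\<phi> p) \<noteq> 0" "closed D" "D \<subseteq> \<phi> ` W" "\<And>x. x \<notin> D \<Longrightarrow> h x = 0"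
    using smooth_bump[OF c oW, of "\<phi> p"] W(2) by auto
  \<comment> \<open>\<open>D\<close> is closed in the model space, but its preimage must be closed
    in the manifold for the extension by zero to be smooth. Intersecting with
    \<open>closure W\<close>, on which the chart is defined and continuous, achieves this.\<close>
  define N where "N = closure W \<inter> \<phi> -` D"
  have cN: "closed N" unfolding N_def
    by (rule continuous_closed_preimage[OF continuous_on_subset[OF DU(5)]]) (use W h in auto)
  have inW: "q \<in> W" if q: "q \<in> U" "\<phi> q \<in> D" for q
  proof -
    obtain w where "w \<in> W" "\<phi> q = \<phi> w" using q(2) h(4) by blast
    then show ?thesis using inj_onD[OF DU(4)] q(1) WU by blast
  qed
  have N: "q \<in> N" if "q \<in> U" "\<phi> q \<in> D" for q
    using inW[OF that] that closure_subset unfolding N_def by blast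
  have hN: "h (\<phi> q) = 0" if "q \<in> U" "q \<notin> N" for q using N h(5) that by blast
  have NW: "N \<subseteq> W" using inW W(3) unfolding N_def by blast
  have "(\<lambda>q. if q \<in> U \<and> \<phi> q \<in> T then h (\<phi> q) * G (\<phi> q) else 0) \<in> smooth_funs A" (is "?F \<in> _") if G: "smooth_on T G" for G
  proof (rule smooth_funsI)
    fix V \<psi> assume V: "(V, \<psi>) \<in> A"
    note DV = smooth_manifoldD[OF A V]
    show "smooth_on (\<psi> ` V) (?F \<circ> inv_into V \<psi>)"
    proof (rule smooth_on_local)
      fix y assume "y \<in> \<psi> ` V"
      then obtain q where q: "q \<in> V" "y = \<psi> q" by auto
      show "\<exists>S. open S \<and> y \<in> S \<and> smooth_on S (?F \<circ> inv_into V \<psi>)"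
      proof (cases "q \<in> N")
        case True
        let ?S = "\<psi> ` (V \<inter> W)"
        have oS: "open ?S" by (rule open_chart_image[OF A V W(1)])
        have tr: "smooth_on ?S (\<phi> \<circ> inv_into V \<psi>)"
          by (rule smooth_on_subset[OF smooth_manifold_transition[OF A V U]]) (use WU in auto)
        have im: "(\<phi> \<circ> inv_into V \<psi>) ` ?S \<subseteq> T" using WU DV(4) by (auto simp: inv_into_f_f)
        have "smooth_on T (\<lambda>x. h x * G x)"
          by (rule smooth_on_mult[OF T(1) smooth_on_subset[OF h(1)] G]) simp
        from smooth_on_compose[OF c oS T(1) im this tr]
        have "smooth_on ?S (?F \<circ> inv_into V \<psi>)"
          by (rule smooth_on_cong[OF oS, rotated]) (use WU DV(4) in \<open>auto simp: inv_into_f_f\<close>)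
        then show ?thesis using oS q True NW by blast
      next
        case False
        let ?S = "\<psi> ` (V \<inter> - N)"
        have oS: "open ?S" by (rule open_chart_image[OF A V]) (simp add: open_Compl cN)
        have "smooth_on ?S (?F \<circ> inv_into V \<psi>)"
          by (rule smooth_on_cong[OF oS _ smooth_on_const[of _ 0]])
            (use hN DV(4) in \<open>auto simp: inv_into_f_f\<close>)
        then show ?thesis using oS q False by blast
      qed
    qed
  qed
  then show ?thesis using h(2) by blast
qed

text \<open>Hadamard's lemma writes a function near \<open>p\<close> as \<open>f p\<close> plus a combination of products of two
  functions, one of which vanishes at \<open>p\<close>; the bump function makes all of them global.\<close>

lemma tangent_in_chart:
  fixes A :: "('k::{t2_space, second_countable_topology}, 'e::real_normed_vector) atlas"
    and c :: "'e \<Rightarrow> 'e \<Rightarrow> real"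
  assumes A: "smooth_manifold A" and K: "compact (UNIV :: 'k set)" and U: "(U, \<phi>) \<in> A" "p \<in> U"
    and c: "coords B c" and a: "a \<in> tangent A p"
  shows "\<exists>\<alpha>. \<forall>f\<in>smooth_funs A. a f = (\<Sum>b\<in>B. \<alpha> b * frechet_derivative (f \<circ> inv_into U \<phi>) (at (\<phi> p)) b)"
proof -
  note DU = smooth_manifoldD[OF A U(1)]
  let ?x0 = "\<phi> p"
  obtain r where r: "r > 0" "ball ?x0 r \<subseteq> \<phi> ` U" using DU(2) U(2) by (meson imageI open_contains_ball)
  let ?T = "ball ?x0 r"
  obtain h where h: "h ?x0 \<noteq> 0"
    "\<And>G. smooth_on ?T G \<Longrightarrow> (\<lambda>q. if q \<in> U \<and> \<phi> q \<in> ?T then h (\<phi> q) * G (\<phi> q) else 0) \<in> smooth_funs A"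
    using chart_bump_extension[OF A K U(1) open_ball r(2) U(2)] r(1) by auto
  have centre: "?x0 \<in> ?T" using r(1) by simp
  define X where "X = (\<lambda>(G::'e \<Rightarrow> complex) q. if q \<in> U \<and> \<phi> q \<in> ?T then h (\<phi> q) * G (\<phi> q) else 0)"
  have X: "X G \<in> smooth_funs A" if "smooth_on ?T G" for G unfolding X_def by (rule h(2)[OF that])
  have Xp: "X G p = h ?x0 * G ?x0" for G using U(2) r(1) by (simp add: X_def)
  have sc: "smooth_on ?T (\<lambda>x. complex_of_real (c b (x - ?x0)))" if "b \<in> B" for b
  proof -
    have bl: "bounded_linear (c b)" using c that by (simp add: coords_def)
    have "smooth_on ?T (\<lambda>x. c b x + (- c b ?x0))" by (rule smooth_on_affine[OF bl open_ball])
    then show ?thesis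
      by (intro smooth_on_linear_compose[OF bounded_linear_of_real open_ball]) (simp add: linear_diff[OF bounded_linear.linear[OF bl]])
  qed
  \<comment> \<open>The coordinate functions vanish at the base point, so cutting them off only
    multiplies the value of \<open>a\<close> by \<open>h ?x0\<close>; this factor is divided
    out.\<close>
  define \<alpha> where "\<alpha> = (\<lambda>b. a (X (\<lambda>x. complex_of_real (c b (x - ?x0)))) / h ?x0)"
  have "a f = (\<Sum>b\<in>B. \<alpha> b * frechet_derivative (f \<circ> inv_into U \<phi>) (at ?x0) b)" if f: "f \<in> smooth_funs A" for f
  proof -
    define F where "F = f \<circ> inv_into U \<phi>"
    have sF: "smooth_on ?T F" unfolding F_def by (rule smooth_on_subset[OF smooth_funsD[OF f U(1)] r(2)])
    obtain g where g: "\<And>b. b \<in> B \<Longrightarrow> smooth_on ?T (g b)" "\<And>b. b \<in> B \<Longrightarrow> g b ?x0 = frechet_derivative F (at ?x0) b"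
      "\<And>x. x \<in> ?T \<Longrightarrow> F x = F ?x0 + (\<Sum>b\<in>B. c b (x - ?x0) *\<^sub>R g b x)"
      using hadamard[OF c open_ball convex_ball centre sF] by blast
    define e where "e = X (\<lambda>x. 1)"
    define u where "u = (\<lambda>q. f q - f p)"
    have e: "e \<in> smooth_funs A" "e p = h ?x0" unfolding e_def by (simp_all add: X smooth_on_const Xp)
    have u: "u \<in> smooth_funs A" "u p = 0" "a u = a f"
      unfolding u_def using smooth_funs_diff[OF A f smooth_funs_const] tangent_diff[OF A a f smooth_funs_const] tangent_const[OF a]
      by simp_all
    have eu: "(\<lambda>q. e q * u q) \<in> smooth_funs A" by (rule smooth_funs_mult[OF A e(1) u(1)])
    \<comment> \<open>Two factors \<open>e\<close>, because on the other side both the coordinate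
      function and its Hadamard coefficient are cut off. Since \<open>u\<close> vanishes at
      \<open>p\<close>, the derivation sees only the values of these factors at
      \<open>p\<close>.\<close>
    have "a (\<lambda>q. e q * (e q * u q)) = h ?x0 * h ?x0 * a f"
      using tangent_mult[OF a e(1) eu] tangent_mult[OF a e(1) u(1)] u e by simp
    moreover have "(\<lambda>q. e q * (e q * u q)) = (\<lambda>q. \<Sum>b\<in>B. X (\<lambda>x. complex_of_real (c b (x - ?x0))) q * X (g b) q)"
    proof
      fix q
      show "e q * (e q * u q) = (\<Sum>b\<in>B. X (\<lambda>x. complex_of_real (c b (x - ?x0))) q * X (g b) q)"
      proof (cases "q \<in> U \<and> \<phi> q \<in> ?T")
        case True
        then have "u q = F (\<phi> q) - F ?x0" using DU(4) U(2) by (simp add: F_def u_def inv_into_f_f)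
        also have "\<dots> = (\<Sum>b\<in>B. c b (\<phi> q - ?x0) *\<^sub>R g b (\<phi> q))" using g(3)[of "\<phi> q"] True by simp
        finally show ?thesis using True
          by (simp add: e_def X_def sum_distrib_left scaleR_conv_of_real mult_ac)
      next
        case False
        have "X G q = 0" for G by (simp only: X_def if_not_P[OF False])
        then show ?thesis by (simp add: e_def)
      qed
    qed
    moreover have "a (\<lambda>q. \<Sum>b\<in>B. X (\<lambda>x. complex_of_real (c b (x - ?x0))) q * X (g b) q)
      = (\<Sum>b\<in>B. a (X (\<lambda>x. complex_of_real (c b (x - ?x0)))) * (h ?x0 * g b ?x0))"
    proof -
      have "a (\<lambda>q. X (\<lambda>x. complex_of_real (c b (x - ?x0))) q * X (g b) q) = a (X (\<lambda>x. complex_of_real (c b (x - ?x0)))) * (h ?x0 * g b ?x0)"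
        if b: "b \<in> B" for b
      proof -
        have "c b 0 = 0" using c b by (simp add: coords_def linear_0 bounded_linear.linear)
        then show ?thesis using tangent_mult[OF a X[OF sc[OF b]] X[OF g(1)[OF b]]] by (simp add: Xp)
      qed
      then show ?thesis
        by (subst tangent_sum[OF A a]) (auto intro!: smooth_funs_mult[OF A] X sc g(1))
    qed
    ultimately have "h ?x0 * h ?x0 * a f = (\<Sum>b\<in>B. a (X (\<lambda>x. complex_of_real (c b (x - ?x0)))) * (h ?x0 * g b ?x0))" by simp
    also have "\<dots> = h ?x0 * h ?x0 * (\<Sum>b\<in>B. \<alpha> b * g b ?x0)"
      using h(1) by (simp add: \<alpha>_def sum_distrib_left mult_ac)
    finally show ?thesis using h(1) g(2) by (simp add: F_def)
  qed
  then show ?thesis by blast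
qed

text \<open>The directional derivatives in a chart span. Only an inclusion is claimed; it bounds the
  size of independent sets of tangent vectors, from which finite bases of the Lie algebra and its
  subspaces are extracted.\<close>

lemma tangent_finite_span:
  fixes A :: "('k::{t2_space, second_countable_topology}, 'e::real_normed_vector) atlas"
  assumes A: "smooth_manifold A" and K: "compact (UNIV :: 'k set)"
  shows "\<exists>S. finite S \<and> tangent A p \<subseteq> fvec.span S"
proof -
  obtain U \<phi> where U: "(U, \<phi>) \<in> A" "p \<in> U" using smooth_manifold_chart[OF A] by blast
  obtain B and c :: "'e \<Rightarrow> 'e \<Rightarrow> real" where c: "coords B c" using smooth_manifold_coords[OF A] by blast
  define d where "d = (\<lambda>b f. if f \<in> smooth_funs A then frechet_derivative (f \<circ> inv_into U \<phi>) (at (\<phi> p)) b else 0)"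
  have "a \<in> fvec.span (d ` B)" if a: "a \<in> tangent A p" for a
  proof -
    obtain \<alpha> where \<alpha>: "\<And>f. f \<in> smooth_funs A \<Longrightarrow> a f = (\<Sum>b\<in>B. \<alpha> b * frechet_derivative (f \<circ> inv_into U \<phi>) (at (\<phi> p)) b)"
      using tangent_in_chart[OF A K U c a] by blast
    have "a f = (\<Sum>b\<in>B. cscale (\<alpha> b) (d b)) f" for f
    proof -
      have "(\<Sum>b\<in>B. cscale (\<alpha> b) (d b)) f = (\<Sum>b\<in>B. cscale (\<alpha> b) (d b) f)"
        by (induction B rule: infinite_finite_induct) auto
      then show ?thesis using \<alpha> tangent_outside[OF a] by (cases "f \<in> smooth_funs A") (simp_all add: d_def cscale_def)
    qed
    then have "a = (\<Sum>b\<in>B. cscale (\<alpha> b) (d b))" by blast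
    also have "\<dots> \<in> fvec.span (d ` B)" by (intro fvec.span_sum fvec.span_scale fvec.span_base) auto
    finally show ?thesis .
  qed
  then show ?thesis using c unfolding coords_def by (intro exI[of _ "d ` B"]) auto
qed

section \<open>Functions of two points of the manifold\<close>

lemma smooth_funs_prodD:
  fixes A :: "('k::{t2_space, second_countable_topology}, 'e::real_normed_vector) atlas"
  assumes A: "smooth_manifold A" and U: "(U, \<phi>) \<in> A" and V: "(V, \<psi>) \<in> A" and h: "h \<in> smooth_funs (prod_atlas A A)"
  shows "smooth_on (\<phi> ` U \<times> \<psi> ` V) (\<lambda>z. h (inv_into U \<phi> (fst z), inv_into V \<psi> (snd z)))"
proof -
  note DU = smooth_manifoldD[OF A U] and DV = smooth_manifoldD[OF A V]
  have im: "map_prod \<phi> \<psi> ` (U \<times> V) = \<phi> ` U \<times> \<psi> ` V" by (rule map_prod_surj_on) auto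
  have "(U \<times> V, map_prod \<phi> \<psi>) \<in> prod_atlas A A" using U V unfolding prod_atlas_def by blast
  from smooth_funsD[OF h this] show ?thesis unfolding im
    by (rule smooth_on_cong[rotated 2]) (use DU DV inv_into_map_prod[OF DU(4) DV(4)] in \<open>auto simp: open_Times\<close>)
qed

lemma frechet_derivative_slice:
  assumes "H differentiable (at (x, y))"
  shows "frechet_derivative (\<lambda>x. H (x, y)) (at x) u = frechet_derivative H (at (x, y)) (u, 0)"
    and "frechet_derivative (\<lambda>y. H (x, y)) (at y) v = frechet_derivative H (at (x, y)) (0, v)"
proof -
  have H: "(H has_derivative frechet_derivative H (at (x, y))) (at (x, y))" using assms frechet_derivative_works by blast
  have "((\<lambda>x. (x, y)) has_derivative (\<lambda>u. (u, 0))) (at x)" by (intro derivative_intros)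
  from diff_chain_at[OF this H] show "frechet_derivative (\<lambda>x. H (x, y)) (at x) u = frechet_derivative H (at (x, y)) (u, 0)"
    by (simp add: o_def frechet_derivative_at[symmetric])
  have "((\<lambda>y. (x, y)) has_derivative (\<lambda>u. (0, u))) (at y)" by (intro derivative_intros)
  from diff_chain_at[OF this H] show "frechet_derivative (\<lambda>y. H (x, y)) (at y) v = frechet_derivative H (at (x, y)) (0, v)"
    by (simp add: o_def frechet_derivative_at[symmetric])
qed

lemma smooth_funs_slice:
  fixes A :: "('k::{t2_space, second_countable_topology}, 'e::real_normed_vector) atlas"
  assumes A: "smooth_manifold A" and h: "h \<in> smooth_funs (prod_atlas A A)"
  shows "(\<lambda>x. h (x, p)) \<in> smooth_funs A" "(\<lambda>x. h (p, x)) \<in> smooth_funs A" "(\<lambda>z. h (snd z, fst z)) \<in> smooth_funs (prod_atlas A A)"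
proof -
  note P = smooth_manifold_prod[OF A A]
  show "(\<lambda>x. h (x, p)) \<in> smooth_funs A"
    by (rule smooth_funs_compose[OF A P smooth_map_Pair[OF A A A smooth_map_id[OF A] smooth_map_const] h])
  show "(\<lambda>x. h (p, x)) \<in> smooth_funs A"
    by (rule smooth_funs_compose[OF A P smooth_map_Pair[OF A A A smooth_map_const smooth_map_id[OF A]] h])
  show "(\<lambda>z. h (snd z, fst z)) \<in> smooth_funs (prod_atlas A A)"
    by (rule smooth_funs_compose[OF P P smooth_map_Pair[OF P A A smooth_map_fst(2)[OF A A] smooth_map_fst(1)[OF A A]] h])
qed

text \<open>The derivative of each slice becomes a partial derivative of one function on the product
  chart, in which the parameter \<open>q\<close> enters as part of the base point. This exposes the
  dependence on \<open>q\<close>.\<close>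

lemma tangent_slice_in_chart:
  fixes A :: "('k::{t2_space, second_countable_topology}, 'e::real_normed_vector) atlas"
    and c :: "'e \<Rightarrow> 'e \<Rightarrow> real"
  assumes A: "smooth_manifold A" and U: "(U, \<phi>) \<in> A" "x0 \<in> U" and V: "(V, \<psi>) \<in> A" "q \<in> V"
    and h: "h \<in> smooth_funs (prod_atlas A A)"
    and \<alpha>: "\<And>f. f \<in> smooth_funs A \<Longrightarrow> a f = (\<Sum>b\<in>B. \<alpha> b * frechet_derivative (f \<circ> inv_into U \<phi>) (at (\<phi> x0)) b)"
  shows "a (\<lambda>x. h (x, q)) = (\<Sum>b\<in>B. \<alpha> b *
    frechet_derivative (\<lambda>z. h (inv_into U \<phi> (fst z), inv_into V \<psi> (snd z))) (at (\<phi> x0, \<psi> q)) (b, 0))"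
proof -
  note DU = smooth_manifoldD[OF A U(1)] and DV = smooth_manifoldD[OF A V(1)]
  define H where "H = (\<lambda>z. h (inv_into U \<phi> (fst z), inv_into V \<psi> (snd z)))"
  have "smooth_on (\<phi> ` U \<times> \<psi> ` V) H" unfolding H_def by (rule smooth_funs_prodD[OF A U(1) V(1) h])
  from smooth_on_has_derivative[OF this, of "(\<phi> x0, \<psi> q)"] U V
  have dH: "H differentiable (at (\<phi> x0, \<psi> q))" by (auto intro: differentiableI)
  have "(\<lambda>x. h (x, q)) \<circ> inv_into U \<phi> = (\<lambda>x. H (x, \<psi> q))"
    using DV(4) V(2) by (auto simp: H_def inv_into_f_f)
  then show ?thesis
    using \<alpha>[OF smooth_funs_slice(1)[OF A h, of q]] frechet_derivative_slice(1)[OF dH] unfolding H_def[symmetric] by simp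
qed

text \<open>Differentiating in one variable leaves a smooth function of the other. For
  \<open>h (x, y) = f (x \<cdot> y)\<close> on a group this is the smoothness of right and left
  invariant vector fields. The second part reduces to the first by exchanging the variables.\<close>

lemma smooth_funs_tangent_slice:
  fixes A :: "('k::{t2_space, second_countable_topology}, 'e::real_normed_vector) atlas"
  assumes A: "smooth_manifold A" and K: "compact (UNIV :: 'k set)"
    and h: "h \<in> smooth_funs (prod_atlas A A)" and a: "a \<in> tangent A x0"
  shows "(\<lambda>q. a (\<lambda>x. h (x, q))) \<in> smooth_funs A" "(\<lambda>q. a (\<lambda>x. h (q, x))) \<in> smooth_funs A"
proof -
  have *: "(\<lambda>q. a (\<lambda>x. h (x, q))) \<in> smooth_funs A" if h: "h \<in> smooth_funs (prod_atlas A A)" for h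
  proof (rule smooth_funsI)
    fix V \<psi> assume V: "(V, \<psi>) \<in> A"
    note DV = smooth_manifoldD[OF A V]
    obtain U \<phi> where U: "(U, \<phi>) \<in> A" "x0 \<in> U" using smooth_manifold_chart[OF A] by blast
    note DU = smooth_manifoldD[OF A U(1)]
    obtain B and c :: "'e \<Rightarrow> 'e \<Rightarrow> real" where c: "coords B c" using smooth_manifold_coords[OF A] by blast
    obtain cB and c' :: "'e \<times> 'e \<Rightarrow> 'e \<times> 'e \<Rightarrow> real" where c': "coords cB c'" using coords_prod[OF c c] by blast
    obtain \<alpha> where \<alpha>: "\<And>f. f \<in> smooth_funs A \<Longrightarrow> a f = (\<Sum>b\<in>B. \<alpha> b * frechet_derivative (f \<circ> inv_into U \<phi>) (at (\<phi> x0)) b)"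
      using tangent_in_chart[OF A K U c a] by blast
    define H where "H = (\<lambda>z. h (inv_into U \<phi> (fst z), inv_into V \<psi> (snd z)))"
    have sH: "smooth_on (\<phi> ` U \<times> \<psi> ` V) H" unfolding H_def by (rule smooth_funs_prodD[OF A U(1) V h])
    have oUV: "open (\<phi> ` U \<times> \<psi> ` V)" using DU DV by (simp add: open_Times)
    have bl: "bounded_linear (\<lambda>y::'e. (0::'e, y))" by (intro bounded_linear_Pair bounded_linear_ident bounded_linear_zero)
    have "smooth_on (\<psi> ` V) (\<lambda>y. (0, y) + (\<phi> x0, 0))" by (rule smooth_on_affine[OF bl DV(2)])
    then have aff: "smooth_on (\<psi> ` V) (\<lambda>y. (\<phi> x0, y))" by simp
    have "smooth_on (\<psi> ` V) (\<lambda>y. \<Sum>b\<in>B. \<alpha> b * frechet_derivative H (at (\<phi> x0, y)) (b, 0))"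
      by (intro smooth_on_sum DV smooth_on_mult smooth_on_const
          smooth_on_compose[OF c' DV(2) oUV _ smooth_on_derivative[OF sH] aff]) (use U in auto)
    then show "smooth_on (\<psi> ` V) ((\<lambda>q. a (\<lambda>x. h (x, q))) \<circ> inv_into V \<psi>)"
      by (rule smooth_on_cong[OF DV(2), rotated])
        (use tangent_slice_in_chart[OF A U V _ h \<alpha>] DV(4) in \<open>auto simp: H_def inv_into_f_f\<close>)
  qed
  show "(\<lambda>q. a (\<lambda>x. h (x, q))) \<in> smooth_funs A" by (rule *[OF h])
  show "(\<lambda>q. a (\<lambda>x. h (q, x))) \<in> smooth_funs A" using *[OF smooth_funs_slice(3)[OF A h]] by simp
qed

text \<open>In charts, \<open>a\<close> and \<open>b\<close> are combinations of partial derivatives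
  in the first and in the second variable; symmetry of second derivatives lets them pass each
  other.\<close>

lemma tangent_commute:
  fixes A :: "('k::{t2_space, second_countable_topology}, 'e::real_normed_vector) atlas"
  assumes A: "smooth_manifold A" and K: "compact (UNIV :: 'k set)"
    and h: "h \<in> smooth_funs (prod_atlas A A)" and a: "a \<in> tangent A p" and b: "b \<in> tangent A q"
  shows "a (\<lambda>x. b (\<lambda>y. h (x, y))) = b (\<lambda>y. a (\<lambda>x. h (x, y)))"
proof -
  obtain U \<phi> where U: "(U, \<phi>) \<in> A" "p \<in> U" using smooth_manifold_chart[OF A] by blast
  obtain V \<psi> where V: "(V, \<psi>) \<in> A" "q \<in> V" using smooth_manifold_chart[OF A] by blast
  note DU = smooth_manifoldD[OF A U(1)] and DV = smooth_manifoldD[OF A V(1)]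
  obtain B and c :: "'e \<Rightarrow> 'e \<Rightarrow> real" where c: "coords B c" using smooth_manifold_coords[OF A] by blast
  obtain \<alpha> where \<alpha>: "\<And>f. f \<in> smooth_funs A \<Longrightarrow> a f = (\<Sum>b\<in>B. \<alpha> b * frechet_derivative (f \<circ> inv_into U \<phi>) (at (\<phi> p)) b)"
    using tangent_in_chart[OF A K U c a] by blast
  obtain \<beta> where \<beta>: "\<And>f. f \<in> smooth_funs A \<Longrightarrow> b f = (\<Sum>j\<in>B. \<beta> j * frechet_derivative (f \<circ> inv_into V \<psi>) (at (\<psi> q)) j)"
    using tangent_in_chart[OF A K V c b] by blast
  define H where "H = (\<lambda>z. h (inv_into U \<phi> (fst z), inv_into V \<psi> (snd z)))"
  have sH: "smooth_on (\<phi> ` U \<times> \<psi> ` V) H" unfolding H_def by (rule smooth_funs_prodD[OF A U(1) V(1) h])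
  have oUV: "open (\<phi> ` U \<times> \<psi> ` V)" using DU DV by (simp add: open_Times)
  define HD where "HD = (\<lambda>w z. frechet_derivative H (at z) w)"
  have sHD: "smooth_on (\<phi> ` U \<times> \<psi> ` V) (HD w)" for w unfolding HD_def by (rule smooth_on_derivative[OF sH])
  have dH: "H differentiable (at (x, y))" if "x \<in> \<phi> ` U" "y \<in> \<psi> ` V" for x y
    using smooth_on_has_derivative[OF sH, of "(x, y)"] that by (auto intro: differentiableI)
  have dHD: "(HD w has_derivative frechet_derivative (HD w) (at (\<phi> p, \<psi> q))) (at (\<phi> p, \<psi> q))" for w
    using smooth_on_has_derivative[OF sHD, of "(\<phi> p, \<psi> q)"] U V by auto
  have fa: "a (\<lambda>x. h (x, inv_into V \<psi> y)) = (\<Sum>i\<in>B. \<alpha> i * HD (i, 0) (\<phi> p, y))" if y: "y \<in> \<psi> ` V" for y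
  proof -
    have "(\<lambda>x. h (x, inv_into V \<psi> y)) \<circ> inv_into U \<phi> = (\<lambda>x. H (x, y))" by (auto simp: H_def)
    then show ?thesis
      using \<alpha>[OF smooth_funs_slice(1)[OF A h, of "inv_into V \<psi> y"]] frechet_derivative_slice(1)[OF dH[OF _ y]] U(2)
      by (simp add: HD_def)
  qed
  have fb: "b (\<lambda>y. h (inv_into U \<phi> x, y)) = (\<Sum>j\<in>B. \<beta> j * HD (0, j) (x, \<psi> q))" if x: "x \<in> \<phi> ` U" for x
  proof -
    have "(\<lambda>y. h (inv_into U \<phi> x, y)) \<circ> inv_into V \<psi> = (\<lambda>y. H (x, y))" by (auto simp: H_def)
    then show ?thesis
      using \<beta>[OF smooth_funs_slice(2)[OF A h, of "inv_into U \<phi> x"]] frechet_derivative_slice(2)[OF dH[OF x]] V(2)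
      by (simp add: HD_def)
  qed
  have "a (\<lambda>x. b (\<lambda>y. h (x, y))) = (\<Sum>i\<in>B. \<alpha> i * (\<Sum>j\<in>B. \<beta> j * frechet_derivative (HD (0, j)) (at (\<phi> p, \<psi> q)) (i, 0)))"
  proof -
    have "((\<lambda>x. \<Sum>j\<in>B. \<beta> j * HD (0, j) (x, \<psi> q)) has_derivative (\<lambda>u. \<Sum>j\<in>B. \<beta> j * frechet_derivative (HD (0, j)) (at (\<phi> p, \<psi> q)) (u, 0))) (at (\<phi> p))"
    proof (intro has_derivative_sum has_derivative_mult_right)
      fix j
      have "((\<lambda>x. (x, \<psi> q)) has_derivative (\<lambda>u. (u, 0))) (at (\<phi> p))" by (intro derivative_intros)
      from diff_chain_at[OF this dHD[of "(0, j)"]]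
      show "((\<lambda>x. HD (0, j) (x, \<psi> q)) has_derivative (\<lambda>u. frechet_derivative (HD (0, j)) (at (\<phi> p, \<psi> q)) (u, 0))) (at (\<phi> p))" by (simp add: o_def)
    qed
    then have "((\<lambda>x. b (\<lambda>y. h (x, y))) \<circ> inv_into U \<phi> has_derivative (\<lambda>u. \<Sum>j\<in>B. \<beta> j * frechet_derivative (HD (0, j)) (at (\<phi> p, \<psi> q)) (u, 0))) (at (\<phi> p))"
      by (rule has_derivative_transform_within_open[OF _ DU(2)]) (use U fb in auto)
    from frechet_derivative_at[OF this] show ?thesis
      using \<alpha>[OF smooth_funs_tangent_slice(2)[OF A K h b]] by (simp add: fun_eq_iff)
  qed
  moreover have "b (\<lambda>y. a (\<lambda>x. h (x, y))) = (\<Sum>j\<in>B. \<beta> j * (\<Sum>i\<in>B. \<alpha> i * frechet_derivative (HD (i, 0)) (at (\<phi> p, \<psi> q)) (0, j)))"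
  proof -
    have "((\<lambda>y. \<Sum>i\<in>B. \<alpha> i * HD (i, 0) (\<phi> p, y)) has_derivative (\<lambda>u. \<Sum>i\<in>B. \<alpha> i * frechet_derivative (HD (i, 0)) (at (\<phi> p, \<psi> q)) (0, u))) (at (\<psi> q))"
    proof (intro has_derivative_sum has_derivative_mult_right)
      fix i
      have "((\<lambda>y. (\<phi> p, y)) has_derivative (\<lambda>u. (0, u))) (at (\<psi> q))" by (intro derivative_intros)
      from diff_chain_at[OF this dHD[of "(i, 0)"]]
      show "((\<lambda>y. HD (i, 0) (\<phi> p, y)) has_derivative (\<lambda>u. frechet_derivative (HD (i, 0)) (at (\<phi> p, \<psi> q)) (0, u))) (at (\<psi> q))" by (simp add: o_def)
    qed
    then have "((\<lambda>y. a (\<lambda>x. h (x, y))) \<circ> inv_into V \<psi> has_derivative (\<lambda>u. \<Sum>i\<in>B. \<alpha> i * frechet_derivative (HD (i, 0)) (at (\<phi> p, \<psi> q)) (0, u))) (at (\<psi> q))"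
      by (rule has_derivative_transform_within_open[OF _ DV(2)]) (use V fa in auto)
    from frechet_derivative_at[OF this] show ?thesis
      using \<beta>[OF smooth_funs_tangent_slice(1)[OF A K h a]] by (simp add: fun_eq_iff)
  qed
  moreover have "frechet_derivative (HD (0, j)) (at (\<phi> p, \<psi> q)) (i, 0) = frechet_derivative (HD (i, 0)) (at (\<phi> p, \<psi> q)) (0, j)" for i j
    unfolding HD_def using U V by (intro second_derivative_commute[OF oUV _ sH]) auto
  ultimately show ?thesis
    by (simp add: sum_distrib_left mult_ac) (subst sum.swap, simp)
qed

section \<open>Vector fields, 1-forms and metrics\<close>

lemma sum_fun_apply: "(\<Sum>i\<in>I. F i) x = (\<Sum>i\<in>I. F i x)"
  by (induction I rule: infinite_finite_induct) auto

text \<open>Combinations with functions as coefficients, against which linearity over functions is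
  tested.\<close>

definition vcomb :: "nat \<Rightarrow> (nat \<Rightarrow> 'k \<Rightarrow> complex) \<Rightarrow> (nat \<Rightarrow> 'k \<Rightarrow> 'k tvec) \<Rightarrow> 'k \<Rightarrow> 'k tvec" where
  "vcomb n g E q = (\<Sum>i<n. cscale (g i q) (E i q))"

lemma vcomb_apply: "vcomb n g E q f = (\<Sum>i<n. g i q * E i q f)"
  by (simp add: vcomb_def sum_fun_apply cscale_def)

lemma tangent_closed:
  "0 \<in> tangent A p" "u \<in> tangent A p \<Longrightarrow> v \<in> tangent A p \<Longrightarrow> u + v \<in> tangent A p"
  "v \<in> tangent A p \<Longrightarrow> cscale c v \<in> tangent A p"
  "u \<in> tangent A p \<Longrightarrow> v \<in> tangent A p \<Longrightarrow> u - v \<in> tangent A p"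
  "v \<in> tangent A p \<Longrightarrow> - v \<in> tangent A p"
  "(\<And>i. i \<in> I \<Longrightarrow> w i \<in> tangent A p) \<Longrightarrow> (\<Sum>i\<in>I. w i) \<in> tangent A p"
  using fvec.subspace_0 fvec.subspace_add fvec.subspace_scale fvec.subspace_diff fvec.subspace_neg fvec.subspace_sum
    tangent_subspace by metis+

lemma tconj_tconj [simp]: "tconj (tconj v) = v"
  by (simp add: tconj_def)

lemma tconj_add: "tconj (u + v) = tconj u + tconj v"
  by (auto simp: tconj_def)

lemma tconj_cscale: "tconj (cscale c v) = cscale (cnj c) (tconj v)"
  by (auto simp: tconj_def cscale_def)

lemma tconj_zero [simp]: "tconj 0 = 0"
  by (auto simp: tconj_def)

lemma tconj_minus: "tconj (- v) = - tconj v"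
  by (auto simp: tconj_def)

lemma tangent_tconj:
  assumes "smooth_manifold A" "v \<in> tangent A p"
  shows "tconj v \<in> tangent A p"
proof (rule tangentI)
  note c = smooth_funs_cnj[OF assms(1)]
  fix f assume "f \<notin> smooth_funs A"
  then have "(\<lambda>x. cnj (f x)) \<notin> smooth_funs A" using c[of "\<lambda>x. cnj (f x)"] by auto
  then show "tconj v f = 0" using tangent_outside[OF assms(2)] by (simp add: tconj_def)
next
  note c = smooth_funs_cnj[OF assms(1)]
  fix f g assume "f \<in> smooth_funs A" "g \<in> smooth_funs A"
  then show "tconj v (\<lambda>x. f x + g x) = tconj v f + tconj v g" "tconj v (\<lambda>x. f x * g x) = tconj v f * g p + f p * tconj v g"
    by (simp_all add: tconj_def tangent_add[OF assms(2) c c] tangent_mult[OF assms(2) c c])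
next
  note c = smooth_funs_cnj[OF assms(1)]
  fix f d assume "f \<in> smooth_funs A"
  then show "tconj v (\<lambda>x. d * f x) = d * tconj v f"
    by (simp add: tconj_def tangent_cscale[OF assms(2) c])
qed

lemma cotangent_add: "\<xi> \<in> cotangent A p \<Longrightarrow> u \<in> tangent A p \<Longrightarrow> v \<in> tangent A p \<Longrightarrow> \<xi> (u + v) = \<xi> u + \<xi> v"
  by (simp add: cotangent_def)

lemma cotangent_cscale: "\<xi> \<in> cotangent A p \<Longrightarrow> v \<in> tangent A p \<Longrightarrow> \<xi> (cscale c v) = c * \<xi> v"
  by (simp add: cotangent_def)

lemma cotangent_zero: "\<xi> \<in> cotangent A p \<Longrightarrow> \<xi> 0 = 0"
  using cotangent_cscale[OF _ tangent_closed(1), of \<xi> A p 0] by (simp add: cscale_def zero_fun_def)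

lemma cotangent_sum:
  assumes "\<xi> \<in> cotangent A p" "\<And>i. i \<in> I \<Longrightarrow> w i \<in> tangent A p"
  shows "\<xi> (\<Sum>i\<in>I. w i) = (\<Sum>i\<in>I. \<xi> (w i))"
  using assms(2)
  by (induction I rule: infinite_finite_induct)
    (auto simp: cotangent_zero[OF assms(1)] cotangent_add[OF assms(1)] tangent_closed)

lemma vfieldsD: "X \<in> vfields A \<Longrightarrow> X p \<in> tangent A p" "X \<in> vfields A \<Longrightarrow> f \<in> smooth_funs A \<Longrightarrow> (\<lambda>p. X p f) \<in> smooth_funs A"
  by (simp_all add: vfields_def)

lemma oneformsD: "\<xi> \<in> oneforms A \<Longrightarrow> \<xi> p \<in> cotangent A p" "\<xi> \<in> oneforms A \<Longrightarrow> X \<in> vfields A \<Longrightarrow> (\<lambda>p. \<xi> p (X p)) \<in> smooth_funs A"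
  by (simp_all add: oneforms_def)

lemma vcomb_tangent: "(\<And>i. i < n \<Longrightarrow> E i \<in> vfields A) \<Longrightarrow> vcomb n g E p \<in> tangent A p"
  unfolding vcomb_def by (rule tangent_closed(6)) (auto intro: tangent_closed(3) dest: vfieldsD(1))

lemma vcomb_vfields:
  assumes "smooth_manifold A" "\<And>i. i < n \<Longrightarrow> E i \<in> vfields A" "\<And>i. i < n \<Longrightarrow> g i \<in> smooth_funs A"
  shows "vcomb n g E \<in> vfields A"
  unfolding vfields_def
proof (intro CollectI conjI allI ballI)
  show "vcomb n g E p \<in> tangent A p" for p by (rule vcomb_tangent[OF assms(2)])
  show "(\<lambda>p. vcomb n g E p f) \<in> smooth_funs A" if "f \<in> smooth_funs A" for f
    unfolding vcomb_apply
    by (rule smooth_funs_sum[OF assms(1)], rule smooth_funs_mult[OF assms(1)])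
      (simp_all add: assms that vfieldsD(2))
qed

lemma cotangent_vcomb:
  assumes "\<xi> \<in> cotangent A p" "\<And>i. i < n \<Longrightarrow> E i \<in> vfields A"
  shows "\<xi> (vcomb n g E p) = (\<Sum>i<n. g i p * \<xi> (E i p))"
proof -
  have E: "E i p \<in> tangent A p" if "i < n" for i using assms(2)[OF that] by (rule vfieldsD)
  then show ?thesis unfolding vcomb_def
    by (subst cotangent_sum[OF assms(1)]) (simp_all add: tangent_closed(3) cotangent_cscale[OF assms(1)])
qed

lemma lie_br_outside:
  assumes "X \<in> vfields A" "Y \<in> vfields A" "f \<notin> smooth_funs A"
  shows "lie_br X Y p f = 0"
  using tangent_outside[OF vfieldsD(1)[OF assms(1)] assms(3)] tangent_outside[OF vfieldsD(1)[OF assms(2)] assms(3)]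
    tangent_const[OF vfieldsD(1)[OF assms(1)], of p 0] tangent_const[OF vfieldsD(1)[OF assms(2)], of p 0]
  by (simp add: lie_br_def)

lemma lie_br_tangent:
  assumes A: "smooth_manifold A" and X: "X \<in> vfields A" and Y: "Y \<in> vfields A"
  shows "lie_br X Y p \<in> tangent A p"
proof (rule tangentI)
  note Xp = vfieldsD(1)[OF X] and Yp = vfieldsD(1)[OF Y] and Xf = vfieldsD(2)[OF X] and Yf = vfieldsD(2)[OF Y]
  fix f assume "f \<notin> smooth_funs A"
  then show "lie_br X Y p f = 0" by (rule lie_br_outside[OF X Y])
next
  note Xp = vfieldsD(1)[OF X] and Yp = vfieldsD(1)[OF Y] and Xf = vfieldsD(2)[OF X] and Yf = vfieldsD(2)[OF Y]
  fix f g assume fg: "f \<in> smooth_funs A" "g \<in> smooth_funs A"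
  show "lie_br X Y p (\<lambda>x. f x + g x) = lie_br X Y p f + lie_br X Y p g"
    by (simp add: lie_br_def tangent_add[OF Xp] tangent_add[OF Yp] fg Xf Yf)
  \<comment> \<open>The mixed products of first derivatives are symmetric under exchange of
    \<open>X\<close> and \<open>Y\<close> and cancel in the commutator, which leaves the Leibniz
    rule.\<close>
  have "X p (\<lambda>q. Y q f * g q + f q * Y q g) = X p (\<lambda>q. Y q f) * g p + Y p f * X p g + (X p f * Y p g + f p * X p (\<lambda>q. Y q g))"
    "Y p (\<lambda>q. X q f * g q + f q * X q g) = Y p (\<lambda>q. X q f) * g p + X p f * Y p g + (Y p f * X p g + f p * Y p (\<lambda>q. X q g))"
    by (simp_all add: tangent_add[OF Xp] tangent_mult[OF Xp] tangent_add[OF Yp] tangent_mult[OF Yp] smooth_funs_mult[OF A] fg Xf Yf)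
  then show "lie_br X Y p (\<lambda>x. f x * g x) = lie_br X Y p f * g p + f p * lie_br X Y p g"
    by (simp add: lie_br_def tangent_mult[OF Xp] tangent_mult[OF Yp] fg algebra_simps)
next
  note Xp = vfieldsD(1)[OF X] and Yp = vfieldsD(1)[OF Y] and Xf = vfieldsD(2)[OF X] and Yf = vfieldsD(2)[OF Y]
  fix f c assume f: "f \<in> smooth_funs A"
  show "lie_br X Y p (\<lambda>x. c * f x) = c * lie_br X Y p f"
    by (simp add: lie_br_def tangent_cscale[OF Xp] tangent_cscale[OF Yp] f Xf Yf algebra_simps)
qed

lemma lie_br_swap: "lie_br Y X p = - lie_br X Y p"
  by (auto simp: lie_br_def)

lemma lie_br_vcomb:
  assumes A: "smooth_manifold A" and X: "X \<in> vfields A" and E: "\<And>i. i < n \<Longrightarrow> E i \<in> vfields A"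
    and g: "\<And>i. i < n \<Longrightarrow> g i \<in> smooth_funs A"
  shows "lie_br X (vcomb n g E) p = (\<Sum>i<n. cscale (X p (g i)) (E i p) + cscale (g i p) (lie_br X (E i) p))"
proof
  fix f
  show "lie_br X (vcomb n g E) p f = (\<Sum>i<n. cscale (X p (g i)) (E i p) + cscale (g i p) (lie_br X (E i) p)) f"
  proof (cases "f \<in> smooth_funs A")
    case True
    note Xp = vfieldsD(1)[OF X]
    have "X p (\<lambda>q. \<Sum>i<n. g i q * E i q f) = (\<Sum>i<n. X p (g i) * E i p f + g i p * X p (\<lambda>q. E i q f))"
      by (subst tangent_sum[OF A Xp]) (simp_all add: smooth_funs_mult[OF A] tangent_mult[OF Xp] vfieldsD(2)[OF E True] g)
    then show ?thesis
      by (simp add: lie_br_def vcomb_apply sum_fun_apply cscale_def sum.distrib sum_subtractf algebra_simps)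
  next
    case False
    have "lie_br X (vcomb n g E) p f = 0" by (rule lie_br_outside[OF X vcomb_vfields[OF A E g] False])
    moreover have "E i p f = 0" "lie_br X (E i) p f = 0" if "i < n" for i
      using tangent_outside[OF vfieldsD(1)[OF E[OF that]] False] lie_br_outside[OF X E[OF that] False] by auto
    ultimately show ?thesis by (simp add: sum_fun_apply cscale_def)
  qed
qed

text \<open>The summands with \<open>X p (g i)\<close> measure how far each expression is from being
  linear over functions. In Lie and exterior derivatives they occur in cancelling pairs.\<close>

lemma oneform_vcomb:
  assumes A: "smooth_manifold A" and X: "X \<in> vfields A" and E: "\<And>i. i < n \<Longrightarrow> E i \<in> vfields A"
    and g: "\<And>i. i < n \<Longrightarrow> g i \<in> smooth_funs A" and \<eta>: "\<eta> \<in> oneforms A"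
  shows "X p (\<lambda>q. \<eta> q (vcomb n g E q)) = (\<Sum>i<n. X p (g i) * \<eta> p (E i p) + g i p * X p (\<lambda>q. \<eta> q (E i q)))"
    and "\<eta> p (lie_br X (vcomb n g E) p) = (\<Sum>i<n. X p (g i) * \<eta> p (E i p) + g i p * \<eta> p (lie_br X (E i) p))"
    and "\<eta> p (lie_br (vcomb n g E) X p) = (\<Sum>i<n. g i p * \<eta> p (lie_br (E i) X p) - X p (g i) * \<eta> p (E i p))"
proof -
  note Xp = vfieldsD(1)[OF X] and \<eta>p = oneformsD(1)[OF \<eta>]
  have "X p (\<lambda>q. \<Sum>i<n. g i q * \<eta> q (E i q)) = (\<Sum>i<n. X p (g i) * \<eta> p (E i p) + g i p * X p (\<lambda>q. \<eta> q (E i q)))"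
    by (subst tangent_sum[OF A Xp]) (simp_all add: smooth_funs_mult[OF A] tangent_mult[OF Xp] oneformsD(2)[OF \<eta> E] g)
  then show "X p (\<lambda>q. \<eta> q (vcomb n g E q)) = (\<Sum>i<n. X p (g i) * \<eta> p (E i p) + g i p * X p (\<lambda>q. \<eta> q (E i q)))"
    using cotangent_vcomb[OF \<eta>p E] by simp
  have t: "lie_br X (E i) p \<in> tangent A p" "E i p \<in> tangent A p" "lie_br (E i) X p \<in> tangent A p" if "i < n" for i
    by (rule lie_br_tangent[OF A X E[OF that]] vfieldsD(1)[OF E[OF that]] lie_br_tangent[OF A E[OF that] X])+
  show *: "\<eta> p (lie_br X (vcomb n g E) p) = (\<Sum>i<n. X p (g i) * \<eta> p (E i p) + g i p * \<eta> p (lie_br X (E i) p))"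
    unfolding lie_br_vcomb[of A X n E g, OF A X E g, simplified]
    by (subst cotangent_sum[OF \<eta>p])
      (simp_all add: cotangent_add[OF \<eta>p] cotangent_cscale[OF \<eta>p] tangent_closed(2,3) t)
  have neg: "\<eta> p (- v) = - \<eta> p v" if "v \<in> tangent A p" for v
  proof -
    have "- v = cscale (-1) v" by (auto simp: cscale_def)
    then show ?thesis using cotangent_cscale[OF \<eta>p that, of "-1"] by simp
  qed
  have "\<eta> p (lie_br (vcomb n g E) X p) = - \<eta> p (lie_br X (vcomb n g E) p)"
    unfolding lie_br_swap[of "vcomb n g E" X p]
    by (rule neg[OF lie_br_tangent[OF A X vcomb_vfields[OF A]]]) (simp_all add: E g)
  also have "\<dots> = (\<Sum>i<n. g i p * - \<eta> p (lie_br X (E i) p) - X p (g i) * \<eta> p (E i p))"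
    unfolding * sum_negf[symmetric] by (intro sum.cong refl) simp
  also have "\<dots> = (\<Sum>i<n. g i p * \<eta> p (lie_br (E i) X p) - X p (g i) * \<eta> p (E i p))"
    by (intro sum.cong refl) (simp add: lie_br_swap[of "E _" X] neg t)
  finally show "\<eta> p (lie_br (vcomb n g E) X p) = (\<Sum>i<n. g i p * \<eta> p (lie_br (E i) X p) - X p (g i) * \<eta> p (E i p))" .
qed

section \<open>Complex bilinear extension of a Riemannian metric\<close>

lemma riemannianD:
  assumes "riemannian A g" "u \<in> tangent A p" "v \<in> tangent A p"
  shows "g p u v = g p v u" "g p (cscale c u) v = c * g p u v" "g p u (cscale c v) = c * g p u v"
    "w \<in> tangent A p \<Longrightarrow> g p (u + w) v = g p u v + g p w v"
    "w \<in> tangent A p \<Longrightarrow> g p u (v + w) = g p u v + g p u w"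
proof -
  have *: "g p u v = g p v u \<and> (\<forall>c. g p (cscale c u) v = c * g p u v) \<and> (\<forall>w\<in>tangent A p. g p (u + w) v = g p u v + g p w v)"
    if "u \<in> tangent A p" "v \<in> tangent A p" for u v
    by (rule bspec[OF bspec[OF spec[OF conjunct1[OF assms(1)[unfolded riemannian_def]]] that(1)] that(2)])
  have sym: "g p u v = g p v u" if "u \<in> tangent A p" "v \<in> tangent A p" for u v by (rule conjunct1[OF *[OF that]])
  have sc: "g p (cscale c u) v = c * g p u v" if "u \<in> tangent A p" "v \<in> tangent A p" for u v c
    using conjunct1[OF conjunct2[OF *[OF that]]] by (rule spec)
  have ad: "g p (u + w) v = g p u v + g p w v" if "u \<in> tangent A p" "v \<in> tangent A p" "w \<in> tangent A p" for u v w
    using conjunct2[OF conjunct2[OF *[OF that(1,2)]]] that(3) by (rule bspec)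
  show "g p u v = g p v u" "g p (cscale c u) v = c * g p u v" by (rule sym[OF assms(2,3)] sc[OF assms(2,3)])+
  show "w \<in> tangent A p \<Longrightarrow> g p (u + w) v = g p u v + g p w v" by (rule ad[OF assms(2,3)])
  show "g p u (cscale c v) = c * g p u v"
  proof -
    have "g p u (cscale c v) = g p (cscale c v) u" by (rule sym[OF assms(2) tangent_closed(3)[OF assms(3)]])
    also have "\<dots> = c * g p v u" by (rule sc[OF assms(3,2)])
    also have "g p v u = g p u v" by (rule sym[OF assms(3,2)])
    finally show ?thesis .
  qed
  show "g p u (v + w) = g p u v + g p u w" if w: "w \<in> tangent A p"
  proof -
    have "g p u (v + w) = g p (v + w) u" by (rule sym[OF assms(2) tangent_closed(2)[OF assms(3) w]])
    also have "\<dots> = g p v u + g p w u" by (rule ad[OF assms(3,2) w])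
    also have "g p v u = g p u v" by (rule sym[OF assms(3,2)])
    also have "g p w u = g p u w" by (rule sym[OF w assms(2)])
    finally show ?thesis .
  qed
qed

lemma riemannian_smooth:
  assumes "riemannian A g" "X \<in> vfields A" "Y \<in> vfields A"
  shows "(\<lambda>p. g p (X p) (Y p)) \<in> smooth_funs A"
  by (rule bspec[OF bspec[OF conjunct2[OF conjunct2[OF conjunct2[OF assms(1)[unfolded riemannian_def]]]] assms(2)] assms(3)])

lemma tangent_real_imag:
  assumes A: "smooth_manifold A" and u: "u \<in> tangent A p"
  shows "\<exists>x\<in>real_tangent A p. \<exists>y\<in>real_tangent A p. u = x + cscale \<i> y \<and> tconj u = x + cscale (- \<i>) y"
proof -
  let ?x = "cscale (1/2) (u + tconj u)" and ?y = "cscale (- \<i> / 2) (u + cscale (-1) (tconj u))"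
  have t: "?x \<in> tangent A p" "?y \<in> tangent A p"
    using tangent_tconj[OF A u] u by (intro tangent_closed(2,3); simp)+
  have "tconj ?x = ?x" "tconj ?y = ?y"
    unfolding tconj_cscale tconj_add tconj_tconj by (auto simp: cscale_def fun_eq_iff field_simps)
  with t have "?x \<in> real_tangent A p" "?y \<in> real_tangent A p" by (simp_all only: real_tangent_def mem_Collect_eq)
  moreover have "u = ?x + cscale \<i> ?y" "tconj u = ?x + cscale (- \<i>) ?y"
    by (auto simp: cscale_def fun_eq_iff field_simps)
  ultimately show ?thesis by blast
qed

lemma riemannian_tconj:
  assumes A: "smooth_manifold A" and g: "riemannian A g" and u: "u \<in> tangent A p" and v: "v \<in> tangent A p"
  shows "g p (tconj u) (tconj v) = cnj (g p u v)"
proof -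
  obtain x y where xy: "x \<in> real_tangent A p" "y \<in> real_tangent A p" "u = x + cscale \<i> y" "tconj u = x + cscale (- \<i>) y"
    using tangent_real_imag[OF A u] by blast
  obtain x' y' where xy': "x' \<in> real_tangent A p" "y' \<in> real_tangent A p" "v = x' + cscale \<i> y'" "tconj v = x' + cscale (- \<i>) y'"
    using tangent_real_imag[OF A v] by blast
  have real: "g p a b \<in> \<real>" "cnj (g p a b) = g p a b" if "a \<in> real_tangent A p" "b \<in> real_tangent A p" for a b
    using g that unfolding riemannian_def by (auto simp: Reals_cnj_iff)
  have t: "x \<in> tangent A p" "y \<in> tangent A p" "x' \<in> tangent A p" "y' \<in> tangent A p"
    using xy xy' by (auto simp: real_tangent_def)
  have e: "g p (x + cscale c y) (x' + cscale d y') = g p x x' + d * g p x y' + c * g p y x' + c * d * g p y y'" for c d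
    by (simp add: riemannianD[OF g] t tangent_closed algebra_simps)
  show ?thesis unfolding xy(4) xy'(4) unfolding xy(3) xy'(3) e
    by (simp add: real xy(1,2) xy'(1,2))
qed

text \<open>For \<open>u = x + i y\<close> with real \<open>x\<close>, \<open>y\<close> the mixed
  terms cancel by symmetry and \<open>g x x + g y y\<close> remains. This turns the positivity of
  the metric on real vectors into that of a Hermitian form on complex ones.\<close>

lemma riemannian_tconj_pos:
  assumes A: "smooth_manifold A" and g: "riemannian A g" and u: "u \<in> tangent A p" "u \<noteq> 0"
  shows "Im (g p u (tconj u)) = 0" "Re (g p u (tconj u)) > 0"
proof -
  obtain x y where xy: "x \<in> real_tangent A p" "y \<in> real_tangent A p" "u = x + cscale \<i> y" "tconj u = x + cscale (- \<i>) y"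
    using tangent_real_imag[OF A u(1)] by blast
  have t: "x \<in> tangent A p" "y \<in> tangent A p" using xy by (auto simp: real_tangent_def)
  have "g p (x + cscale c y) (x + cscale d y) = g p x x + d * g p x y + c * g p y x + c * d * g p y y" for c d
    by (simp add: riemannianD[OF g] t tangent_closed algebra_simps)
  from this[of \<i> "- \<i>"] have "g p (x + cscale \<i> y) (x + cscale (- \<i>) y) = g p x x + g p y y"
    using riemannianD(1)[OF g t] by (simp del: fvec.scale_minus_left)
  then have e: "g p u (tconj u) = g p x x + g p y y" using xy by simp
  have real: "Im (g p a a) = 0" if "a \<in> real_tangent A p" for a
    using g that unfolding riemannian_def by (auto simp: complex_is_Real_iff)
  have pos: "Re (g p a a) > 0" if "a \<in> real_tangent A p" "a \<noteq> 0" for a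
    using g that unfolding riemannian_def by blast
  have z: "g p 0 0 = 0" using riemannianD(2)[OF g tangent_closed(1) tangent_closed(1), of p 0] by (simp add: cscale_def zero_fun_def)
  show "Im (g p u (tconj u)) = 0" using e real xy by simp
  have "x \<noteq> 0 \<or> y \<noteq> 0" using u xy by (auto simp: cscale_def zero_fun_def)
  then show "Re (g p u (tconj u)) > 0"
    unfolding e using pos[OF xy(1)] pos[OF xy(2)] z by (cases "x = 0"; cases "y = 0") auto
qed

lemma riemannian_nondegenerate:
  assumes A: "smooth_manifold A" and g: "riemannian A g" and u: "u \<in> tangent A p"
    and "\<And>w. w \<in> tangent A p \<Longrightarrow> g p u w = 0"
  shows "u = 0"
  using riemannian_tconj_pos(2)[OF A g u] assms(4)[OF tangent_tconj[OF A u]] by fastforce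

lemma flat_cotangent: "riemannian A g \<Longrightarrow> v \<in> tangent A p \<Longrightarrow> flat A g p v \<in> cotangent A p"
  unfolding cotangent_def flat_def by (auto simp: riemannianD tangent_closed)

lemma flat_oneform:
  assumes "riemannian A g" "X \<in> vfields A"
  shows "(\<lambda>q. flat A g q (X q)) \<in> oneforms A"
proof -
  have "(\<lambda>p. flat A g p (X p) (Y p)) = (\<lambda>p. g p (X p) (Y p))" if "Y \<in> vfields A" for Y
    using vfieldsD(1)[OF that] by (auto simp: flat_def)
  then show ?thesis unfolding oneforms_def
    using assms flat_cotangent[OF assms(1) vfieldsD(1)[OF assms(2)]] by (auto simp: riemannian_def)
qed

lemma flat_linear:
  assumes "riemannian A g" "u \<in> tangent A p" "v \<in> tangent A p"
  shows "flat A g p (u + v) = flat A g p u + flat A g p v" "flat A g p (cscale c u) = cscale c (flat A g p u)"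
  using assms by (auto simp: flat_def riemannianD fun_eq_iff cscale_def[of c "\<lambda>w. if _ w then _ w else 0"] cscale_def[of c "flat A g p u"])

lemma flat_inj:
  assumes A: "smooth_manifold A" and g: "riemannian A g" and u: "u \<in> tangent A p" and v: "v \<in> tangent A p"
    and e: "flat A g p u = flat A g p v"
  shows "u = v"
proof -
  have "u + cscale (-1) v = 0"
  proof (rule riemannian_nondegenerate[OF A g])
    show "u + cscale (-1) v \<in> tangent A p" using u v by (intro tangent_closed(2,3))
    fix w assume w: "w \<in> tangent A p"
    have "g p u w = g p v w" using fun_cong[OF e, of w] w by (simp add: flat_def)
    then show "g p (u + cscale (-1) v) w = 0"
      using riemannianD(4)[OF g u w tangent_closed(3)[OF v, of "-1"]] riemannianD(2)[OF g v w, of "-1"] by simp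
  qed
  then show ?thesis by (simp add: cscale_def fun_eq_iff)
qed

lemma sharp_flat:
  assumes "smooth_manifold A" "riemannian A g" "v \<in> tangent A p"
  shows "sharp A g p (flat A g p v) = v"
  unfolding sharp_def using assms flat_inj[OF assms(1,2)] by (intro inv_into_f_f) (auto simp: inj_on_def)

lemma push_tangent:
  assumes A: "smooth_manifold A" and F: "\<And>f. f \<in> smooth_funs A \<Longrightarrow> (\<lambda>x. f (F x)) \<in> smooth_funs A" and v: "v \<in> tangent A p"
  shows "push A F v \<in> tangent A (F p)"
proof (rule tangentI)
  fix f g assume fg: "f \<in> smooth_funs A" "g \<in> smooth_funs A"
  then show "push A F v (\<lambda>x. f x + g x) = push A F v f + push A F v g"
    "push A F v (\<lambda>x. f x * g x) = push A F v f * g (F p) + f (F p) * push A F v g"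
    by (simp_all add: push_def o_def smooth_funs_add[OF A] smooth_funs_mult[OF A] tangent_add[OF v] tangent_mult[OF v] F)
next
  fix f c assume "f \<in> smooth_funs A"
  then show "push A F v (\<lambda>x. c * f x) = c * push A F v f"
    using smooth_funs_cscale[OF A, of f c]
    by (simp add: push_def o_def tangent_cscale[OF v] F cscale_def)
qed (simp add: push_def)

section \<open>Compact Lie groups\<close>

locale compact_lie_group =
  fixes A :: "('k::{t2_space, second_countable_topology}, 'e::real_normed_vector) atlas"
    and K :: "'k monoid"
  assumes lie_group: "lie_group A K"
    and compact_univ: "compact (UNIV :: 'k set)"
begin

abbreviation mul :: "'k \<Rightarrow> 'k \<Rightarrow> 'k" (infixl "\<cdot>" 70) where "x \<cdot> y \<equiv> x \<otimes>\<^bsub>K\<^esub> y"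
abbreviation unit :: 'k where "unit \<equiv> \<one>\<^bsub>K\<^esub>"
abbreviation ginv :: "'k \<Rightarrow> 'k" where "ginv x \<equiv> inv\<^bsub>K\<^esub> x"
abbreviation R :: "'k tvec \<Rightarrow> 'k \<Rightarrow> 'k tvec" where "R \<equiv> right_field A K"
abbreviation L :: "'k tvec \<Rightarrow> 'k \<Rightarrow> 'k tvec" where "L \<equiv> left_field A K"
abbreviation \<gg> :: "'k tvec set" where "\<gg> \<equiv> lie_alg A K"

lemma manifold: "smooth_manifold A"
  using lie_group by (simp add: lie_group_def)

lemma group_laws [simp]:
  "x \<cdot> unit = x" "unit \<cdot> x = x" "x \<cdot> ginv x = unit" "ginv x \<cdot> x = unit" "ginv unit = unit"
  "x \<cdot> y \<cdot> ginv y = x" "x \<cdot> ginv y \<cdot> y = x" "ginv x \<cdot> (x \<cdot> y) = y" "x \<cdot> (ginv x \<cdot> y) = y"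
proof -
  interpret group K using lie_group by (simp add: lie_group_def)
  have c: "carrier K = UNIV" using lie_group by (simp add: lie_group_def)
  show "x \<cdot> unit = x" "unit \<cdot> x = x" "x \<cdot> ginv x = unit" "ginv x \<cdot> x = unit" "ginv unit = unit"
    "x \<cdot> y \<cdot> ginv y = x" "x \<cdot> ginv y \<cdot> y = x" "ginv x \<cdot> (x \<cdot> y) = y" "x \<cdot> (ginv x \<cdot> y) = y"
    by (simp_all add: c m_assoc) (simp_all add: c m_assoc[symmetric])
qed

lemma mul_assoc: "x \<cdot> y \<cdot> z = x \<cdot> (y \<cdot> z)"
proof -
  interpret group K using lie_group by (simp add: lie_group_def)
  have c: "carrier K = UNIV" using lie_group by (simp add: lie_group_def)
  show ?thesis by (simp add: c m_assoc)
qed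

lemma lie_alg_eq: "\<gg> = tangent A unit"
  by (simp add: lie_alg_def)

lemmas lie_alg_closed = tangent_closed[where A = A and p = unit, folded lie_alg_eq]
lemmas lie_alg_tconj = tangent_tconj[OF manifold, where p = unit, folded lie_alg_eq]

section \<open>Translations and invariant vector fields\<close>

lemma smooth_mul: "f \<in> smooth_funs A \<Longrightarrow> (\<lambda>z. f (fst z \<cdot> snd z)) \<in> smooth_funs (prod_atlas A A)"
proof -
  have "smooth_map (prod_atlas A A) A (\<lambda>z. fst z \<cdot> snd z)"
    using lie_group unfolding lie_group_def case_prod_unfold by (elim conjE)
  then show "f \<in> smooth_funs A \<Longrightarrow> (\<lambda>z. f (fst z \<cdot> snd z)) \<in> smooth_funs (prod_atlas A A)"
    by (rule smooth_funs_compose[OF smooth_manifold_prod[OF manifold manifold] manifold])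
qed

lemma smooth_translate: "f \<in> smooth_funs A \<Longrightarrow> (\<lambda>x. f (x \<cdot> p)) \<in> smooth_funs A"
  "f \<in> smooth_funs A \<Longrightarrow> (\<lambda>x. f (p \<cdot> x)) \<in> smooth_funs A"
  using smooth_funs_slice(1,2)[OF manifold smooth_mul] by fastforce+

lemma right_field_apply: "f \<in> smooth_funs A \<Longrightarrow> R a p f = a (\<lambda>x. f (x \<cdot> p))"
  and left_field_apply: "f \<in> smooth_funs A \<Longrightarrow> L a p f = a (\<lambda>x. f (p \<cdot> x))"
  by (simp_all add: right_field_def left_field_def push_def o_def)

lemma push_translate_tangent:
  assumes "v \<in> tangent A q"
  shows "push A (\<lambda>x. x \<cdot> p) v \<in> tangent A (q \<cdot> p)" "push A (\<lambda>x. p \<cdot> x) v \<in> tangent A (p \<cdot> q)"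
  by (rule push_tangent[OF manifold _ assms], erule smooth_translate)+

lemma right_field_tangent: "a \<in> \<gg> \<Longrightarrow> R a p \<in> tangent A p"
  using push_translate_tangent(1)[of a unit p] by (simp add: right_field_def lie_alg_def)

lemma left_field_tangent: "a \<in> \<gg> \<Longrightarrow> L a p \<in> tangent A p"
  using push_translate_tangent(2)[of a unit p] by (simp add: left_field_def lie_alg_def)

lemma right_field_vfields:
  assumes a: "a \<in> \<gg>"
  shows "R a \<in> vfields A"
  using smooth_funs_tangent_slice(1)[OF manifold compact_univ smooth_mul a[unfolded lie_alg_eq]]
  by (auto simp: vfields_def right_field_tangent[OF a] right_field_apply)

lemma left_field_vfields:
  assumes a: "a \<in> \<gg>"
  shows "L a \<in> vfields A"
  using smooth_funs_tangent_slice(2)[OF manifold compact_univ smooth_mul a[unfolded lie_alg_eq]]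
  by (auto simp: vfields_def left_field_tangent[OF a] left_field_apply)

lemma push_add: "push A F (u + v) = push A F u + push A F v"
  and push_cscale: "push A F (cscale c v) = cscale c (push A F v)"
  and push_tconj: "push A F (tconj v) = tconj (push A F v)"
proof -
  show "push A F (u + v) = push A F u + push A F v" "push A F (cscale c v) = cscale c (push A F v)"
    by (auto simp: push_def cscale_def)
  have "(\<lambda>x. cnj (f x)) \<in> smooth_funs A \<longleftrightarrow> f \<in> smooth_funs A" for f
    using smooth_funs_cnj[OF manifold, of f] smooth_funs_cnj[OF manifold, of "\<lambda>x. cnj (f x)"] by auto
  then show "push A F (tconj v) = tconj (push A F v)"
    by (auto simp: push_def tconj_def o_def)
qed

lemma push_push:
  assumes "\<And>f. f \<in> smooth_funs A \<Longrightarrow> (\<lambda>x. f (F x)) \<in> smooth_funs A"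
  shows "push A F (push A G v) = push A (\<lambda>x. F (G x)) v"
  using assms by (auto simp: push_def o_def)

lemma push_id: "v \<in> tangent A p \<Longrightarrow> push A (\<lambda>x. x) v = v"
  using tangent_outside by (fastforce simp: push_def o_def)

lemma theta_r_lie_alg: "v \<in> tangent A p \<Longrightarrow> theta_r A K p v \<in> \<gg>"
  using push_translate_tangent(1)[of v p "ginv p"] by (simp add: theta_r_def lie_alg_def)

lemma theta_r_right_field: "a \<in> \<gg> \<Longrightarrow> theta_r A K p (R a p) = a"
  unfolding theta_r_def right_field_def
  by (subst push_push) (auto intro: smooth_translate simp: push_id lie_alg_eq)

lemma right_field_theta_r: "v \<in> tangent A p \<Longrightarrow> R (theta_r A K p v) p = v"
  unfolding theta_r_def right_field_def
  by (subst push_push) (auto intro: smooth_translate simp: push_id)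

lemma theta_l_left_field: "a \<in> \<gg> \<Longrightarrow> theta_l A K p (L a p) = a"
  unfolding theta_l_def left_field_def
  by (subst push_push) (auto intro: smooth_translate simp: push_id lie_alg_eq)

lemma theta_l_lie_alg: "v \<in> tangent A p \<Longrightarrow> theta_l A K p v \<in> \<gg>"
  using push_translate_tangent(2)[of v p "ginv p"] by (simp add: theta_l_def lie_alg_def)

lemma theta_r_linear: "theta_r A K p (u + v) = theta_r A K p u + theta_r A K p v"
  "theta_r A K p (cscale c v) = cscale c (theta_r A K p v)"
  by (simp_all add: theta_r_def push_add push_cscale)

lemma field_linear: "R (a + b) p = R a p + R b p" "L (a + b) p = L a p + L b p"
  "R (cscale c a) p = cscale c (R a p)" "L (cscale c a) p = cscale c (L a p)"
  "R (tconj a) p = tconj (R a p)" "L (tconj a) p = tconj (L a p)"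
  by (simp_all add: right_field_def left_field_def push_add push_cscale push_tconj)

lemma field_zero: "R 0 p = 0" "L 0 p = 0"
  by (auto simp: right_field_def left_field_def push_def)

lemma field_sum: "R (\<Sum>i\<in>I. a i) p = (\<Sum>i\<in>I. R (a i) p)" "L (\<Sum>i\<in>I. a i) p = (\<Sum>i\<in>I. L (a i) p)"
  by (induction I rule: infinite_finite_induct) (auto simp: field_linear field_zero)

lemma lbr_lie_alg: "a \<in> \<gg> \<Longrightarrow> b \<in> \<gg> \<Longrightarrow> lbr A K a b \<in> \<gg>"
  unfolding lbr_def lie_alg_eq by (intro lie_br_tangent manifold right_field_vfields) (auto simp: lie_alg_eq)

text \<open>Composing \<open>f\<close> with right translation by \<open>p\<close> moves iterated
  derivatives at \<open>p\<close> to iterated derivatives at \<open>unit\<close>, where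
  \<open>lbr\<close> is defined.\<close>

lemma lie_br_right_right:
  assumes a: "a \<in> \<gg>" and b: "b \<in> \<gg>"
  shows "lie_br (R a) (R b) p = R (lbr A K a b) p"
proof
  fix f
  show "lie_br (R a) (R b) p f = R (lbr A K a b) p f"
  proof (cases "f \<in> smooth_funs A")
    case True
    have c: "R a p (\<lambda>q. R b q f) = R a unit (\<lambda>q. R b q (\<lambda>x. f (x \<cdot> p)))"
      if a: "a \<in> \<gg>" and b: "b \<in> \<gg>" for a b
      using vfieldsD(2)[OF right_field_vfields[OF b] True]
        vfieldsD(2)[OF right_field_vfields[OF b] smooth_translate(1)[OF True, of p]] True smooth_translate(1)[OF True]
      by (simp add: right_field_apply mul_assoc)
    show ?thesis unfolding right_field_apply[OF True]
      by (simp add: lie_br_def lbr_def c[OF a b] c[OF b a])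
  next
    case False
    then show ?thesis
      using lie_br_outside[OF right_field_vfields[OF a] right_field_vfields[OF b] False] by (simp add: right_field_def push_def)
  qed
qed

text \<open>\<open>R a\<close> differentiates the left and \<open>L b\<close> the right factor in
  \<open>f (x \<cdot> p \<cdot> y)\<close>, and derivations in separate variables commute.\<close>

lemma lie_br_right_left:
  assumes a: "a \<in> \<gg>" and b: "b \<in> \<gg>"
  shows "lie_br (R a) (L b) p = 0"
proof
  fix f
  show "lie_br (R a) (L b) p f = 0 f"
  proof (cases "f \<in> smooth_funs A")
    case f: True
    \<comment> \<open>Multiplication supplies functions of two variables of the form
      \<open>f (x \<cdot> z)\<close>. For the translate of \<open>f\<close> by \<open>p\<close>, the
      substitution \<open>z = p \<cdot> y \<cdot> ginv p\<close> produces
      \<open>f (x \<cdot> p \<cdot> y)\<close>. Accordingly \<open>b\<close> is replaced by its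
      image \<open>c\<close> under conjugation by \<open>p\<close>.\<close>
    define h where "h = (\<lambda>z. f (fst z \<cdot> snd z \<cdot> p))"
    have h: "h \<in> smooth_funs (prod_atlas A A)" unfolding h_def by (rule smooth_mul[OF smooth_translate(1)[OF f]])
    define c where "c = push A (\<lambda>y. p \<cdot> y \<cdot> ginv p) b"
    have c: "c \<in> tangent A (p \<cdot> unit \<cdot> ginv p)" unfolding c_def
      by (rule push_tangent[OF manifold]) (use smooth_translate b in \<open>auto simp: lie_alg_eq\<close>)
    have capp: "c g = b (\<lambda>y. g (p \<cdot> y \<cdot> ginv p))" if "g \<in> smooth_funs A" for g
      using that by (simp add: c_def push_def o_def)
    have s1: "(\<lambda>y. h (x, y)) \<in> smooth_funs A" for x by (rule smooth_funs_slice(2)[OF manifold h])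
    have s2: "(\<lambda>y. a (\<lambda>x. h (x, y))) \<in> smooth_funs A"
      by (rule smooth_funs_tangent_slice(1)[OF manifold compact_univ h]) (use a in \<open>simp add: lie_alg_eq\<close>)
    have hp: "h (x, p \<cdot> y \<cdot> ginv p) = f (x \<cdot> p \<cdot> y)" for x y
      by (simp add: h_def mul_assoc)
    have "R a p (\<lambda>q. L b q f) = a (\<lambda>x. b (\<lambda>y. f (x \<cdot> p \<cdot> y)))"
      using vfieldsD(2)[OF left_field_vfields[OF b] f] f by (simp add: right_field_apply left_field_apply)
    also have "\<dots> = a (\<lambda>x. c (\<lambda>y. h (x, y)))" using capp[OF s1] by (simp add: hp)
    also have "\<dots> = c (\<lambda>y. a (\<lambda>x. h (x, y)))"
      by (rule tangent_commute[OF manifold compact_univ h _ c]) (use a in \<open>simp add: lie_alg_eq\<close>)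
    also have "\<dots> = b (\<lambda>y. a (\<lambda>x. f (x \<cdot> p \<cdot> y)))" by (simp add: capp[OF s2] hp)
    also have "\<dots> = L b p (\<lambda>q. R a q f)"
      using vfieldsD(2)[OF right_field_vfields[OF a] f] f by (simp add: right_field_apply left_field_apply mul_assoc)
    finally show ?thesis by (simp add: lie_br_def)
  next
    case False
    then show ?thesis
      using lie_br_outside[OF right_field_vfields[OF a] left_field_vfields[OF b] False] by simp
  qed
qed

end

locale metric_lie_group = compact_lie_group A K
  for A :: "('k::{t2_space, second_countable_topology}, 'e::real_normed_vector) atlas" and K :: "'k monoid" +
  fixes \<kappa> :: "'k tvec \<Rightarrow> 'k tvec \<Rightarrow> complex"
  assumes kappa: "kappa_form A K \<kappa>"
begin

abbreviation \<sigma> where "\<sigma> \<equiv> sigma_metric A K \<kappa>"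
abbreviation \<gamma> where "\<gamma> \<equiv> cartan_form A K \<kappa>"
abbreviation fl :: "('k \<Rightarrow> 'k tvec) \<Rightarrow> 'k \<Rightarrow> 'k covec" where "fl X \<equiv> \<lambda>q. flat A \<sigma> q (X q)"

lemma sigma_riemannian: "riemannian A \<sigma>"
  using kappa by (simp add: kappa_form_def)

lemma sigma_one: "u \<in> \<gg> \<Longrightarrow> v \<in> \<gg> \<Longrightarrow> \<sigma> unit u v = \<kappa> u v"
  by (simp add: sigma_metric_def theta_r_def push_id lie_alg_eq)

section \<open>The invariant form on the Lie algebra and its Hermitian counterpart\<close>

lemma kappa_laws: "a \<in> \<gg> \<Longrightarrow> b \<in> \<gg> \<Longrightarrow> \<kappa> a b = \<kappa> b a \<and> (\<forall>c. \<kappa> (cscale c a) b = c * \<kappa> a b) \<and>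
    (\<forall>c\<in>\<gg>. \<kappa> (a + c) b = \<kappa> a b + \<kappa> c b \<and> \<kappa> (lbr A K a b) c = \<kappa> a (lbr A K b c))"
  by (rule bspec[OF bspec[OF conjunct1[OF kappa[unfolded kappa_form_def]]]])

lemma kappa_sym: "a \<in> \<gg> \<Longrightarrow> b \<in> \<gg> \<Longrightarrow> \<kappa> a b = \<kappa> b a"
  and kappa_scale: "a \<in> \<gg> \<Longrightarrow> b \<in> \<gg> \<Longrightarrow> \<kappa> (cscale c a) b = c * \<kappa> a b"
  and kappa_add: "a \<in> \<gg> \<Longrightarrow> b \<in> \<gg> \<Longrightarrow> d \<in> \<gg> \<Longrightarrow> \<kappa> (a + d) b = \<kappa> a b + \<kappa> d b"
  and kappa_invariant: "a \<in> \<gg> \<Longrightarrow> b \<in> \<gg> \<Longrightarrow> d \<in> \<gg> \<Longrightarrow> \<kappa> (lbr A K a b) d = \<kappa> a (lbr A K b d)"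
  using kappa_laws[of a b] by auto

lemma kappa_scale_right: "a \<in> \<gg> \<Longrightarrow> b \<in> \<gg> \<Longrightarrow> \<kappa> a (cscale c b) = c * \<kappa> a b"
  using kappa_sym kappa_scale lie_alg_closed(3) by metis

lemma kappa_zero: "a \<in> \<gg> \<Longrightarrow> \<kappa> 0 a = 0" "a \<in> \<gg> \<Longrightarrow> \<kappa> a 0 = 0"
  using kappa_scale[of a a 0] kappa_scale_right[of a a 0] by (simp_all add: cscale_def zero_fun_def)

lemma kappa_sum:
  assumes "b \<in> \<gg>" "\<And>i. i \<in> I \<Longrightarrow> a i \<in> \<gg>"
  shows "\<kappa> (\<Sum>i\<in>I. a i) b = (\<Sum>i\<in>I. \<kappa> (a i) b)"
  using assms(2)
  by (induction I rule: infinite_finite_induct) (auto simp: kappa_zero kappa_add lie_alg_closed assms(1))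

lemma kappa_tconj: "a \<in> \<gg> \<Longrightarrow> b \<in> \<gg> \<Longrightarrow> \<kappa> (tconj a) (tconj b) = cnj (\<kappa> a b)"
  using riemannian_tconj[OF manifold sigma_riemannian, of a unit b] by (simp add: sigma_one lie_alg_eq[symmetric] lie_alg_tconj)

lemma kappa_tconj_pos: "a \<in> \<gg> \<Longrightarrow> a \<noteq> 0 \<Longrightarrow> \<exists>t>0. \<kappa> a (tconj a) = complex_of_real t"
  using riemannian_tconj_pos[OF manifold sigma_riemannian, of a unit]
  by (intro exI[of _ "Re (\<kappa> a (tconj a))"]) (simp add: sigma_one lie_alg_eq[symmetric] lie_alg_tconj complex_eq_iff)

lemma sigma_right_right: "a \<in> \<gg> \<Longrightarrow> b \<in> \<gg> \<Longrightarrow> \<sigma> p (R a p) (R b p) = \<kappa> a b"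
  by (simp add: sigma_metric_def theta_r_right_field)

text \<open>The metric is defined by the right trivialization. Left translation by
  \<open>ginv p\<close>, an isometry by bi-invariance, carries the computation to
  \<open>unit\<close>, where both trivializations agree.\<close>

lemma sigma_left: "v \<in> tangent A p \<Longrightarrow> a \<in> \<gg> \<Longrightarrow> \<sigma> p v (L a p) = \<kappa> (theta_l A K p v) a"
proof -
  assume v: "v \<in> tangent A p" and a: "a \<in> \<gg>"
  have "bi_invariant A K \<sigma>" using kappa by (simp add: kappa_form_def)
  then have "\<sigma> (ginv p \<cdot> p) (push A (\<lambda>x. ginv p \<cdot> x) v) (push A (\<lambda>x. ginv p \<cdot> x) (L a p)) = \<sigma> p v (L a p)"
    using v left_field_tangent[OF a] unfolding bi_invariant_def by blast
  then show ?thesis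
    using sigma_one[OF theta_l_lie_alg[OF v] a] theta_l_left_field[OF a, of p] by (simp add: theta_l_def)
qed

lemma sigma_left_left: "a \<in> \<gg> \<Longrightarrow> b \<in> \<gg> \<Longrightarrow> \<sigma> p (L a p) (L b p) = \<kappa> a b"
  by (simp add: sigma_left left_field_tangent theta_l_left_field)

lemma fl_apply: "v \<in> tangent A p \<Longrightarrow> fl X p v = \<sigma> p (X p) v"
  by (simp add: flat_def)

lemma fl_sym: "X \<in> vfields A \<Longrightarrow> Y \<in> vfields A \<Longrightarrow> fl X p (Y p) = fl Y p (X p)"
  using riemannianD(1)[OF sigma_riemannian] vfieldsD(1) by (metis fl_apply)

lemma fl_oneform: "X \<in> vfields A \<Longrightarrow> fl X \<in> oneforms A"
  by (rule flat_oneform[OF sigma_riemannian])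

text \<open>Orthonormal for the form that sends \<open>a\<close>, \<open>b\<close> to
  \<open>\<kappa> a (tconj b)\<close>. This is used rather than \<open>\<kappa>\<close> itself
  because the subspaces of interest are \<open>\<kappa>\<close>-isotropic. The last conjunct is the
  Fourier expansion and expresses that the basis spans.\<close>

definition hermitian_basis :: "'k tvec set \<Rightarrow> nat \<Rightarrow> (nat \<Rightarrow> 'k tvec) \<Rightarrow> bool" where
  "hermitian_basis V r e \<longleftrightarrow> (\<forall>i<r. e i \<in> V) \<and> (\<forall>i<r. \<forall>j<r. \<kappa> (e i) (tconj (e j)) = (if i = j then 1 else 0)) \<and>
     (\<forall>v\<in>V. v = (\<Sum>i<r. cscale (\<kappa> v (tconj (e i))) (e i)))"

text \<open>Gram-Schmidt, adding the vectors of \<open>B\<close> one at a time. A vector whose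
  residue \<open>w\<close> vanishes leaves the basis unchanged; otherwise \<open>w\<close> is
  normalized, which is possible because \<open>\<kappa> w (tconj w)\<close> is positive.\<close>

lemma hermitian_basis_span:
  assumes V: "V \<subseteq> \<gg>" "fvec.subspace V" and B: "finite B" "B \<subseteq> V"
  shows "\<exists>(r::nat) e. (\<forall>i<r. e i \<in> V) \<and> (\<forall>i<r. \<forall>j<r. \<kappa> (e i) (tconj (e j)) = (if i = j then 1 else 0)) \<and>
     (\<forall>v\<in>fvec.span B. v = (\<Sum>i<r. cscale (\<kappa> v (tconj (e i))) (e i)))"
  using B
proof (induction B rule: finite_induct)
  case empty
  show ?case by (intro exI[of _ 0]) auto
next
  case (insert v B)
  have BV: "B \<subseteq> V" and v: "v \<in> V" using insert.prems by auto
  from insert.IH[OF BV] obtain r :: nat and e where e: "\<And>i. i < r \<Longrightarrow> e i \<in> V"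
    "\<And>i j. i < r \<Longrightarrow> j < r \<Longrightarrow> \<kappa> (e i) (tconj (e j)) = (if i = j then 1 else 0)"
    "\<And>v. v \<in> fvec.span B \<Longrightarrow> v = (\<Sum>i<r. cscale (\<kappa> v (tconj (e i))) (e i))"
    by blast
  have eg: "e i \<in> \<gg>" "tconj (e i) \<in> \<gg>" if "i < r" for i using e(1)[OF that] V(1) lie_alg_tconj by auto
  have vg: "v \<in> \<gg>" using v V by auto
  define w where "w = v - (\<Sum>i<r. cscale (\<kappa> v (tconj (e i))) (e i))"
  have wV: "w \<in> V" unfolding w_def
    by (intro fvec.subspace_diff fvec.subspace_sum fvec.subspace_scale V(2) v e) auto
  then have wg: "w \<in> \<gg>" "tconj w \<in> \<gg>" using V lie_alg_tconj by auto
  have vw: "v = w + (\<Sum>i<r. cscale (\<kappa> v (tconj (e i))) (e i))" by (simp add: w_def)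
  have sg: "(\<Sum>i<r. cscale (c i) (e i)) \<in> \<gg>" for c by (rule lie_alg_closed(6)) (auto intro: lie_alg_closed(3) eg)
  have we: "\<kappa> w (tconj (e j)) = 0" if j: "j < r" for j
  proof -
    have "\<kappa> v (tconj (e j)) = \<kappa> w (tconj (e j)) + \<kappa> (\<Sum>i<r. cscale (\<kappa> v (tconj (e i))) (e i)) (tconj (e j))"
      using arg_cong[OF vw, of "\<lambda>x. \<kappa> x (tconj (e j))"] kappa_add[OF wg(1) eg(2)[OF j] sg] by metis
    also have "\<kappa> (\<Sum>i<r. cscale (\<kappa> v (tconj (e i))) (e i)) (tconj (e j)) = (\<Sum>i<r. \<kappa> v (tconj (e i)) * \<kappa> (e i) (tconj (e j)))"
      by (subst kappa_sum) (auto intro!: sum.cong simp: eg j kappa_scale lie_alg_closed(3))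
    also have "\<dots> = (\<Sum>i<r. if i = j then \<kappa> v (tconj (e i)) else 0)" by (intro sum.cong) (auto simp: e(2) j)
    also have "\<dots> = \<kappa> v (tconj (e j))" using j by simp
    finally show ?thesis by simp
  qed
  have ew: "\<kappa> (e j) (tconj w) = 0" if j: "j < r" for j
  proof -
    have "\<kappa> (e j) (tconj w) = cnj (\<kappa> (tconj (e j)) w)" using kappa_tconj[OF eg(2)[OF j] wg(1)] by simp
    also have "\<kappa> (tconj (e j)) w = 0" using we[OF j] kappa_sym[OF eg(2)[OF j] wg(1)] by simp
    finally show ?thesis by simp
  qed
  show ?case
  proof (cases "w = 0")
    case True
    have "u = (\<Sum>i<r. cscale (\<kappa> u (tconj (e i))) (e i))" if u: "u \<in> fvec.span (insert v B)" for u
    proof -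
      obtain c where c: "u - cscale c v \<in> fvec.span B" using u unfolding fvec.span_breakdown_eq by blast
      have ug: "u \<in> \<gg>" using u fvec.span_minimal[OF insert.prems V(2)] V(1) by blast
      define u' where "u' = u - cscale c v"
      have u'g: "u' \<in> \<gg>" unfolding u'_def by (intro lie_alg_closed ug vg)
      have uu: "u = u' + cscale c v" by (simp add: u'_def)
      have "\<kappa> u (tconj (e i)) = \<kappa> u' (tconj (e i)) + c * \<kappa> v (tconj (e i))" if "i < r" for i
        unfolding uu using kappa_add[OF u'g eg(2)[OF that] lie_alg_closed(3)[OF vg]] kappa_scale[OF vg eg(2)[OF that]] by simp
      then have "(\<Sum>i<r. cscale (\<kappa> u (tconj (e i))) (e i)) = (\<Sum>i<r. cscale (\<kappa> u' (tconj (e i))) (e i) + cscale c (cscale (\<kappa> v (tconj (e i))) (e i)))"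
        by (intro sum.cong) (auto simp: fvec.scale_left_distrib)
      also have "\<dots> = u' + cscale c v"
      proof -
        have "(\<Sum>i<r. cscale c (cscale (\<kappa> v (tconj (e i))) (e i))) = cscale c v"
          unfolding fvec.scale_sum_right[symmetric] using vw True by simp
        then show ?thesis unfolding sum.distrib using e(3)[OF c] by (simp add: u'_def)
      qed
      finally show ?thesis using uu by simp
    qed
    then show ?thesis using e by blast
  next
    case False
    obtain t where t: "t > 0" "\<kappa> w (tconj w) = complex_of_real t" using kappa_tconj_pos[OF wg(1) False] by blast
    define s where "s = complex_of_real (1 / sqrt t)"
    have s: "cnj s = s" "s * s * complex_of_real t = 1"
      using t(1) by (auto simp: s_def of_real_mult[symmetric] simp del: of_real_mult)
    define e' where "e' = e(r := cscale s w)"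
    have e'g: "e' i \<in> \<gg>" "tconj (e' i) \<in> \<gg>" if "i < Suc r" for i
      using that eg wg by (auto simp: e'_def less_Suc_eq tconj_cscale lie_alg_closed(3))
    have 1: "\<forall>i<Suc r. e' i \<in> V" using e(1) wV fvec.subspace_scale[OF V(2)] by (auto simp: e'_def less_Suc_eq)
    have 2: "\<forall>i<Suc r. \<forall>j<Suc r. \<kappa> (e' i) (tconj (e' j)) = (if i = j then 1 else 0)"
      using e(2) we ew eg wg t(2) s
      by (auto simp: e'_def less_Suc_eq tconj_cscale kappa_scale kappa_scale_right lie_alg_closed(3) mult.assoc)
    have 3: "u = (\<Sum>i<Suc r. cscale (\<kappa> u (tconj (e' i))) (e' i))" if u: "u \<in> fvec.span (insert v B)" for u
    proof -
      obtain c where c: "u - cscale c v \<in> fvec.span B" using u unfolding fvec.span_breakdown_eq by blast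
      define d where "d = (\<lambda>i. \<kappa> (u - cscale c v) (tconj (e i)) + c * \<kappa> v (tconj (e i)))"
      have "u = (u - cscale c v) + cscale c (w + (\<Sum>i<r. cscale (\<kappa> v (tconj (e i))) (e i)))" using vw by simp
      also have "\<dots> = (\<Sum>i<r. cscale (d i) (e i)) + cscale c w"
        by (subst e(3)[OF c]) (simp add: d_def fvec.scale_right_distrib fvec.scale_sum_right fvec.scale_left_distrib sum.distrib)
      \<comment> \<open>The new basis vector is \<open>cscale s w\<close>, so the coefficient
        \<open>c\<close> of \<open>w\<close> becomes \<open>c / s\<close>.\<close>
      also have "\<dots> = (\<Sum>i<Suc r. cscale ((d(r := c / s)) i) (e' i))"
        using s(2) by (auto simp: e'_def intro!: sum.cong)
      finally obtain d' where d': "u = (\<Sum>i<Suc r. cscale (d' i) (e' i))" by blast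
      have "\<kappa> u (tconj (e' j)) = d' j" if j: "j < Suc r" for j
      proof -
        have "\<kappa> u (tconj (e' j)) = (\<Sum>i<Suc r. d' i * \<kappa> (e' i) (tconj (e' j)))"
          unfolding d' by (subst kappa_sum) (auto intro!: sum.cong simp del: sum.lessThan_Suc simp: e'g j kappa_scale lie_alg_closed(3))
        also have "\<dots> = (\<Sum>i<Suc r. if i = j then d' i else 0)" using 2 j by (intro sum.cong) auto
        also have "\<dots> = d' j" using j by (simp del: sum.lessThan_Suc)
        finally show ?thesis .
      qed
      then show ?thesis using d' by (metis (no_types, lifting) lessThan_iff sum.cong)
    qed
    show ?thesis using 1 2 3 by blast
  qed
qed

lemma hermitian_basis_exists:
  assumes V: "V \<subseteq> \<gg>" "fvec.subspace V"
  shows "\<exists>r e. hermitian_basis V r e"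
proof -
  obtain S where S: "finite S" "\<gg> \<subseteq> fvec.span S"
    using tangent_finite_span[OF manifold compact_univ, of unit] by (auto simp: lie_alg_eq)
  obtain B where B: "B \<subseteq> V" "fvec.independent B" "V \<subseteq> fvec.span B" using fvec.maximal_independent_subset[of V] by blast
  have "finite B" using fvec.independent_span_bound[OF S(1) B(2)] B(1) V(1) S(2) by blast
  from hermitian_basis_span[OF V this B(1)] B(3) show ?thesis unfolding hermitian_basis_def by blast
qed

section \<open>Global frames and tensorial expressions\<close>

lemma lie_alg_subspace: "fvec.subspace \<gg>"
  unfolding lie_alg_eq by (rule tangent_subspace)

text \<open>The right invariant fields of a Hermitian basis trivialize the tangent bundle.
  Coefficients are read off by pairing with the right invariant fields of the conjugate basis, since
  \<open>\<sigma>\<close> is \<open>\<kappa>\<close> in the right trivialization; being pairings of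
  smooth fields, they are smooth.\<close>

lemma frame_exists:
  "\<exists>n e d. (\<forall>i<n. e i \<in> \<gg> \<and> d i \<in> \<gg>) \<and>
     (\<forall>X\<in>vfields A. (\<forall>i<n. (\<lambda>q. \<sigma> q (X q) (R (d i) q)) \<in> smooth_funs A) \<and>
        X = vcomb n (\<lambda>i q. \<sigma> q (X q) (R (d i) q)) (\<lambda>i. R (e i)))"
proof -
  obtain n e where e: "hermitian_basis \<gg> n e" using hermitian_basis_exists[OF _ lie_alg_subspace] by blast
  define d where "d = (\<lambda>i. tconj (e i))"
  have ed: "\<forall>i<n. e i \<in> \<gg> \<and> d i \<in> \<gg>" using e lie_alg_tconj by (auto simp: hermitian_basis_def d_def)
  have ex: "v = (\<Sum>i<n. cscale (\<kappa> v (d i)) (e i))" if "v \<in> \<gg>" for v using e that by (simp add: hermitian_basis_def d_def)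
  have vc: "X q = vcomb n (\<lambda>i q. \<sigma> q (X q) (R (d i) q)) (\<lambda>i. R (e i)) q" if X: "X \<in> vfields A" for X q
  proof -
    let ?v = "theta_r A K q (X q)"
    have v: "?v \<in> \<gg>" by (rule theta_r_lie_alg[OF vfieldsD(1)[OF X]])
    have "X q = R ?v q" using right_field_theta_r[OF vfieldsD(1)[OF X]] by simp
    also have "\<dots> = R (\<Sum>i<n. cscale (\<kappa> ?v (d i)) (e i)) q" using ex[OF v] by simp
    also have "\<dots> = (\<Sum>i<n. cscale (\<kappa> ?v (d i)) (R (e i) q))" by (simp only: field_sum field_linear)
    finally show ?thesis using ed by (simp add: vcomb_def sigma_metric_def theta_r_right_field)
  qed
  have sm: "(\<lambda>q. \<sigma> q (X q) (R (d i) q)) \<in> smooth_funs A" if "X \<in> vfields A" "i < n" for X i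
    using riemannian_smooth[OF sigma_riemannian that(1) right_field_vfields[of "d i"]] ed that(2) by blast
  show ?thesis
  proof (rule exI[of _ n], rule exI[of _ e], rule exI[of _ d], intro conjI ballI)
    show "\<forall>i<n. e i \<in> \<gg> \<and> d i \<in> \<gg>" by (rule ed)
    fix X assume X: "X \<in> vfields A"
    show "\<forall>i<n. (\<lambda>q. \<sigma> q (X q) (R (d i) q)) \<in> smooth_funs A" using sm[OF X] by blast
    show "X = vcomb n (\<lambda>i q. \<sigma> q (X q) (R (d i) q)) (\<lambda>i. R (e i))" by (rule ext) (rule vc[OF X])
  qed
qed

text \<open>Expansion in a global frame shows that an expression linear over functions depends on the value at
  one point only; this makes the choice in \<^const>\<open>extension\<close> irrelevant.\<close>

lemma tensorial:
  assumes Q: "\<And>n g E. (\<And>i. i < n \<Longrightarrow> E i \<in> vfields A) \<Longrightarrow> (\<And>i. i < n \<Longrightarrow> g i \<in> smooth_funs A) \<Longrightarrow>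
      Q (vcomb n g E) = (\<Sum>i<n. g i p * Q (E i))"
    and Z: "Z \<in> vfields A" "Z' \<in> vfields A" "Z p = Z' p"
  shows "Q Z = (Q Z' :: complex)"
proof -
  obtain n e d where f: "\<And>i. i < n \<Longrightarrow> e i \<in> \<gg>"
    "\<And>X i. X \<in> vfields A \<Longrightarrow> i < n \<Longrightarrow> (\<lambda>q. \<sigma> q (X q) (R (d i) q)) \<in> smooth_funs A"
    "\<And>X. X \<in> vfields A \<Longrightarrow> X = vcomb n (\<lambda>i q. \<sigma> q (X q) (R (d i) q)) (\<lambda>i. R (e i))"
    using frame_exists by blast
  have "Q X = (\<Sum>i<n. \<sigma> p (X p) (R (d i) p) * Q (R (e i)))" if X: "X \<in> vfields A" for X
    by (subst f(3)[OF X], subst Q) (use f X right_field_vfields in auto)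
  then show ?thesis using Z by simp
qed

lemma extension_vfields: "Z \<in> vfields A \<Longrightarrow> extension A p (Z p) \<in> vfields A \<and> extension A p (Z p) p = Z p"
  unfolding extension_def by (rule someI[of _ Z]) simp

text \<open>As an expression in \<open>Z\<close>, the derivatives of the coefficients cancel between
  the two summands, so the chosen extension may be replaced by \<open>Z\<close> itself.\<close>

lemma lie_derivative_eq:
  assumes X: "X \<in> vfields A" and \<eta>: "\<eta> \<in> oneforms A" and Z: "Z \<in> vfields A"
  shows "lie_derivative A X \<eta> p (Z p) = X p (\<lambda>q. \<eta> q (Z q)) - \<eta> p (lie_br X Z p)"
proof -
  have "X p (\<lambda>q. \<eta> q (extension A p (Z p) q)) - \<eta> p (lie_br X (extension A p (Z p)) p) = X p (\<lambda>q. \<eta> q (Z q)) - \<eta> p (lie_br X Z p)"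
    by (rule tensorial[where Q = "\<lambda>Z. X p (\<lambda>q. \<eta> q (Z q)) - \<eta> p (lie_br X Z p)" and p = p])
      (use extension_vfields[OF Z, of p] Z in \<open>simp_all add: oneform_vcomb(1,2)[OF manifold X _ _ \<eta>] sum_subtractf[symmetric] algebra_simps\<close>)
  then show ?thesis using vfieldsD(1)[OF Z] by (simp add: lie_derivative_def Let_def)
qed

lemma ext_deriv_eq:
  assumes \<xi>: "\<xi> \<in> oneforms A" and Y: "Y \<in> vfields A" and Z: "Z \<in> vfields A"
  shows "ext_deriv A \<xi> p (Y p) (Z p) = Y p (\<lambda>q. \<xi> q (Z q)) - Z p (\<lambda>q. \<xi> q (Y q)) - \<xi> p (lie_br Y Z p)"
proof -
  define Q where "Q = (\<lambda>Y Z. Y p (\<lambda>q. \<xi> q (Z q)) - Z p (\<lambda>q. \<xi> q (Y q)) - \<xi> p (lie_br Y Z p))"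
  have 1: "Q Y Z = Q Y Z'" if "Y \<in> vfields A" "Z \<in> vfields A" "Z' \<in> vfields A" "Z p = Z' p" for Y Z Z'
    unfolding Q_def
    by (rule tensorial[where Q = "\<lambda>Z. Y p (\<lambda>q. \<xi> q (Z q)) - Z p (\<lambda>q. \<xi> q (Y q)) - \<xi> p (lie_br Y Z p)" and p = p])
      (use that in \<open>simp_all add: oneform_vcomb(1,2)[OF manifold that(1) _ _ \<xi>] vcomb_apply sum_subtractf[symmetric] sum.distrib[symmetric] algebra_simps\<close>)
  have 2: "Q Y Z = Q Y' Z" if "Y \<in> vfields A" "Y' \<in> vfields A" "Z \<in> vfields A" "Y p = Y' p" for Y Y' Z
    unfolding Q_def
    by (rule tensorial[where Q = "\<lambda>Y. Y p (\<lambda>q. \<xi> q (Z q)) - Z p (\<lambda>q. \<xi> q (Y q)) - \<xi> p (lie_br Y Z p)" and p = p])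
      (use that in \<open>simp_all add: oneform_vcomb(1,3)[OF manifold that(3) _ _ \<xi>] vcomb_apply sum_subtractf[symmetric] sum.distrib[symmetric] algebra_simps\<close>)
  let ?Y = "extension A p (Y p)" and ?Z = "extension A p (Z p)"
  have e: "?Y \<in> vfields A" "?Y p = Y p" "?Z \<in> vfields A" "?Z p = Z p" using extension_vfields Y Z by blast+
  \<comment> \<open>The two extensions are replaced one after the other, each time by tensoriality
    in a single slot.\<close>
  have "Q ?Y ?Z = Q Y Z" using 1[OF Y e(3) Z e(4)] 2[OF e(1) Y e(3) e(2)] by simp
  then show ?thesis using vfieldsD(1)[OF Y] vfieldsD(1)[OF Z] by (simp add: ext_deriv_def Let_def Q_def)
qed

lemma dorfman_apply:
  assumes s: "s \<in> gsections A" and t: "t \<in> gsections A" and Z: "Z \<in> vfields A"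
  defines "X \<equiv> \<lambda>q. fst (s q)" and "\<xi> \<equiv> \<lambda>q. snd (s q)" and "Y \<equiv> \<lambda>q. fst (t q)" and "\<eta> \<equiv> \<lambda>q. snd (t q)"
  shows "fst (dorfman A \<gamma> s t p) = lie_br X Y p"
    and "snd (dorfman A \<gamma> s t p) (Z p) = X p (\<lambda>q. \<eta> q (Z q)) - \<eta> p (lie_br X Z p)
      - (Y p (\<lambda>q. \<xi> q (Z q)) - Z p (\<lambda>q. \<xi> q (Y q)) - \<xi> p (lie_br Y Z p)) + \<gamma> p (Y p) (X p) (Z p)"
proof -
  have X: "X \<in> vfields A" and xi: "\<xi> \<in> oneforms A" and Y: "Y \<in> vfields A" and eta: "\<eta> \<in> oneforms A"
    using s t by (auto simp: gsections_def X_def \<xi>_def Y_def \<eta>_def)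
  show "fst (dorfman A \<gamma> s t p) = lie_br X Y p" by (simp add: dorfman_def X_def Y_def Let_def)
  have "snd (dorfman A \<gamma> s t p) (Z p) = lie_derivative A X \<eta> p (Z p) - ext_deriv A \<xi> p (Y p) (Z p) + \<gamma> p (Y p) (X p) (Z p)"
    using vfieldsD(1)[OF Z] by (simp add: dorfman_def Let_def X_def Y_def \<xi>_def \<eta>_def)
  then show "snd (dorfman A \<gamma> s t p) (Z p) = X p (\<lambda>q. \<eta> q (Z q)) - \<eta> p (lie_br X Z p)
      - (Y p (\<lambda>q. \<xi> q (Z q)) - Z p (\<lambda>q. \<xi> q (Y q)) - \<xi> p (lie_br Y Z p)) + \<gamma> p (Y p) (X p) (Z p)"
    unfolding lie_derivative_eq[OF X eta Z] ext_deriv_eq[OF xi Y Z] .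
qed

end

section \<open>The Dorfman bracket of invariant sections\<close>

lemma fst_gscale_sum: "fst (\<Sum>k\<in>I. gscale (c k) (u k)) = (\<Sum>k\<in>I. cscale (c k) (fst (u k)))"
  and snd_gscale_sum: "snd (\<Sum>k\<in>I. gscale (c k) (u k)) v = (\<Sum>k\<in>I. c k * snd (u k) v)"
  by (simp_all add: fst_sum snd_sum gscale_def sum_fun_apply cscale_def)

lemma gpair_add_left:
  assumes "fst u \<in> tangent A p" "fst u' \<in> tangent A p" "w \<in> gtangent A p"
  shows "gpair (u + u') w = gpair u w + gpair u' w"
  using assms by (auto simp: gpair_def gtangent_def cotangent_add add_divide_distrib)

lemma gpair_gscale_left:
  assumes "fst u \<in> tangent A p" "w \<in> gtangent A p"
  shows "gpair (gscale c u) w = c * gpair u w"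
  using assms by (auto simp: gpair_def gscale_def gtangent_def cotangent_cscale) (simp add: cscale_def algebra_simps)

lemma gpair_sum_left:
  assumes "\<And>k. k \<in> I \<Longrightarrow> fst (u k) \<in> tangent A p" "w \<in> gtangent A p"
  shows "gpair (\<Sum>k\<in>I. gscale (c k) (u k)) w = (\<Sum>k\<in>I. c k * gpair (u k) w)"
proof -
  have w: "snd w \<in> cotangent A p" using assms(2) by (auto simp: gtangent_def)
  have "snd w (\<Sum>k\<in>I. cscale (c k) (fst (u k))) = (\<Sum>k\<in>I. c k * snd w (fst (u k)))"
    by (subst cotangent_sum[OF w]) (simp_all add: assms(1) tangent_closed(3) cotangent_cscale[OF w])
  then show ?thesis
    by (simp add: gpair_def fst_gscale_sum snd_gscale_sum sum.distrib[symmetric] sum_divide_distrib algebra_simps)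
qed

lemma gsectionsD:
  assumes "s \<in> gsections A"
  shows "(\<lambda>q. fst (s q)) \<in> vfields A" "(\<lambda>q. snd (s q)) \<in> oneforms A" "fst (s p) \<in> tangent A p"
    "snd (s p) \<in> cotangent A p" "s p \<in> gtangent A p"
proof -
  show 1: "(\<lambda>q. fst (s q)) \<in> vfields A" "(\<lambda>q. snd (s q)) \<in> oneforms A" using assms by (simp_all add: gsections_def)
  show "fst (s p) \<in> tangent A p" "snd (s p) \<in> cotangent A p" using vfieldsD(1)[OF 1(1)] oneformsD(1)[OF 1(2)] by simp_all
  then show "s p \<in> gtangent A p" by (simp add: gtangent_def mem_Times_iff)
qed

lemma gpair_smooth:
  assumes A: "smooth_manifold A" and s: "s \<in> gsections A" and t: "t \<in> gsections A"
  shows "(\<lambda>q. gpair (s q) (t q)) \<in> smooth_funs A"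
proof -
  have "(\<lambda>q. snd (t q) (fst (s q))) \<in> smooth_funs A" "(\<lambda>q. snd (s q) (fst (t q))) \<in> smooth_funs A"
    by (rule oneformsD(2)[OF gsectionsD(2)[OF t] gsectionsD(1)[OF s]] oneformsD(2)[OF gsectionsD(2)[OF s] gsectionsD(1)[OF t]])+
  from smooth_funs_mult[OF A smooth_funs_const[of "1/2"] smooth_funs_add[OF A this]]
  show ?thesis by (simp add: gpair_def)
qed

lemma gsections_sum:
  fixes n :: nat
  assumes A: "smooth_manifold A" and u: "\<And>k. k < n \<Longrightarrow> u k \<in> gsections A" and h: "\<And>k. k < n \<Longrightarrow> h k \<in> smooth_funs A"
  shows "(\<lambda>q. \<Sum>k<n. gscale (h k q) (u k q)) \<in> gsections A"
  unfolding gsections_def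
proof (intro CollectI conjI)
  show "(\<lambda>p. fst (\<Sum>k<n. gscale (h k p) (u k p))) \<in> vfields A"
    using vcomb_vfields[OF A, of n "\<lambda>k q. fst (u k q)" h] u h
    unfolding fst_gscale_sum vcomb_def[abs_def] by (simp add: gsections_def)
  show "(\<lambda>p. snd (\<Sum>k<n. gscale (h k p) (u k p))) \<in> oneforms A"
    unfolding oneforms_def
  proof (intro CollectI conjI allI ballI)
    fix p
    have c: "snd (u k p) \<in> cotangent A p" if "k < n" for k using gsectionsD(4)[OF u[OF that]] .
    show "snd (\<Sum>k<n. gscale (h k p) (u k p)) \<in> cotangent A p"
      unfolding cotangent_def
      by (simp add: snd_gscale_sum cotangent_add[OF c] cotangent_cscale[OF c] sum.distrib[symmetric] sum_distrib_left algebra_simps)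
        (use c in \<open>auto simp: cotangent_def\<close>)
  next
    fix X assume X: "X \<in> vfields A"
    show "(\<lambda>p. snd (\<Sum>k<n. gscale (h k p) (u k p)) (X p)) \<in> smooth_funs A"
      unfolding snd_gscale_sum
      by (rule smooth_funs_sum[OF A], rule smooth_funs_mult[OF A])
        (simp_all add: h oneformsD(2)[OF gsectionsD(2)[OF u] X])
  qed
qed

context metric_lie_group
begin

text \<open>If \<open>s\<close> and \<open>t\<close> have commuting anchors, this is twice the failure of
  \<open>\<langle>s * u, t\<rangle> = a(s) \<langle>u, t\<rangle>\<close> for a section \<open>u\<close> with anchor \<open>Y\<close>; it does not
  depend on the 1-form part of \<open>u\<close> and is linear over functions in \<open>Y\<close>.\<close>

definition defect :: "('k \<Rightarrow> 'k gvec) \<Rightarrow> ('k \<Rightarrow> 'k gvec) \<Rightarrow> 'k \<Rightarrow> ('k \<Rightarrow> 'k tvec) \<Rightarrow> complex" where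
  "defect s t p Y = - Y p (\<lambda>q. snd (s q) (fst (t q))) + fst (t p) (\<lambda>q. snd (s q) (Y q))
     + snd (s p) (lie_br Y (\<lambda>q. fst (t q)) p) + \<gamma> p (Y p) (fst (s p)) (fst (t p))
     + snd (t p) (lie_br (\<lambda>q. fst (s q)) Y p) - fst (s p) (\<lambda>q. snd (t q) (Y q))"

lemma lbr_swap: "lbr A K b a = - lbr A K a b"
  unfolding lbr_def by (rule lie_br_swap)

lemma kappa_minus: "a \<in> \<gg> \<Longrightarrow> b \<in> \<gg> \<Longrightarrow> \<kappa> (- a) b = - \<kappa> a b" "a \<in> \<gg> \<Longrightarrow> b \<in> \<gg> \<Longrightarrow> \<kappa> a (- b) = - \<kappa> a b"
  using kappa_scale[of a b "-1"] kappa_scale_right[of a b "-1"] by (simp_all add: fvec.scale_minus_left)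

lemma gamma_vcomb:
  assumes E: "\<And>i. i < n \<Longrightarrow> E i \<in> vfields A" and v: "v \<in> tangent A p" and w: "w \<in> tangent A p"
  shows "\<gamma> p (vcomb n g E p) v w = (\<Sum>i<n. g i p * \<gamma> p (E i p) v w)"
    and "\<gamma> p v (vcomb n g E p) w = (\<Sum>i<n. g i p * \<gamma> p v (E i p) w)"
proof -
  have t: "theta_r A K p (E i p) \<in> \<gg>" if "i < n" for i by (rule theta_r_lie_alg[OF vfieldsD(1)[OF E[OF that]]])
  have l: "lbr A K (theta_r A K p v) (theta_r A K p w) \<in> \<gg>" by (intro lbr_lie_alg theta_r_lie_alg v w)
  have th: "theta_r A K p (vcomb n g E p) = (\<Sum>i<n. cscale (g i p) (theta_r A K p (E i p)))"
  proof -
    have "theta_r A K p 0 = 0" by (auto simp: theta_r_def push_def)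
    then have "theta_r A K p (\<Sum>i\<in>I. x i) = (\<Sum>i\<in>I. theta_r A K p (x i))" for I and x :: "nat \<Rightarrow> 'k tvec"
      by (induction I rule: infinite_finite_induct) (auto simp: theta_r_linear)
    then show ?thesis by (simp add: vcomb_def theta_r_linear)
  qed
  have 1: "\<gamma> p (vcomb n g E p) v w = (\<Sum>i<n. g i p * \<gamma> p (E i p) v w)" if v: "v \<in> tangent A p" for v
    unfolding cartan_form_def th
    by (subst kappa_sum) (simp_all add: t lbr_lie_alg theta_r_lie_alg v w kappa_scale lie_alg_closed(3))
  show "\<gamma> p (vcomb n g E p) v w = (\<Sum>i<n. g i p * \<gamma> p (E i p) v w)" by (rule 1[OF v])
  \<comment> \<open>Invariance of \<open>\<kappa>\<close> moves the bracket onto the first two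
    arguments, where it is visibly antisymmetric.\<close>
  have sw: "\<gamma> p a b w = - \<gamma> p b a w" if "a \<in> tangent A p" "b \<in> tangent A p" for a b
  proof -
    note m = theta_r_lie_alg[OF that(1)] theta_r_lie_alg[OF that(2)] theta_r_lie_alg[OF w]
    show ?thesis unfolding cartan_form_def
      by (simp add: kappa_invariant[symmetric] m lbr_swap[of "theta_r A K p b" "theta_r A K p a"] kappa_minus lbr_lie_alg)
  qed
  show "\<gamma> p v (vcomb n g E p) w = (\<Sum>i<n. g i p * \<gamma> p v (E i p) w)"
  proof -
    have "\<gamma> p v (vcomb n g E p) w = - \<gamma> p (vcomb n g E p) v w" by (rule sw[OF v vcomb_tangent]) (rule E)
    then show ?thesis by (simp add: 1[OF v] sw[OF v vfieldsD(1)[OF E]] sum_negf)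
  qed
qed

text \<open>Derivatives of the coefficients of \<open>Y\<close> cancel between the second and third
  summand and between the last two. Hence \<open>Y\<close> may be replaced by a right invariant
  field with the same value at \<open>p\<close>.\<close>

lemma defect_tensorial:
  assumes s: "s \<in> gsections A" and t: "t \<in> gsections A" and Y: "Y \<in> vfields A" "Y' \<in> vfields A" "Y p = Y' p"
  shows "defect s t p Y = defect s t p Y'"
proof (rule tensorial[where p = p, OF _ Y])
  fix n :: nat and g E assume E: "\<And>i. i < n \<Longrightarrow> E i \<in> vfields A" and g: "\<And>i. i < n \<Longrightarrow> g i \<in> smooth_funs A"
  note S = gsectionsD[OF s] and T = gsectionsD[OF t]
  note rules = oneform_vcomb(1)[OF manifold T(1) _ _ S(2)] oneform_vcomb(3)[OF manifold T(1) _ _ S(2)]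
    oneform_vcomb(1)[OF manifold S(1) _ _ T(2)] oneform_vcomb(2)[OF manifold S(1) _ _ T(2)]
  show "defect s t p (vcomb n g E) = (\<Sum>i<n. g i p * defect s t p (E i))"
    unfolding defect_def
    by (simp add: rules E g gamma_vcomb(1)[OF E S(3) T(3)] vcomb_apply sum.distrib[symmetric] sum_subtractf[symmetric] sum_negf[symmetric] algebra_simps)
qed

text \<open>Differentiating a left invariant field along \<open>y\<close> is the adjoint action of \<open>- y\<close> on its right
  trivialization, because the two kinds of fields commute; invariance of \<open>\<kappa>\<close> moves it to \<open>b\<close>.\<close>

lemma right_field_killing:
  assumes y: "y \<in> \<gg>" and b: "b \<in> \<gg>" and c: "c \<in> \<gg>"
  shows "R y p (\<lambda>q. fl (R b) q (L c q)) = fl (R (lbr A K y b)) p (L c p)"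
proof -
  obtain n e d where f: "\<And>i. i < n \<Longrightarrow> e i \<in> \<gg>"
    "\<And>X i. X \<in> vfields A \<Longrightarrow> i < n \<Longrightarrow> (\<lambda>q. \<sigma> q (X q) (R (d i) q)) \<in> smooth_funs A"
    "\<And>X. X \<in> vfields A \<Longrightarrow> X = vcomb n (\<lambda>i q. \<sigma> q (X q) (R (d i) q)) (\<lambda>i. R (e i))"
    using frame_exists by blast
  define w where "w = (\<lambda>i q. \<sigma> q (L c q) (R (d i) q))"
  have Lc: "L c = vcomb n w (\<lambda>i. R (e i))" unfolding w_def by (rule f(3)[OF left_field_vfields[OF c]])
  have w: "w i \<in> smooth_funs A" if "i < n" for i unfolding w_def by (rule f(2)[OF left_field_vfields[OF c] that])
  have E: "R (e i) \<in> vfields A" if "i < n" for i by (rule right_field_vfields[OF f(1)[OF that]])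
  note Ry = right_field_vfields[OF y] and Rb = fl_oneform[OF right_field_vfields[OF b]]
  have yb: "lbr A K y b \<in> \<gg>" by (rule lbr_lie_alg[OF y b])
  \<comment> \<open>Expanding the vanishing bracket of \<open>R y\<close> and \<open>L c\<close> in
    the right invariant frame determines how the coefficients \<open>w i\<close> of
    \<open>L c\<close> vary along \<open>R y\<close>.\<close>
  have "0 = fl (R b) p (lie_br (R y) (L c) p)"
    using cotangent_zero[OF oneformsD(1)[OF Rb]] by (simp add: lie_br_right_left[OF y c])
  also have "\<dots> = (\<Sum>i<n. R y p (w i) * fl (R b) p (R (e i) p) + w i p * fl (R b) p (lie_br (R y) (R (e i)) p))"
    unfolding Lc by (rule oneform_vcomb(2)[OF manifold Ry E w Rb]; assumption)
  also have "\<dots> = (\<Sum>i<n. R y p (w i) * fl (R b) p (R (e i) p)) - (\<Sum>i<n. w i p * fl (R (lbr A K y b)) p (R (e i) p))"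
  proof -
    have "fl (R b) p (lie_br (R y) (R (e i)) p) = - fl (R (lbr A K y b)) p (R (e i) p)" if "i < n" for i
    proof -
      have "\<kappa> b (lbr A K y (e i)) = - \<kappa> (lbr A K y b) (e i)"
        by (simp add: kappa_invariant[symmetric] b y f(1)[OF that] lbr_swap[of b y] kappa_minus lbr_lie_alg)
      then show ?thesis
        by (simp add: lie_br_right_right[OF y f(1)[OF that]] fl_apply right_field_tangent lbr_lie_alg f(1)[OF that] y b sigma_right_right)
    qed
    then show ?thesis by (simp add: sum.distrib sum_subtractf sum_negf)
  qed
  finally have 1: "(\<Sum>i<n. R y p (w i) * fl (R b) p (R (e i) p)) = (\<Sum>i<n. w i p * fl (R (lbr A K y b)) p (R (e i) p))" by simp
  have "R y p (\<lambda>q. fl (R b) q (L c q)) = (\<Sum>i<n. R y p (w i) * fl (R b) p (R (e i) p) + w i p * R y p (\<lambda>q. fl (R b) q (R (e i) q)))"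
    unfolding Lc by (rule oneform_vcomb(1)[OF manifold Ry E w Rb]; assumption)
  \<comment> \<open>The metric is constant on pairs of right invariant fields, so only the
    coefficients are differentiated.\<close>
  also have "\<dots> = (\<Sum>i<n. R y p (w i) * fl (R b) p (R (e i) p))"
    by (intro sum.cong refl) (simp add: fl_apply right_field_tangent f(1) b sigma_right_right tangent_const[OF right_field_tangent[OF y]])
  also have "\<dots> = fl (R (lbr A K y b)) p (L c p)"
    unfolding 1 Lc
    by (rule cotangent_vcomb[OF oneformsD(1)[OF fl_oneform[OF right_field_vfields[OF yb]]] E, symmetric])
  finally show ?thesis .
qed

text \<open>The Courant trivialization of \<open>(0, b)\<close> is \<open>rsec b\<close>, that of \<open>(a, 0)\<close> is \<open>lsec (- a)\<close>.\<close>

definition rsec :: "'k tvec \<Rightarrow> 'k \<Rightarrow> 'k gvec" where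
  "rsec b q = (R b q, flat A \<sigma> q (R b q))"

definition lsec :: "'k tvec \<Rightarrow> 'k \<Rightarrow> 'k gvec" where
  "lsec a q = (L a q, flat A \<sigma> q (L (- a) q))"

lemma rsec_gsections: "b \<in> \<gg> \<Longrightarrow> rsec b \<in> gsections A"
  and lsec_gsections: "b \<in> \<gg> \<Longrightarrow> lsec b \<in> gsections A"
  using right_field_vfields left_field_vfields fl_oneform lie_alg_closed(5)
  by (auto simp: gsections_def rsec_def lsec_def)

lemma gamma_right_right:
  assumes "y \<in> \<gg>" "b \<in> \<gg>" "w \<in> tangent A p"
  shows "\<gamma> p (R y p) (R b p) w = fl (R (lbr A K y b)) p w"
  using assms theta_r_lie_alg[OF assms(3)]
  by (simp add: cartan_form_def theta_r_right_field kappa_invariant[symmetric] fl_apply sigma_metric_def lbr_lie_alg)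

lemma gamma_swap_right:
  assumes "u \<in> tangent A p" "v \<in> tangent A p" "w \<in> tangent A p"
  shows "\<gamma> p u v w = - \<gamma> p u w v"
  using assms[THEN theta_r_lie_alg] lbr_swap[of "theta_r A K p v" "theta_r A K p w"]
  by (simp add: cartan_form_def kappa_minus lbr_lie_alg)

lemma fl_minus: "a \<in> \<gg> \<Longrightarrow> v \<in> tangent A p \<Longrightarrow> fl (R (- a)) p v = - fl (R a) p v"
proof -
  assume a: "a \<in> \<gg>" and v: "v \<in> tangent A p"
  have "R (- a) p = cscale (-1) (R a p)" using field_linear(3)[of "-1" a p] by (simp add: fvec.scale_minus_left)
  then show ?thesis
    using riemannianD(2)[OF sigma_riemannian right_field_tangent[OF a] v, of "-1"] v by (simp add: flat_def)
qed

lemma fl_left_minus: "X \<in> vfields A \<Longrightarrow> a \<in> \<gg> \<Longrightarrow> fl X p (L (- a) p) = - fl X p (L a p)"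
  using cotangent_cscale[OF oneformsD(1)[OF fl_oneform, of X p] left_field_tangent[of a p], of "-1"] field_linear(4)[of "-1" a p]
  by (simp add: fvec.scale_minus_left)

text \<open>For \<open>Y = R y\<close> the second summand differentiates a constant and the third
  contains the bracket of commuting fields. The 3-form contributes
  \<open>fl (R (lbr A K y b)) p (L c p)\<close>, which cancels the derivative in the first summand;
  this is where the normalization of \<open>\<gamma>\<close> enters. The last two summands are equal
  with opposite signs by \<open>right_field_killing\<close>.\<close>

lemma defect_right_left:
  assumes b: "b \<in> \<gg>" and c: "c \<in> \<gg>" and Y: "Y \<in> vfields A"
  shows "defect (rsec b) (lsec c) p Y = 0"
proof -
  define y where "y = theta_r A K p (Y p)"
  have y: "y \<in> \<gg>" unfolding y_def by (rule theta_r_lie_alg[OF vfieldsD(1)[OF Y]])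
  have c': "- c \<in> \<gg>" by (rule lie_alg_closed(5)[OF c])
  note v = right_field_vfields[OF b] right_field_vfields[OF y] left_field_vfields[OF c] left_field_vfields[OF c']
  have "defect (rsec b) (lsec c) p Y = defect (rsec b) (lsec c) p (R y)"
    by (rule defect_tensorial[OF rsec_gsections[OF b] lsec_gsections[OF c] Y v(2)])
      (simp add: y_def right_field_theta_r vfieldsD(1)[OF Y])
  also have "\<dots> = 0"
  proof -
    have 1: "L c p (\<lambda>q. fl (R b) q (R y q)) = 0"
      by (simp add: fl_apply right_field_tangent y b sigma_right_right tangent_const[OF left_field_tangent[OF c]])
    have 2: "fl (R b) p (lie_br (R y) (L c) p) = 0"
      using cotangent_zero[OF oneformsD(1)[OF fl_oneform[OF v(1)]]] by (simp add: lie_br_right_left[OF y c])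
    have 3: "\<gamma> p (R y p) (R b p) (L c p) = fl (R (lbr A K y b)) p (L c p)"
      by (rule gamma_right_right[OF y b left_field_tangent[OF c]])
    have 4: "fl (L (- c)) p (lie_br (R b) (R y) p) = fl (R (lbr A K b y)) p (L (- c) p)"
      unfolding lie_br_right_right[OF b y] by (rule fl_sym[OF v(4) right_field_vfields[OF lbr_lie_alg[OF b y]]])
    have 5: "R b p (\<lambda>q. fl (L (- c)) q (R y q)) = fl (R (lbr A K b y)) p (L (- c) p)"
      using right_field_killing[OF b y c', of p] fl_sym[OF v(4,2)] by simp
    show ?thesis
      unfolding defect_def rsec_def lsec_def fst_conv snd_conv 1 2 3 4 5 right_field_killing[OF y b c] by simp
  qed
  finally show ?thesis .
qed

lemma lie_br_left_right: "a \<in> \<gg> \<Longrightarrow> b \<in> \<gg> \<Longrightarrow> lie_br (L a) (R b) p = 0"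
  using lie_br_right_left[of b a p] lie_br_swap[of "L a" "R b" p] by simp

text \<open>The same reduction to \<open>Y = R y\<close>, but with another cancellation: the bracket
  of \<open>R y\<close> with \<open>R c\<close> survives. The first four summands are
  \<open>- ?P\<close>, \<open>- ?P\<close>, \<open>?P\<close> and \<open>?P\<close>, and the last
  two vanish.\<close>

lemma defect_left_right:
  assumes a: "a \<in> \<gg>" and c: "c \<in> \<gg>" and Y: "Y \<in> vfields A"
  shows "defect (lsec a) (rsec c) p Y = 0"
proof -
  define y where "y = theta_r A K p (Y p)"
  have y: "y \<in> \<gg>" unfolding y_def by (rule theta_r_lie_alg[OF vfieldsD(1)[OF Y]])
  have a': "- a \<in> \<gg>" by (rule lie_alg_closed(5)[OF a])
  note v = right_field_vfields[OF c] right_field_vfields[OF y] left_field_vfields[OF a] left_field_vfields[OF a']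
  have "defect (lsec a) (rsec c) p Y = defect (lsec a) (rsec c) p (R y)"
    by (rule defect_tensorial[OF lsec_gsections[OF a] rsec_gsections[OF c] Y v(2)])
      (simp add: y_def right_field_theta_r vfieldsD(1)[OF Y])
  also have "\<dots> = 0"
  proof -
    let ?P = "fl (R (lbr A K y c)) p (L (- a) p)"
    have 1: "R y p (\<lambda>q. fl (L (- a)) q (R c q)) = ?P"
      using right_field_killing[OF y c a', of p] fl_sym[OF v(4,1)] by simp
    have 2: "R c p (\<lambda>q. fl (L (- a)) q (R y q)) = - ?P"
      using right_field_killing[OF c y a', of p] fl_sym[OF v(4,2)] lbr_swap[of c y]
        fl_minus[OF lbr_lie_alg[OF y c] left_field_tangent[OF a']] by simp
    have 3: "fl (L (- a)) p (lie_br (R y) (R c) p) = ?P"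
      unfolding lie_br_right_right[OF y c] by (rule fl_sym[OF v(4) right_field_vfields[OF lbr_lie_alg[OF y c]]])
    have 4: "\<gamma> p (R y p) (L a p) (R c p) = ?P"
      using gamma_swap_right[OF right_field_tangent[OF y] left_field_tangent[OF a] right_field_tangent[OF c], of p]
        gamma_right_right[OF y c left_field_tangent[OF a]] fl_left_minus[OF right_field_vfields[OF lbr_lie_alg[OF y c]] a] by simp
    have 5: "fl (R c) p (lie_br (L a) (R y) p) = 0"
      using cotangent_zero[OF oneformsD(1)[OF fl_oneform[OF v(1)]]] by (simp add: lie_br_left_right[OF a y])
    have 6: "L a p (\<lambda>q. fl (R c) q (R y q)) = 0"
      by (simp add: fl_apply right_field_tangent y c sigma_right_right tangent_const[OF left_field_tangent[OF a]])
    show ?thesis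
      unfolding defect_def rsec_def lsec_def fst_conv snd_conv 1 2 3 4 5 6 by simp
  qed
  finally show ?thesis .
qed

text \<open>Passage from the frame \<open>f\<close> to an arbitrary section \<open>s\<close> of its
  span. The coefficients \<open>h k\<close> themselves multiply the defects. Their derivatives along
  the anchors of \<open>C\<close> and \<open>t\<close> multiply the pairings of \<open>t\<close>
  with \<open>f k\<close> and of \<open>f k\<close> with \<open>C\<close>, respectively. All of
  these vanish.\<close>

lemma dorfman_pairing:
  fixes m :: nat
  assumes f: "\<And>k. k < m \<Longrightarrow> f k \<in> gsections A" and h: "\<And>k. k < m \<Longrightarrow> h k \<in> smooth_funs A"
    and s: "s \<in> gsections A" "s = (\<lambda>q. \<Sum>k<m. gscale (h k q) (f k q))"
    and t: "t \<in> gsections A" and C: "C \<in> gsections A"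
    and br: "\<And>k. k < m \<Longrightarrow> lie_br (\<lambda>q. fst (f k q)) (\<lambda>q. fst (C q)) p = 0"
    and df: "\<And>k. k < m \<Longrightarrow> defect (f k) C p (\<lambda>q. fst (t q)) = 0"
    and fC: "\<And>k. k < m \<Longrightarrow> gpair (f k p) (C p) = 0"
    and tf: "\<And>k. k < m \<Longrightarrow> gpair (t p) (f k p) = 0"
  shows "gpair (dorfman A \<gamma> s t p) (C p) = fst (s p) (\<lambda>q. gpair (t q) (C q))"
proof -
  define X where "X = (\<lambda>q. fst (s q))"
  define \<xi> where "\<xi> = (\<lambda>q. snd (s q))"
  define Y where "Y = (\<lambda>q. fst (t q))"
  define \<eta> where "\<eta> = (\<lambda>q. snd (t q))"
  define Z where "Z = (\<lambda>q. fst (C q))"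
  define \<zeta> where "\<zeta> = (\<lambda>q. snd (C q))"
  define U where "U = (\<lambda>k q. fst (f k q))"
  define \<phi> where "\<phi> = (\<lambda>k q. snd (f k q))"
  have vX: "X \<in> vfields A" and xi: "\<xi> \<in> oneforms A" and vY: "Y \<in> vfields A" and eta: "\<eta> \<in> oneforms A"
    and vZ: "Z \<in> vfields A" and zeta: "\<zeta> \<in> oneforms A"
    using gsectionsD[OF s(1)] gsectionsD[OF t] gsectionsD[OF C] by (auto simp: X_def \<xi>_def Y_def \<eta>_def Z_def \<zeta>_def)
  have vU: "U k \<in> vfields A" and ph: "\<phi> k \<in> oneforms A" if "k < m" for k
    using gsectionsD[OF f[OF that]] by (auto simp: U_def \<phi>_def)
  have Xv: "X = vcomb m h U" by (auto simp: X_def s(2) fst_gscale_sum vcomb_def U_def)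
  have xia: "\<xi> q v = (\<Sum>k<m. h k q * \<phi> k q v)" for q v by (simp add: \<xi>_def s(2) snd_gscale_sum \<phi>_def)
  have D: "fst (dorfman A \<gamma> s t p) = lie_br X Y p"
    "snd (dorfman A \<gamma> s t p) (Z p) = X p (\<lambda>q. \<eta> q (Z q)) - \<eta> p (lie_br X Z p)
      - (Y p (\<lambda>q. \<xi> q (Z q)) - Z p (\<lambda>q. \<xi> q (Y q)) - \<xi> p (lie_br Y Z p)) + \<gamma> p (Y p) (X p) (Z p)"
    unfolding X_def \<xi>_def Y_def \<eta>_def using dorfman_apply[OF s(1) t vZ] by simp_all
  have b: "\<eta> p (lie_br X Z p) = (\<Sum>k<m. - (Z p (h k) * \<eta> p (U k p)))"
  proof -
    have "\<eta> p (lie_br X Z p) = (\<Sum>k<m. h k p * \<eta> p (lie_br (U k) Z p) - Z p (h k) * \<eta> p (U k p))"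
      unfolding Xv by (rule oneform_vcomb(3)[OF manifold vZ vU h eta])
    also have "\<dots> = (\<Sum>k<m. - (Z p (h k) * \<eta> p (U k p)))"
      by (intro sum.cong refl) (simp add: U_def Z_def br cotangent_zero[OF oneformsD(1)[OF eta]])
    finally show ?thesis .
  qed
  have xiW: "V p (\<lambda>q. \<xi> q (W q)) = (\<Sum>k<m. V p (h k) * \<phi> k p (W p) + h k p * V p (\<lambda>q. \<phi> k q (W q)))"
    if V: "V \<in> vfields A" and W: "W \<in> vfields A" for V W
    unfolding xia
    by (subst tangent_sum[OF manifold vfieldsD(1)[OF V]])
      (simp_all add: smooth_funs_mult[OF manifold] h oneformsD(2)[OF ph W] tangent_mult[OF vfieldsD(1)[OF V]])
  have g: "\<zeta> p (lie_br X Y p) = (\<Sum>k<m. h k p * \<zeta> p (lie_br (U k) Y p) - Y p (h k) * \<zeta> p (U k p))"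
    unfolding Xv by (rule oneform_vcomb(3)[OF manifold vY vU h zeta])
  have gm: "\<gamma> p (Y p) (X p) (Z p) = (\<Sum>k<m. h k p * \<gamma> p (Y p) (U k p) (Z p))"
    unfolding Xv by (rule gamma_vcomb(2)[OF vU vfieldsD(1)[OF vY] vfieldsD(1)[OF vZ]])
  have Xz: "X p (\<lambda>q. \<zeta> q (Y q)) = (\<Sum>k<m. h k p * U k p (\<lambda>q. \<zeta> q (Y q)))"
    unfolding Xv vcomb_apply ..
  \<comment> \<open>All terms belonging to the index \<open>k\<close>: the coefficient times the
    defect, and the two terms with derivatives of the coefficient.\<close>
  have term0: "h k p * (- Y p (\<lambda>q. \<phi> k q (Z q)) + Z p (\<lambda>q. \<phi> k q (Y q)) + \<phi> k p (lie_br Y Z p) + \<gamma> p (Y p) (U k p) (Z p)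
      + \<zeta> p (lie_br (U k) Y p) - U k p (\<lambda>q. \<zeta> q (Y q)))
      + Z p (h k) * (\<eta> p (U k p) + \<phi> k p (Y p)) - Y p (h k) * (\<phi> k p (Z p) + \<zeta> p (U k p)) = 0" if k: "k < m" for k
  proof -
    have "- Y p (\<lambda>q. \<phi> k q (Z q)) + Z p (\<lambda>q. \<phi> k q (Y q)) + \<phi> k p (lie_br Y Z p) + \<gamma> p (Y p) (U k p) (Z p)
      + \<zeta> p (lie_br (U k) Y p) - U k p (\<lambda>q. \<zeta> q (Y q)) = 0"
      using df[OF k] by (simp add: defect_def U_def \<phi>_def Z_def \<zeta>_def Y_def)
    moreover have "\<eta> p (U k p) + \<phi> k p (Y p) = 0" "\<phi> k p (Z p) + \<zeta> p (U k p) = 0"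
      using tf[OF k] fC[OF k] by (simp_all add: gpair_def U_def \<phi>_def Z_def \<zeta>_def Y_def \<eta>_def add.commute)
    ultimately show ?thesis by simp
  qed
  have "\<zeta> p (lie_br X Y p) - \<eta> p (lie_br X Z p) - Y p (\<lambda>q. \<xi> q (Z q)) + Z p (\<lambda>q. \<xi> q (Y q)) + \<xi> p (lie_br Y Z p)
    + \<gamma> p (Y p) (X p) (Z p) - X p (\<lambda>q. \<zeta> q (Y q)) = 0"
    unfolding b g gm Xz xiW[OF vY vZ] xiW[OF vZ vY] xia[of p "lie_br Y Z p"]
      sum_subtractf[symmetric] sum.distrib[symmetric]
    by (rule sum.neutral, rule ballI) (use term0 in \<open>simp add: algebra_simps\<close>)
  then have "\<zeta> p (fst (dorfman A \<gamma> s t p)) + snd (dorfman A \<gamma> s t p) (Z p) = X p (\<lambda>q. \<eta> q (Z q)) + X p (\<lambda>q. \<zeta> q (Y q))"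
    unfolding D by (simp add: algebra_simps)
  moreover have "X p (\<lambda>q. gpair (t q) (C q)) = (X p (\<lambda>q. \<eta> q (Z q)) + X p (\<lambda>q. \<zeta> q (Y q))) / 2"
  proof -
    have sm: "(\<lambda>q. \<eta> q (Z q)) \<in> smooth_funs A" "(\<lambda>q. \<zeta> q (Y q)) \<in> smooth_funs A"
      by (rule oneformsD(2)[OF eta vZ] oneformsD(2)[OF zeta vY])+
    have "(\<lambda>q. gpair (t q) (C q)) = (\<lambda>q. 1/2 * (\<eta> q (Z q) + \<zeta> q (Y q)))"
      by (simp add: gpair_def \<eta>_def Z_def \<zeta>_def Y_def add.commute)
    then show ?thesis
      using tangent_cscale[OF vfieldsD(1)[OF vX] smooth_funs_add[OF manifold sm], of p "1/2"] tangent_add[OF vfieldsD(1)[OF vX] sm, of p] by simp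
  qed
  ultimately show ?thesis by (simp add: gpair_def[of "dorfman A \<gamma> s t p"] X_def Z_def \<zeta>_def)
qed

section \<open>Trivialization of the quotient bundle\<close>

text \<open>The dual sections \<open>C\<close> of the frame \<open>g\<close> annihilate \<open>F\<close>, so pairing with them gives coordinates on
  the quotient. The relations between \<open>f\<close> and \<open>C\<close> make these coordinates holomorphic.\<close>

lemma quotient_holomorphically_trivial:
  fixes f f' g C :: "nat \<Rightarrow> 'k \<Rightarrow> 'k gvec" and m r :: nat
  assumes f: "\<And>k. k < m \<Longrightarrow> f k \<in> gsections A" and f': "\<And>k. k < m \<Longrightarrow> f' k \<in> gsections A"
    and g: "\<And>i. i < r \<Longrightarrow> g i \<in> gsections A" and C: "\<And>i. i < r \<Longrightarrow> C i \<in> gsections A"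
    and F: "\<And>p. F p = {\<Sum>k<m. gscale (h k) (f k p) | h. True}"
    and E: "\<And>p. E p = F p + {\<Sum>i<r. gscale (x i) (g i p) | x. True}"
    and ff': "\<And>k l p. k < m \<Longrightarrow> l < m \<Longrightarrow> gpair (f k p) (f' l p) = (if k = l then 1 else 0)"
    and gC: "\<And>i j p. i < r \<Longrightarrow> j < r \<Longrightarrow> gpair (g i p) (C j p) = (if i = j then 1 else 0)"
    and fC: "\<And>k j p. k < m \<Longrightarrow> j < r \<Longrightarrow> gpair (f k p) (C j p) = 0"
    and ff: "\<And>k l p. k < m \<Longrightarrow> l < m \<Longrightarrow> gpair (f k p) (f l p) = 0"
    and gf: "\<And>i k p. i < r \<Longrightarrow> k < m \<Longrightarrow> gpair (g i p) (f k p) = 0"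
    and br: "\<And>k j p. k < m \<Longrightarrow> j < r \<Longrightarrow> lie_br (\<lambda>q. fst (f k q)) (\<lambda>q. fst (C j q)) p = 0"
    and df: "\<And>k j p Y. k < m \<Longrightarrow> j < r \<Longrightarrow> Y \<in> vfields A \<Longrightarrow> defect (f k) (C j) p Y = 0"
    and lift: "\<And>X. X \<in> vfields01 A I \<Longrightarrow> \<exists>s\<in>sections_in A F. \<forall>q. fst (s q) = X q"
  shows "holomorphically_trivial A I (quotient_bundle A E F) (quotient_dolbeault A \<gamma> E F)"
proof -
  define G where "G = (\<lambda>p x. \<Sum>i<r. gscale (x i) (g i p))"
  have Fadd: "u + w \<in> F p" if uw: "u \<in> F p" "w \<in> F p" for u w p
  proof -
    obtain h h' where "u = (\<Sum>k<m. gscale (h k) (f k p))" "w = (\<Sum>k<m. gscale (h' k) (f k p))" using uw F by auto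
    then have "u + w = (\<Sum>k<m. gscale (h k + h' k) (f k p))" by (simp add: gvec.scale_left_distrib sum.distrib)
    then show ?thesis unfolding F by (intro CollectI exI[of _ "\<lambda>k. h k + h' k"]) simp
  qed
  have Fsc: "gscale c u \<in> F p" if u: "u \<in> F p" for u c p
  proof -
    obtain h where "u = (\<Sum>k<m. gscale (h k) (f k p))" using u F by auto
    then have "gscale c u = (\<Sum>k<m. gscale (c * h k) (f k p))" by (simp add: gvec.scale_sum_right)
    then show ?thesis unfolding F by (intro CollectI exI[of _ "\<lambda>k. c * h k"]) simp
  qed
  have F0: "0 \<in> F p" for p using F[of p] by (auto intro!: exI[of _ "\<lambda>k. 0"])
  have Fneg: "- u \<in> F p" if "u \<in> F p" for u p using Fsc[OF that, of "-1"] by (simp add: gvec.scale_minus_left)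
  have Ft: "fst u \<in> tangent A p" if u: "u \<in> F p" for u p
  proof -
    obtain h where "u = (\<Sum>k<m. gscale (h k) (f k p))" using u F by auto
    then have "fst u = (\<Sum>k<m. cscale (h k) (fst (f k p)))" by (simp only: fst_gscale_sum)
    moreover have "(\<Sum>k<m. cscale (h k) (fst (f k p))) \<in> tangent A p"
      by (rule tangent_closed(6), rule tangent_closed(3), rule gsectionsD(3)[OF f], simp)
    ultimately show ?thesis by simp
  qed
  have Gt: "fst (G p x) \<in> tangent A p" for p x
    unfolding G_def fst_gscale_sum by (rule tangent_closed(6), rule tangent_closed(3), rule gsectionsD(3)[OF g], simp)
  have FC: "gpair u (C j p) = 0" if u: "u \<in> F p" and j: "j < r" for u j p
  proof -
    obtain h where h: "u = (\<Sum>k<m. gscale (h k) (f k p))" using u F by auto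
    have "gpair u (C j p) = (\<Sum>k<m. h k * gpair (f k p) (C j p))"
      unfolding h by (rule gpair_sum_left[OF gsectionsD(3)[OF f] gsectionsD(5)[OF C[OF j]]]) simp
    then show ?thesis by (simp add: fC j)
  qed
  have GC: "gpair (G p x) (C j p) = x j" if j: "j < r" for j p x
  proof -
    have "gpair (G p x) (C j p) = (\<Sum>i<r. x i * gpair (g i p) (C j p))"
      unfolding G_def by (rule gpair_sum_left[OF gsectionsD(3)[OF g] gsectionsD(5)[OF C[OF j]]]) simp
    also have "\<dots> = (\<Sum>i<r. if i = j then x i else 0)" by (intro sum.cong) (auto simp: gC j)
    finally show ?thesis using j by simp
  qed
  have Edec: "\<exists>w\<in>F p. u = w + G p (\<lambda>i. gpair u (C i p))" if u: "u \<in> E p" for u p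
  proof -
    obtain w x where w: "w \<in> F p" "u = w + G p x" using u E[of p] by (auto simp: set_plus_def G_def)
    have "gpair u (C i p) = x i" if "i < r" for i
      using gpair_add_left[OF Ft[OF w(1)] Gt gsectionsD(5)[OF C[OF that]], of x] FC[OF w(1) that] GC[OF that] w(2) by simp
    then have "G p (\<lambda>i. gpair u (C i p)) = G p x" unfolding G_def by (intro sum.cong) auto
    then show ?thesis using w by auto
  qed
  have GE: "G p x \<in> E p" for p x
  proof -
    have "0 + G p x \<in> E p" unfolding E by (rule set_plus_intro[OF F0]) (auto simp: G_def)
    then show ?thesis by simp
  qed
  have Et: "fst u \<in> tangent A p" if "u \<in> E p" for u p
    using Edec[OF that] Ft Gt by (metis fst_add tangent_closed(2))
  have coset_absorb: "coset F p (w + u) = coset F p u" if w: "w \<in> F p" for w u p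
  proof (intro equalityI subsetI)
    fix v assume "v \<in> coset F p (w + u)"
    then obtain w' where w': "w' \<in> F p" "v = w + u + w'" by (auto simp: coset_def)
    then have "v = u + (w + w')" by (simp add: algebra_simps)
    then show "v \<in> coset F p u" using Fadd[OF w w'(1)] unfolding coset_def by blast
  next
    fix v assume "v \<in> coset F p u"
    then obtain w' where w': "w' \<in> F p" "v = u + w'" by (auto simp: coset_def)
    then have "v = w + u + (w' + - w)" by (simp add: algebra_simps)
    then show "v \<in> coset F p (w + u)" using Fadd[OF w'(1) Fneg[OF w]] unfolding coset_def by blast
  qed
  have cosetE: "coset F p u = coset F p (G p (\<lambda>i. gpair u (C i p)))" if "u \<in> E p" for u p
    using Edec[OF that] coset_absorb by metis
  have coset_plus: "coset F p u + coset F p v = coset F p (u + v)" for p u v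
  proof (intro equalityI subsetI)
    fix z assume "z \<in> coset F p u + coset F p v"
    then obtain a b where "a \<in> F p" "b \<in> F p" "z = (u + a) + (v + b)" unfolding coset_def set_plus_def by blast
    then have "z = (u + v) + (a + b)" "a + b \<in> F p" using Fadd by (simp_all add: algebra_simps)
    then show "z \<in> coset F p (u + v)" unfolding coset_def by blast
  next
    fix z assume "z \<in> coset F p (u + v)"
    then obtain a where "a \<in> F p" "z = u + v + a" by (auto simp: coset_def)
    then have "z = (u + a) + (v + 0)" "a \<in> F p" by (auto simp: algebra_simps)
    then show "z \<in> coset F p u + coset F p v" using F0 unfolding coset_def set_plus_def by blast
  qed
  have coset_scale: "gscale c ` coset F p u + F p = coset F p (gscale c u)" for p c u
  proof (intro equalityI subsetI)
    fix z assume "z \<in> gscale c ` coset F p u + F p"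
    then obtain a b where ab: "a \<in> F p" "b \<in> F p" "z = gscale c (u + a) + b" by (auto simp: coset_def set_plus_def)
    then have "z = gscale c u + (gscale c a + b)" by (simp add: gvec.scale_right_distrib add.assoc)
    then show "z \<in> coset F p (gscale c u)" using Fadd[OF Fsc[OF ab(1)] ab(2)] unfolding coset_def by blast
  next
    fix z assume "z \<in> coset F p (gscale c u)"
    then obtain a where "a \<in> F p" "z = gscale c (u + 0) + a" by (auto simp: coset_def)
    then show "z \<in> gscale c ` coset F p u + F p" using F0 unfolding coset_def set_plus_def by blast
  qed
  \<comment> \<open>Any representative of the coset gives the same coordinates, because
    \<open>C\<close> annihilates \<open>F\<close>.\<close>
  define \<Phi> where "\<Phi> = (\<lambda>p S i. if i < r then gpair (SOME u. u \<in> S) (C i p) else 0)"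
  have \<Phi>: "\<Phi> p (coset F p u) = (\<lambda>i. if i < r then gpair u (C i p) else 0)" if u: "fst u \<in> tangent A p" for p u
  proof
    fix i
    have "u + 0 \<in> coset F p u" using F0 unfolding coset_def by blast
    then have "(SOME v. v \<in> coset F p u) \<in> coset F p u" by (rule someI)
    then obtain w where w: "w \<in> F p" "(SOME v. v \<in> coset F p u) = u + w" by (auto simp: coset_def)
    show "\<Phi> p (coset F p u) i = (if i < r then gpair u (C i p) else 0)"
      using gpair_add_left[OF u Ft[OF w(1)] gsectionsD(5)[OF C], of i] FC[OF w(1)] by (simp add: \<Phi>_def w(2))
  qed
  have bij: "bij_betw (\<Phi> p) (coset F p ` E p) {x. \<forall>i\<ge>r. x i = 0}" for p
  proof (rule bij_betwI')
    fix S T assume "S \<in> coset F p ` E p" "T \<in> coset F p ` E p"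
    then obtain u v where uv: "u \<in> E p" "v \<in> E p" "S = coset F p u" "T = coset F p v" by auto
    show "(\<Phi> p S = \<Phi> p T) = (S = T)"
    proof
      assume "\<Phi> p S = \<Phi> p T"
      then have "gpair u (C i p) = gpair v (C i p)" if "i < r" for i
        using \<Phi>[OF Et[OF uv(1)]] \<Phi>[OF Et[OF uv(2)]] uv(3,4) that by (auto simp: fun_eq_iff split: if_splits dest: spec[of _ i])
      then have "G p (\<lambda>i. gpair u (C i p)) = G p (\<lambda>i. gpair v (C i p))" unfolding G_def by (intro sum.cong) auto
      then show "S = T" using cosetE uv by metis
    qed simp
  next
    fix S assume "S \<in> coset F p ` E p"
    then show "\<Phi> p S \<in> {x. \<forall>i\<ge>r. x i = 0}" by (simp add: \<Phi>_def)
  next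
    fix x :: "nat \<Rightarrow> complex" assume "x \<in> {x. \<forall>i\<ge>r. x i = 0}"
    then have "x = \<Phi> p (coset F p (G p x))" using \<Phi>[OF Gt] GC by auto
    then show "\<exists>S\<in>coset F p ` E p. x = \<Phi> p S" using GE by blast
  qed
  have smooth: "(s \<in> {(\<lambda>p. coset F p (t p)) | t. t \<in> sections_in A E}) \<longleftrightarrow>
      (\<forall>i. (\<forall>p. i \<ge> r \<longrightarrow> \<Phi> p (s p) i = 0) \<and> (\<lambda>p. \<Phi> p (s p) i) \<in> smooth_funs A)" (is "?l \<longleftrightarrow> ?r")
    if s: "\<And>p. s p \<in> coset F p ` E p" for s
  proof
    assume ?l
    then obtain t where t: "t \<in> sections_in A E" "s = (\<lambda>p. coset F p (t p))" by auto
    have tg: "t \<in> gsections A" using t(1) by (simp add: sections_in_def)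
    have "(\<lambda>p. \<Phi> p (s p) i) \<in> smooth_funs A" for i
      using gpair_smooth[OF manifold tg C, of i] smooth_funs_const[of 0 A]
      by (cases "i < r") (simp_all add: t(2) \<Phi>[OF gsectionsD(3)[OF tg]])
    then show ?r by (simp add: \<Phi>_def)
  next
    assume r: ?r
    \<comment> \<open>The combination of the frame \<open>g\<close> with the given coordinates is a
      smooth representative of \<open>s\<close>.\<close>
    define t where "t = (\<lambda>p. G p (\<Phi> p (s p)))"
    have "t \<in> gsections A" unfolding t_def G_def using r by (intro gsections_sum[OF manifold g]) auto
    then have "t \<in> sections_in A E" using GE by (simp add: sections_in_def t_def)
    moreover have "s p = coset F p (t p)" for p
    proof -
      obtain u where u: "u \<in> E p" "s p = coset F p u" using s by blast
      have "G p (\<Phi> p (s p)) = G p (\<lambda>i. gpair u (C i p))" unfolding u(2) \<Phi>[OF Et[OF u(1)]] G_def by (intro sum.cong) auto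
      then show ?thesis using cosetE[OF u(1)] u(2) by (simp add: t_def)
    qed
    ultimately show ?l by blast
  qed
  have hol: "\<Phi> p (quotient_dolbeault A \<gamma> E F X s p) = trivial_dolbeault X (\<lambda>q. \<Phi> q (s q)) p"
    if X: "X \<in> vfields01 A I" and s: "s \<in> {(\<lambda>p. coset F p (t p)) | t. t \<in> sections_in A E}" for X s p
  proof -
    define \<XX> where "\<XX> = (SOME \<XX>. \<XX> \<in> sections_in A F \<and> (\<forall>q. fst (\<XX> q) = X q))"
    define \<YY> where "\<YY> = (SOME \<YY>. \<YY> \<in> sections_in A E \<and> (\<forall>q. s q = coset F q (\<YY> q)))"
    have "\<XX> \<in> sections_in A F \<and> (\<forall>q. fst (\<XX> q) = X q)"
      using someI_ex[of "\<lambda>\<XX>. \<XX> \<in> sections_in A F \<and> (\<forall>q. fst (\<XX> q) = X q)"] lift[OF X] unfolding \<XX>_def by blast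
    then have x: "\<XX> \<in> gsections A" "\<And>q. \<XX> q \<in> F q" "\<And>q. fst (\<XX> q) = X q" by (auto simp: sections_in_def)
    have "\<YY> \<in> sections_in A E \<and> (\<forall>q. s q = coset F q (\<YY> q))"
      using someI_ex[of "\<lambda>\<YY>. \<YY> \<in> sections_in A E \<and> (\<forall>q. s q = coset F q (\<YY> q))"] s unfolding \<YY>_def by blast
    then have y: "\<YY> \<in> gsections A" "\<And>q. \<YY> q \<in> E q" "\<And>q. s q = coset F q (\<YY> q)" by (auto simp: sections_in_def)
    \<comment> \<open>The coefficients of the lift in the frame \<open>f\<close>, read off by the
      dual sections \<open>f'\<close>. As pairings of smooth sections they are smooth, so the lift
      has the form that \<open>dorfman_pairing\<close> requires.\<close>
    define h where "h = (\<lambda>k q. gpair (\<XX> q) (f' k q))"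
    have hs: "h k \<in> smooth_funs A" if "k < m" for k unfolding h_def by (rule gpair_smooth[OF manifold x(1) f'[OF that]])
    have xs: "\<XX> = (\<lambda>q. \<Sum>k<m. gscale (h k q) (f k q))"
    proof
      fix q
      obtain c where c: "\<XX> q = (\<Sum>k<m. gscale (c k) (f k q))" using x(2)[of q] F by auto
      have "h l q = c l" if l: "l < m" for l
      proof -
        have "h l q = (\<Sum>k<m. c k * gpair (f k q) (f' l q))"
          unfolding h_def c by (rule gpair_sum_left[OF gsectionsD(3)[OF f] gsectionsD(5)[OF f'[OF l]]]) simp
        also have "\<dots> = (\<Sum>k<m. if k = l then c k else 0)" by (intro sum.cong) (auto simp: ff' l)
        finally show ?thesis using l by simp
      qed
      then show "\<XX> q = (\<Sum>k<m. gscale (h k q) (f k q))" using c by simp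
    qed
    \<comment> \<open>\<open>F\<close> is isotropic and orthogonal to the frame \<open>g\<close>,
      hence orthogonal to all of \<open>E\<close>.\<close>
    have yf: "gpair (\<YY> p) (f k p) = 0" if k: "k < m" for k
    proof -
      obtain w z where w: "w \<in> F p" "\<YY> p = w + G p z" using Edec[OF y(2)[of p]] by blast
      obtain c where c: "w = (\<Sum>l<m. gscale (c l) (f l p))" using w(1) F by auto
      have "gpair w (f k p) = 0"
        unfolding c by (subst gpair_sum_left[OF gsectionsD(3)[OF f] gsectionsD(5)[OF f[OF k]]]) (simp_all add: ff k)
      moreover have "gpair (G p z) (f k p) = 0"
        unfolding G_def by (subst gpair_sum_left[OF gsectionsD(3)[OF g] gsectionsD(5)[OF f[OF k]]]) (simp_all add: gf k)
      ultimately show ?thesis using gpair_add_left[OF Ft[OF w(1)] Gt gsectionsD(5)[OF f[OF k]], of z] w(2) by simp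
    qed
    have tan: "fst (dorfman A \<gamma> \<XX> \<YY> p) \<in> tangent A p"
      unfolding dorfman_apply(1)[OF x(1) y(1) gsectionsD(1)[OF x(1)]]
      by (rule lie_br_tangent[OF manifold gsectionsD(1)[OF x(1)] gsectionsD(1)[OF y(1)]])
    have "\<Phi> p (quotient_dolbeault A \<gamma> E F X s p) = \<Phi> p (coset F p (dorfman A \<gamma> \<XX> \<YY> p))"
      by (simp add: quotient_dolbeault_def Let_def \<XX>_def \<YY>_def)
    also have "\<dots> = (\<lambda>i. X p (\<lambda>q. \<Phi> q (s q) i))"
    proof
      fix i
      show "\<Phi> p (coset F p (dorfman A \<gamma> \<XX> \<YY> p)) i = X p (\<lambda>q. \<Phi> q (s q) i)"
      proof (cases "i < r")
        case True
        have "gpair (dorfman A \<gamma> \<XX> \<YY> p) (C i p) = fst (\<XX> p) (\<lambda>q. gpair (\<YY> q) (C i q))"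
          by (rule dorfman_pairing[OF f hs x(1) xs y(1) C[OF True] br[OF _ True] df[OF _ True gsectionsD(1)[OF y(1)]] fC[OF _ True] yf])
        then show ?thesis using True by (simp add: \<Phi>[OF tan] y(3) \<Phi>[OF gsectionsD(3)[OF y(1)]] x(3))
      next
        case False
        then show ?thesis using tangent_const[OF gsectionsD(3)[OF x(1)], of p 0] by (simp add: \<Phi>_def x(3))
      qed
    qed
    finally show ?thesis by (simp add: trivial_dolbeault_def)
  qed
  have "holomorphic_iso A I (quotient_bundle A E F) (quotient_dolbeault A \<gamma> E F) (trivial_bundle A r) trivial_dolbeault \<Phi>"
    unfolding holomorphic_iso_def quotient_bundle_def trivial_bundle_def cbundle.simps
  proof (intro conjI allI ballI impI)
    show "bij_betw (\<Phi> p) (coset F p ` E p) {x. \<forall>i\<ge>r. x i = 0}" for p by (rule bij)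
  next
    fix p S T assume "S \<in> coset F p ` E p" "T \<in> coset F p ` E p"
    then obtain u v where uv: "u \<in> E p" "v \<in> E p" "S = coset F p u" "T = coset F p v" by auto
    have t: "fst u \<in> tangent A p" "fst v \<in> tangent A p" "fst (u + v) \<in> tangent A p"
      using Et[OF uv(1)] Et[OF uv(2)] by (simp_all add: tangent_closed(2))
    show "\<Phi> p (S + T) = \<Phi> p S + \<Phi> p T"
      unfolding uv(3,4) coset_plus \<Phi>[OF t(1)] \<Phi>[OF t(2)] \<Phi>[OF t(3)]
      using gpair_add_left[OF t(1,2) gsectionsD(5)[OF C]] by (auto simp: fun_eq_iff)
  next
    fix p c S assume "S \<in> coset F p ` E p"
    then obtain u where u: "u \<in> E p" "S = coset F p u" by auto
    have t: "fst u \<in> tangent A p" "fst (gscale c u) \<in> tangent A p"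
      using Et[OF u(1)] by (simp_all add: gscale_def tangent_closed(3))
    show "\<Phi> p (gscale c ` S + F p) = cscale c (\<Phi> p S)"
      unfolding u(2) coset_scale \<Phi>[OF t(1)] \<Phi>[OF t(2)]
      using gpair_gscale_left[OF t(1) gsectionsD(5)[OF C]] by (auto simp: fun_eq_iff cscale_def)
  next
    fix s assume "\<forall>p. s p \<in> coset F p ` E p"
    then show "(s \<in> {(\<lambda>p. coset F p (t p)) | t. t \<in> sections_in A E}) =
      ((\<lambda>p. \<Phi> p (s p)) \<in> {s. \<forall>i. (\<forall>p. r \<le> i \<longrightarrow> s p i = 0) \<and> (\<lambda>p. s p i) \<in> smooth_funs A})"
      using smooth[of s] by simp
  next
    fix X s p assume "X \<in> vfields01 A I" "s \<in> {(\<lambda>p. coset F p (t p)) | t. t \<in> sections_in A E}"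
    then show "\<Phi> p (quotient_dolbeault A \<gamma> E F X s p) = trivial_dolbeault X (\<lambda>q. \<Phi> q (s q)) p" by (rule hol)
  qed
  then show ?thesis unfolding holomorphically_trivial_def by blast
qed

end

section \<open>The Lie algebraic generalized Kaehler structure\<close>

lemma gconj_gconj [simp]: "gconj (gconj u) = u"
  by (simp add: gconj_def)

lemma gconj_gscale: "gconj (gscale c u) = gscale (cnj c) (gconj u)"
  by (simp add: gconj_def gscale_def tconj_cscale) (simp add: cscale_def)

lemma gconj_gtangent:
  assumes A: "smooth_manifold A" and u: "u \<in> gtangent A p"
  shows "gconj u \<in> gtangent A p"
proof -
  have x: "snd u \<in> cotangent A p" and v: "fst u \<in> tangent A p" using u by (auto simp: gtangent_def)
  note t = tangent_tconj[OF A]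
  have o: "tconj v \<notin> tangent A p" if "v \<notin> tangent A p" for v using t[of "tconj v" p] that by auto
  have "(\<lambda>v. cnj (snd u (tconj v))) \<in> cotangent A p"
    unfolding cotangent_def
    by (auto simp: tconj_add tconj_cscale cotangent_add[OF x] cotangent_cscale[OF x] t o cotangent_def[of A p] x[unfolded cotangent_def, simplified])
  then show ?thesis using t[OF v] by (simp add: gconj_def gtangent_def)
qed

lemma generalized_complexD:
  assumes "generalized_complex A \<gamma> J" "u \<in> gtangent A p"
  shows "J p u \<in> gtangent A p" "J p (gconj u) = gconj (J p u)" "J p (gscale c u) = gscale c (J p u)" "J p (J p u) = - u"
proof -
  have r: "real_gendo A J" by (rule conjunct1[OF assms(1)[unfolded generalized_complex_def]])
  have *: "J p u \<in> gtangent A p \<and> J p (gconj u) = gconj (J p u) \<and> (\<forall>c. J p (gscale c u) = gscale c (J p u)) \<and>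
        (\<forall>w\<in>gtangent A p. J p (u + w) = J p u + J p w)"
    by (rule bspec[OF spec[OF conjunct1[OF r[unfolded real_gendo_def]]] assms(2)])
  show "J p u \<in> gtangent A p" by (rule conjunct1[OF *])
  show "J p (gconj u) = gconj (J p u)" by (rule conjunct1[OF conjunct2[OF *]])
  show "J p (gscale c u) = gscale c (J p u)" by (rule spec[OF conjunct1[OF conjunct2[OF conjunct2[OF *]]]])
  show "J p (J p u) = - u"
    by (rule bspec[OF spec[OF conjunct1[OF conjunct2[OF assms(1)[unfolded generalized_complex_def]]]] assms(2)])
qed

lemma lagrangian_subalgebraD:
  assumes "lagrangian_subalgebra A K \<kappa> \<LL>"
  shows "\<LL> \<subseteq> lie_alg A K \<times> lie_alg A K" "0 \<in> \<LL>" "x \<in> \<LL> \<Longrightarrow> y \<in> \<LL> \<Longrightarrow> x + y \<in> \<LL>"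
    "x \<in> \<LL> \<Longrightarrow> (cscale c (fst x), cscale c (snd x)) \<in> \<LL>" "x \<in> \<LL> \<Longrightarrow> y \<in> \<LL> \<Longrightarrow> pair_form \<kappa> x y = 0"
proof -
  note d = assms[unfolded lagrangian_subalgebra_def]
  note d3 = conjunct2[OF conjunct2[OF d]]
  note d4 = conjunct2[OF d3]
  note l = conjunct2[OF conjunct2[OF d4]]
  show "\<LL> \<subseteq> lie_alg A K \<times> lie_alg A K" by (rule conjunct1[OF d])
  show "0 \<in> \<LL>" by (rule conjunct1[OF conjunct2[OF d]])
  show "x + y \<in> \<LL>" if "x \<in> \<LL>" "y \<in> \<LL>" by (rule bspec[OF bspec[OF conjunct1[OF d3] that(1)] that(2)])
  show "(cscale c (fst x), cscale c (snd x)) \<in> \<LL>" if "x \<in> \<LL>" by (rule bspec[OF spec[OF conjunct1[OF d4]] that])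
  assume xy: "x \<in> \<LL>" "y \<in> \<LL>"
  have "x \<in> {x \<in> lie_alg A K \<times> lie_alg A K. \<forall>y\<in>\<LL>. pair_form \<kappa> x y = 0}"
    by (rule subsetD[OF equalityD1[OF l] xy(1)])
  then show "pair_form \<kappa> x y = 0" using xy(2) by simp
qed

lemma gscale_uminus: "gscale (-1) u = - u"
  by (simp add: gvec.scale_minus_left)

context metric_lie_group
begin

section \<open>Linearity and spans of the invariant sections\<close>

lemma flat_tconj: "u \<in> tangent A p \<Longrightarrow> flat A \<sigma> p (tconj u) = (\<lambda>v. cnj (flat A \<sigma> p u (tconj v)))"
proof
  fix v assume u: "u \<in> tangent A p"
  have "tconj v \<in> tangent A p \<longleftrightarrow> v \<in> tangent A p" using tangent_tconj[OF manifold, of v p] tangent_tconj[OF manifold, of "tconj v" p] by auto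
  then show "flat A \<sigma> p (tconj u) v = cnj (flat A \<sigma> p u (tconj v))"
    using riemannian_tconj[OF manifold sigma_riemannian u, of "tconj v"] by (simp add: flat_def)
qed

lemma flat_zero: "flat A \<sigma> p 0 = 0"
  using flat_linear(2)[OF sigma_riemannian tangent_closed(1) tangent_closed(1), of p 0] by (simp add: cscale_def zero_fun_def)

lemma flat_cscale: "u \<in> tangent A p \<Longrightarrow> flat A \<sigma> p (cscale c u) = cscale c (flat A \<sigma> p u)"
  by (rule flat_linear(2)[OF sigma_riemannian])

lemma rsec_linear: "a \<in> \<gg> \<Longrightarrow> b \<in> \<gg> \<Longrightarrow> rsec (a + b) p = rsec a p + rsec b p"
    "a \<in> \<gg> \<Longrightarrow> rsec (cscale c a) p = gscale c (rsec a p)" "rsec 0 p = 0" "a \<in> \<gg> \<Longrightarrow> rsec (tconj a) p = gconj (rsec a p)"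
  by (simp_all add: rsec_def field_linear field_zero flat_linear(1)[OF sigma_riemannian] flat_cscale right_field_tangent gscale_def flat_zero gconj_def flat_tconj zero_prod_def)

lemma lsec_linear: "a \<in> \<gg> \<Longrightarrow> b \<in> \<gg> \<Longrightarrow> lsec (a + b) p = lsec a p + lsec b p"
    "a \<in> \<gg> \<Longrightarrow> lsec (cscale c a) p = gscale c (lsec a p)" "lsec 0 p = 0" "a \<in> \<gg> \<Longrightarrow> lsec (tconj a) p = gconj (lsec a p)"
proof -
  have m: "- a = cscale (-1) a" for a :: "'k tvec" by (simp add: fvec.scale_minus_left)
  have ta: "L (- a) p \<in> tangent A p" if "a \<in> \<gg>" for a by (rule left_field_tangent[OF lie_alg_closed(5)[OF that]])
  have 1: "- (a + b) = (- a) + (- b)" "- cscale c a = cscale c (- a)" "- tconj a = tconj (- a)" for a b :: "'k tvec" and c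
    by (auto simp: cscale_def tconj_def)
  show "a \<in> \<gg> \<Longrightarrow> b \<in> \<gg> \<Longrightarrow> lsec (a + b) p = lsec a p + lsec b p"
    "a \<in> \<gg> \<Longrightarrow> lsec (cscale c a) p = gscale c (lsec a p)" "lsec 0 p = 0" "a \<in> \<gg> \<Longrightarrow> lsec (tconj a) p = gconj (lsec a p)"
    by (simp_all only: lsec_def 1 field_linear field_zero flat_linear(1)[OF sigma_riemannian ta ta] flat_cscale[OF ta] flat_tconj[OF ta] minus_zero flat_zero)
      (simp_all add: gscale_def gconj_def zero_prod_def)
qed

lemma sec_sum:
  fixes n :: nat
  assumes "\<And>k. k < n \<Longrightarrow> e k \<in> \<gg>"
  shows "rsec (\<Sum>k<n. cscale (h k) (e k)) p = (\<Sum>k<n. gscale (h k) (rsec (e k) p))"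
    and "lsec (\<Sum>k<n. cscale (h k) (e k)) p = (\<Sum>k<n. gscale (h k) (lsec (e k) p))"
proof -
  have g: "(\<Sum>k<i. cscale (h k) (e k)) \<in> \<gg>" if "i \<le> n" for i using assms that by (intro lie_alg_closed(6) lie_alg_closed(3)) auto
  have "rsec (\<Sum>k<i. cscale (h k) (e k)) p = (\<Sum>k<i. gscale (h k) (rsec (e k) p))
    \<and> lsec (\<Sum>k<i. cscale (h k) (e k)) p = (\<Sum>k<i. gscale (h k) (lsec (e k) p))" if "i \<le> n" for i
    using that
  proof (induction i)
    case (Suc i)
    then have i: "i < n" "i \<le> n" by auto
    note t = lie_alg_closed(3)[OF assms[OF i(1)], of "h i"]
    show ?case
      unfolding sum.lessThan_Suc rsec_linear(1)[OF g[OF i(2)] t] lsec_linear(1)[OF g[OF i(2)] t]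
        rsec_linear(2)[OF assms[OF i(1)]] lsec_linear(2)[OF assms[OF i(1)]]
      using Suc.IH[OF i(2)] by simp
  qed (simp add: rsec_linear lsec_linear)
  then show "rsec (\<Sum>k<n. cscale (h k) (e k)) p = (\<Sum>k<n. gscale (h k) (rsec (e k) p))"
    "lsec (\<Sum>k<n. cscale (h k) (e k)) p = (\<Sum>k<n. gscale (h k) (lsec (e k) p))" by auto
qed

text \<open>The constants \<open>e k\<close> do not depend on \<open>p\<close>. This turns the
  fibrewise description of the bundles into global frames.\<close>

lemma sec_span:
  assumes M: "M \<subseteq> \<gg>" "fvec.subspace M" and e: "hermitian_basis M n e"
  shows "{rsec b p | b. b \<in> M} = {\<Sum>k<n. gscale (h k) (rsec (e k) p) | h. True}"
    and "{lsec b p | b. b \<in> M} = {\<Sum>k<n. gscale (h k) (lsec (e k) p) | h. True}"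
proof -
  have eM: "e k \<in> M" if "k < n" for k using e that by (simp add: hermitian_basis_def)
  then have eg: "e k \<in> \<gg>" if "k < n" for k using that M(1) by blast
  have ex: "\<exists>h. b = (\<Sum>k<n. cscale (h k) (e k))" if "b \<in> M" for b
    using e that by (intro exI[of _ "\<lambda>i. \<kappa> b (tconj (e i))"]) (simp add: hermitian_basis_def)
  have inM: "(\<Sum>k<n. cscale (h k) (e k)) \<in> M" for h
    by (intro fvec.subspace_sum fvec.subspace_scale M(2)) (auto intro: eM)
  note s = sec_sum[where n = n and e = e, OF eg]
  show "{rsec b p | b. b \<in> M} = {\<Sum>k<n. gscale (h k) (rsec (e k) p) | h. True}"
    using ex inM by (auto simp: s(1)[symmetric])
  show "{lsec b p | b. b \<in> M} = {\<Sum>k<n. gscale (h k) (lsec (e k) p) | h. True}"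
    using ex inM by (auto simp: s(2)[symmetric])
qed

text \<open>The quadratic form \<open>- \<kappa> \<oplus> \<kappa>\<close> on pairs of constants.
  The sign for \<open>lsec\<close> and the vanishing of the cross terms come from its 1-form having
  the opposite sign relative to its anchor.\<close>

lemma gpair_sec:
  assumes a: "a \<in> \<gg>" and b: "b \<in> \<gg>"
  shows "gpair (rsec a p) (rsec b p) = \<kappa> a b" "gpair (lsec a p) (lsec b p) = - \<kappa> a b"
    "gpair (rsec a p) (lsec b p) = 0" "gpair (lsec b p) (rsec a p) = 0"
proof -
  note v = right_field_vfields[OF a] right_field_vfields[OF b] left_field_vfields[OF a] left_field_vfields[OF b]
  show "gpair (rsec a p) (rsec b p) = \<kappa> a b"
    using kappa_sym[OF a b] by (simp add: gpair_def rsec_def flat_def right_field_tangent a b sigma_right_right)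
  have "fl (L (- b)) p (L a p) = - fl (L a) p (L b p)" "fl (L (- a)) p (L b p) = - fl (L b) p (L a p)"
    using fl_sym[OF v(3) left_field_vfields[OF lie_alg_closed(5)[OF b]], of p] fl_left_minus[OF v(3) b, of p]
      fl_sym[OF v(4) left_field_vfields[OF lie_alg_closed(5)[OF a]], of p] fl_left_minus[OF v(4) a, of p] by simp_all
  then show "gpair (lsec a p) (lsec b p) = - \<kappa> a b"
    using kappa_sym[OF a b] by (simp add: gpair_def lsec_def flat_def left_field_tangent a b sigma_left_left)
  have "fl (L (- b)) p (R a p) = - fl (R a) p (L b p)"
    using fl_sym[OF v(1) left_field_vfields[OF lie_alg_closed(5)[OF b]], of p] fl_left_minus[OF v(1) b, of p] by simp
  then show "gpair (rsec a p) (lsec b p) = 0" "gpair (lsec b p) (rsec a p) = 0"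
    by (simp_all add: gpair_def lsec_def rsec_def)
qed

section \<open>The Courant trivialization and its image of a Lagrangian subalgebra\<close>

lemma courant_triv_eq:
  assumes a: "a \<in> \<gg>" and b: "b \<in> \<gg>"
  shows "courant_triv A K \<kappa> (a, b) p = rsec b p + lsec (- a) p"
proof -
  have "L (- a) p = - L a p" using field_linear(4)[of "-1" a p] by (simp add: fvec.scale_minus_left)
  then have 1: "R b p - L a p = R b p + L (- a) p" by simp
  have 2: "(if v \<in> tangent A p then \<kappa> (theta_r A K p v) b + \<kappa> (theta_l A K p v) a else 0) = flat A \<sigma> p (R b p) v + flat A \<sigma> p (L a p) v" for v
  proof (cases "v \<in> tangent A p")
    case v: True
    have "\<kappa> (theta_r A K p v) b = \<sigma> p v (R b p)" by (simp add: sigma_metric_def theta_r_right_field b)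
    then show ?thesis using v sigma_left[OF v a]
        riemannianD(1)[OF sigma_riemannian v right_field_tangent[OF b]] riemannianD(1)[OF sigma_riemannian v left_field_tangent[OF a]]
      by (simp add: flat_def)
  qed (simp add: flat_def)
  show ?thesis
    unfolding courant_triv_def fst_conv snd_conv rsec_def lsec_def add_Pair minus_minus
    by (rule arg_cong2[where f = Pair, OF 1]) (rule ext, simp add: 2)
qed

lemma courant_triv_parts:
  assumes a: "a \<in> \<gg>" and b: "b \<in> \<gg>"
  shows "fst (courant_triv A K \<kappa> (a, b) p) = R b p - L a p" "snd (courant_triv A K \<kappa> (a, b) p) = flat A \<sigma> p (R b p + L a p)"
  unfolding courant_triv_eq[OF a b] using flat_linear(1)[OF sigma_riemannian right_field_tangent[OF b] left_field_tangent[OF a]]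
    field_linear(4)[of "-1" a p]
  by (simp_all add: rsec_def lsec_def fvec.scale_minus_left)

lemma left_field_inj: "a \<in> \<gg> \<Longrightarrow> b \<in> \<gg> \<Longrightarrow> L a p = L b p \<Longrightarrow> a = b"
  and right_field_inj: "a \<in> \<gg> \<Longrightarrow> b \<in> \<gg> \<Longrightarrow> R a p = R b p \<Longrightarrow> a = b"
  using theta_l_left_field theta_r_right_field by metis+

lemma sum_diff_eqD:
  fixes x y x' y' :: "'k tvec"
  assumes "x + y = x' + y'" "x - y = x' - y'"
  shows "x = x'" "y = y'"
proof -
  have "x f = x' f \<and> y f = y' f" for f
  proof -
    have e: "x f + y f = x' f + y' f" "x f - y f = x' f - y' f"
      using fun_cong[OF assms(1), of f] fun_cong[OF assms(2), of f] by simp_all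
    have "2 * x f = (x f + y f) + (x f - y f)" by simp
    also have "\<dots> = 2 * x' f" unfolding e by simp
    finally show ?thesis using e(1) by simp
  qed
  then show "x = x'" "y = y'" by auto
qed

text \<open>The 1-form determines the sum of \<open>R b p\<close> and \<open>L a p\<close> and the
  anchor their difference, hence both, and invariant fields are determined by their value at one
  point.\<close>

lemma courant_triv_inj:
  assumes g: "a \<in> \<gg>" "b \<in> \<gg>" "a' \<in> \<gg>" "b' \<in> \<gg>" and e: "courant_triv A K \<kappa> (a, b) p = courant_triv A K \<kappa> (a', b') p"
  shows "a = a' \<and> b = b'"
proof -
  have "R b p + L a p = R b' p + L a' p"
    using e courant_triv_parts(2)[OF g(1,2), of p] courant_triv_parts(2)[OF g(3,4), of p]
    by (intro flat_inj[OF manifold sigma_riemannian, where p = p]) (simp_all add: tangent_closed(2) g right_field_tangent left_field_tangent)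
  moreover have "R b p - L a p = R b' p - L a' p"
    using e courant_triv_parts(1)[OF g(1,2), of p] courant_triv_parts(1)[OF g(3,4), of p] by simp
  ultimately have "R b p = R b' p" "L a p = L a' p" by (rule sum_diff_eqD)+
  then show ?thesis using left_field_inj[OF g(1,3)] right_field_inj[OF g(2,4)] by blast
qed

text \<open>Generators \<open>(0, b)\<close> and \<open>(a, 0)\<close> are singled out by their images lying on the graphs of the metric
  and of its negative, which are the eigenbundles of \<open>- Jp Jm\<close>.\<close>

lemma courant_triv_graph:
  assumes g: "a \<in> \<gg>" "b \<in> \<gg>"
  shows "snd (courant_triv A K \<kappa> (a, b) p) = flat A \<sigma> p (fst (courant_triv A K \<kappa> (a, b) p)) \<Longrightarrow> a = 0"
    and "snd (courant_triv A K \<kappa> (a, b) p) = - flat A \<sigma> p (fst (courant_triv A K \<kappa> (a, b) p)) \<Longrightarrow> b = 0"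
proof -
  note t = right_field_tangent[OF g(2), of p] left_field_tangent[OF g(1), of p]
  have d: "R b p - L a p \<in> tangent A p" by (rule tangent_closed(4)[OF t])
  {
    assume "snd (courant_triv A K \<kappa> (a, b) p) = flat A \<sigma> p (fst (courant_triv A K \<kappa> (a, b) p))"
    then have "R b p + L a p = R b p - L a p"
      unfolding courant_triv_parts[OF g] by (intro flat_inj[OF manifold sigma_riemannian, where p = p]) (simp_all only: tangent_closed(2,4) t)
    then have "L a p = L 0 p" using sum_diff_eqD[of "R b p" "L a p" "R b p" "- L a p"] by (simp add: field_zero fun_eq_iff)
    then show "a = 0" by (rule left_field_inj[OF g(1) lie_alg_closed(1)])
  next
    assume "snd (courant_triv A K \<kappa> (a, b) p) = - flat A \<sigma> p (fst (courant_triv A K \<kappa> (a, b) p))"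
    then have "flat A \<sigma> p (R b p + L a p) = flat A \<sigma> p (cscale (-1) (R b p - L a p))"
      unfolding courant_triv_parts[OF g] flat_cscale[OF d] by (simp add: fvec.scale_minus_left)
    then have "R b p + L a p = cscale (-1) (R b p - L a p)"
      by (intro flat_inj[OF manifold sigma_riemannian, where p = p]) (simp_all only: tangent_closed(2,3,4) t)
    then have "R b p = R 0 p" by (simp add: field_zero fun_eq_iff cscale_def)
    then show "b = 0" by (rule right_field_inj[OF g(2) lie_alg_closed(1)])
  }
qed

text \<open>The images of the elements of \<open>\<LL>\<close> already form a subspace, so the span
  adds nothing. Each vector of the eigenbundle can therefore be traced back to a single pair of
  constants.\<close>

lemma eigenbundle_lagrangian:
  assumes L: "lagrangian_subalgebra A K \<kappa> \<LL>"
    and e: "eigenbundle A J p = gvec.span {courant_triv A K \<kappa> x p | x. x \<in> \<LL>}"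
  shows "eigenbundle A J p = {courant_triv A K \<kappa> x p | x. x \<in> \<LL>}"
proof -
  note sub = lagrangian_subalgebraD(1)[OF L] and z = lagrangian_subalgebraD(2)[OF L]
    and add = lagrangian_subalgebraD(3)[OF L] and sc = lagrangian_subalgebraD(4)[OF L]
  have "gvec.subspace {courant_triv A K \<kappa> x p | x. x \<in> \<LL>}"
    unfolding gvec.subspace_def
  proof (intro conjI ballI allI)
    have "courant_triv A K \<kappa> 0 p = 0"
      using courant_triv_eq[OF lie_alg_closed(1,1), of p] by (simp add: zero_prod_def[symmetric] rsec_linear lsec_linear)
    then have "0 = courant_triv A K \<kappa> 0 p" by simp
    then show "0 \<in> {courant_triv A K \<kappa> x p | x. x \<in> \<LL>}" using z by blast
  next
    fix u w assume "u \<in> {courant_triv A K \<kappa> x p | x. x \<in> \<LL>}" "w \<in> {courant_triv A K \<kappa> x p | x. x \<in> \<LL>}"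
    then obtain x y where xy: "x \<in> \<LL>" "y \<in> \<LL>" "u = courant_triv A K \<kappa> x p" "w = courant_triv A K \<kappa> y p" by auto
    obtain a b a' b' where ab: "x = (a, b)" "y = (a', b')" by (metis surj_pair)
    have g: "a \<in> \<gg>" "b \<in> \<gg>" "a' \<in> \<gg>" "b' \<in> \<gg>" using sub xy ab by auto
    have "u + w = courant_triv A K \<kappa> (x + y) p"
      unfolding xy ab add_Pair courant_triv_eq[OF g(1,2)] courant_triv_eq[OF g(3,4)] courant_triv_eq[OF lie_alg_closed(2)[OF g(1,3)] lie_alg_closed(2)[OF g(2,4)]]
      using lsec_linear(1)[OF lie_alg_closed(5)[OF g(1)] lie_alg_closed(5)[OF g(3)], of p] by (simp add: rsec_linear g algebra_simps)
    then show "u + w \<in> {courant_triv A K \<kappa> x p | x. x \<in> \<LL>}" using add[OF xy(1,2)] by blast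
  next
    fix c u assume "u \<in> {courant_triv A K \<kappa> x p | x. x \<in> \<LL>}"
    then obtain x where x: "x \<in> \<LL>" "u = courant_triv A K \<kappa> x p" by auto
    obtain a b where ab: "x = (a, b)" by (metis surj_pair)
    have g: "a \<in> \<gg>" "b \<in> \<gg>" using sub x ab by auto
    have "gscale c u = courant_triv A K \<kappa> (cscale c a, cscale c b) p"
      unfolding x ab courant_triv_eq[OF g] courant_triv_eq[OF lie_alg_closed(3)[OF g(1)] lie_alg_closed(3)[OF g(2)]]
      using lsec_linear(2)[OF lie_alg_closed(5)[OF g(1)], of c p]
      by (simp add: rsec_linear g gvec.scale_right_distrib)
    then show "gscale c u \<in> {courant_triv A K \<kappa> x p | x. x \<in> \<LL>}" using sc[OF x(1), of c] ab by auto
  qed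
  then show ?thesis using e gvec.span_eq_iff by auto
qed

end

locale lie_algebraic_gk = metric_lie_group A K \<kappa>
  for A :: "('k::{t2_space, second_countable_topology}, 'e::real_normed_vector) atlas" and K :: "'k monoid" and \<kappa> +
  fixes Jp Jm :: "'k \<Rightarrow> 'k gvec \<Rightarrow> 'k gvec"
  assumes gk: "lie_algebraic_generalized_kaehler A K \<kappa> Jp Jm"
begin

section \<open>The two eigenbundles and the bundles cut out by them\<close>

lemma generalized_kaehler: "generalized_kaehler A \<gamma> Jp Jm \<sigma>"
  using gk by (simp add: lie_algebraic_generalized_kaehler_def)

lemma Jp: "generalized_complex A \<gamma> Jp" and Jm: "generalized_complex A \<gamma> Jm"
  using generalized_kaehler by (simp_all add: generalized_kaehler_def)

lemma commute:
  assumes u: "u \<in> gtangent A p"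
  shows "Jp p (Jm p u) = Jm p (Jp p u)"
proof -
  have "\<forall>p. \<forall>u\<in>gtangent A p. Jp p (Jm p u) = Jm p (Jp p u)"
    using generalized_kaehler unfolding generalized_kaehler_def by (elim conjE)
  from bspec[OF spec[OF this] u] show ?thesis .
qed

lemma metric:
  assumes u: "u \<in> gtangent A p"
  shows "- Jp p (Jm p u) = (sharp A \<sigma> p (snd u), flat A \<sigma> p (fst u))"
proof -
  have "\<forall>p. \<forall>v\<in>tangent A p. \<forall>\<xi>\<in>cotangent A p. - Jp p (Jm p (v, \<xi>)) = (sharp A \<sigma> p \<xi>, flat A \<sigma> p v)"
    using generalized_kaehler unfolding generalized_kaehler_def by (elim conjE)
  from bspec[OF bspec[OF spec[OF this]], of "fst u" p "snd u"] u show ?thesis by (simp add: gtangent_def mem_Times_iff)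
qed

lemma eigen_graph:
  assumes u: "u \<in> eigenbundle A Jp p"
  shows "u \<in> eigenbundle A Jm p \<Longrightarrow> snd u = flat A \<sigma> p (fst u)"
    and "u = gconj w \<Longrightarrow> w \<in> eigenbundle A Jm p \<Longrightarrow> snd u = - flat A \<sigma> p (fst u)"
proof -
  have ut: "u \<in> gtangent A p" and ju: "Jp p u = gscale \<i> u" using u by (auto simp: eigenbundle_def)
  {
    assume "u \<in> eigenbundle A Jm p"
    then have "Jm p u = gscale \<i> u" by (simp add: eigenbundle_def)
    then have "- Jp p (Jm p u) = u" using generalized_complexD(3)[OF Jp ut, of \<i>] ju by (simp add: gvec.scale_minus_left)
    then show "snd u = flat A \<sigma> p (fst u)" using metric[OF ut] by (metis snd_conv)
  next
    assume w: "u = gconj w" "w \<in> eigenbundle A Jm p"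
    then have wt: "w \<in> gtangent A p" "Jm p w = gscale \<i> w" by (auto simp: eigenbundle_def)
    have "Jm p u = gscale (- \<i>) u" using generalized_complexD(2)[OF Jm wt(1)] wt(2) w(1) by (simp add: gconj_gscale)
    then have "- Jp p (Jm p u) = - u" using generalized_complexD(3)[OF Jp ut, of "- \<i>"] ju by (simp add: gvec.scale_minus_left)
    then have "- snd u = flat A \<sigma> p (fst u)" using metric[OF ut] by (metis snd_conv snd_uminus)
    then show "snd u = - flat A \<sigma> p (fst u)" by (metis minus_minus)
  }
qed

lemma ell_bars:
  obtains M N where "M \<subseteq> \<gg>" "fvec.subspace M" "\<forall>b\<in>M. \<forall>b'\<in>M. \<kappa> b b' = 0"
      "\<forall>p. ell_plus_bar A Jp Jm p = {rsec b p | b. b \<in> M}"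
    and "N \<subseteq> \<gg>" "fvec.subspace N" "\<forall>a\<in>N. \<forall>a'\<in>N. \<kappa> a a' = 0"
      "\<forall>p. ell_minus_bar A Jp Jm p = {lsec a p | a. a \<in> N}"
proof -
  have "lie_algebraic A K \<kappa> Jp" using gk by (simp add: lie_algebraic_generalized_kaehler_def)
  then obtain P where P': "lagrangian_subalgebra A K \<kappa> P \<and> P \<inter> (real_lie_alg A K \<times> real_lie_alg A K) = {0} \<and>
     (\<forall>p. eigenbundle A Jp p = gvec.span {courant_triv A K \<kappa> x p | x. x \<in> P})"
    unfolding lie_algebraic_def by (rule exE)
  note P = conjunct1[OF P'] conjunct2[OF conjunct2[OF P']]
  have "lie_algebraic A K \<kappa> Jm" using gk by (simp add: lie_algebraic_generalized_kaehler_def)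
  then obtain Q where Q': "lagrangian_subalgebra A K \<kappa> Q \<and> Q \<inter> (real_lie_alg A K \<times> real_lie_alg A K) = {0} \<and>
     (\<forall>p. eigenbundle A Jm p = gvec.span {courant_triv A K \<kappa> x p | x. x \<in> Q})"
    unfolding lie_algebraic_def by (rule exE)
  note Q = conjunct1[OF Q'] conjunct2[OF conjunct2[OF Q']]
  note eP = eigenbundle_lagrangian[OF P(1) spec[OF P(2)]] and eQ = eigenbundle_lagrangian[OF Q(1) spec[OF Q(2)]]
  note P_sub = lagrangian_subalgebraD(1)[OF P(1)] and P_zero = lagrangian_subalgebraD(2)[OF P(1)]
    and P_add = lagrangian_subalgebraD(3)[OF P(1)] and P_sc = lagrangian_subalgebraD(4)[OF P(1)]
    and P_iso = lagrangian_subalgebraD(5)[OF P(1)]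
  note Q_sub = lagrangian_subalgebraD(1)[OF Q(1)] and Q_zero = lagrangian_subalgebraD(2)[OF Q(1)]
    and Q_add = lagrangian_subalgebraD(3)[OF Q(1)] and Q_sc = lagrangian_subalgebraD(4)[OF Q(1)]
  \<comment> \<open>The conjugation is that in \<open>ell_plus_bar\<close>: its vectors are
    conjugates of vectors common to both eigenbundles. \<open>M\<close> refers to \<open>P\<close>
    and \<open>Q\<close> only, so it is the same at every point.\<close>
  define M where "M = {b \<in> \<gg>. (0, tconj b) \<in> P \<and> (0, tconj b) \<in> Q}"
  \<comment> \<open>A vector of \<open>ell_minus_bar\<close> has its conjugate in the eigenbundle of
    \<open>Jp\<close> but lies itself in that of \<open>Jm\<close>, so only the first condition is
    conjugated. The sign between \<open>lsec a\<close> and the constant \<open>(- a, 0)\<close> is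
    absorbed because \<open>N\<close> is a subspace.\<close>
  define N where "N = {a \<in> \<gg>. (tconj a, 0) \<in> P \<and> (a, 0) \<in> Q}"
  have M: "M \<subseteq> \<gg>" "fvec.subspace M"
  proof -
    show "fvec.subspace M"
      unfolding fvec.subspace_def
    proof (intro conjI ballI allI)
      show "0 \<in> M" using P_zero Q_zero by (simp add: M_def lie_alg_closed(1) zero_prod_def)
      fix x assume x: "x \<in> M"
      show "x + y \<in> M" if "y \<in> M" for y
        using x that P_add[of "(0, tconj x)" "(0, tconj y)"] Q_add[of "(0, tconj x)" "(0, tconj y)"]
        by (simp add: M_def lie_alg_closed(2) tconj_add)
      show "cscale c x \<in> M" for c
        using x P_sc[of "(0, tconj x)" "cnj c"] Q_sc[of "(0, tconj x)" "cnj c"]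
        by (simp add: M_def lie_alg_closed(3) tconj_cscale)
    qed
  qed (auto simp: M_def)
  have N: "N \<subseteq> \<gg>" "fvec.subspace N"
  proof -
    show "fvec.subspace N"
      unfolding fvec.subspace_def
    proof (intro conjI ballI allI)
      show "0 \<in> N" using P_zero Q_zero by (simp add: N_def lie_alg_closed(1) zero_prod_def)
      fix x assume x: "x \<in> N"
      show "x + y \<in> N" if "y \<in> N" for y
        using x that P_add[of "(tconj x, 0)" "(tconj y, 0)"] Q_add[of "(x, 0)" "(y, 0)"]
        by (simp add: N_def lie_alg_closed(2) tconj_add)
      show "cscale c x \<in> N" for c
        using x P_sc[of "(tconj x, 0)" "cnj c"] Q_sc[of "(x, 0)" c]
        by (simp add: N_def lie_alg_closed(3) tconj_cscale)
    qed
  qed (auto simp: N_def)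
  have Miso: "\<kappa> b b' = 0" if b: "b \<in> M" "b' \<in> M" for b b'
  proof -
    have g: "b \<in> \<gg>" "b' \<in> \<gg>" and "(0, tconj b) \<in> P" "(0, tconj b') \<in> P" using b by (auto simp: M_def)
    then have "\<kappa> (tconj b) (tconj b') = 0" using P_iso[of "(0, tconj b)" "(0, tconj b')"] by (simp add: pair_form_def kappa_zero lie_alg_closed(1))
    then show ?thesis using kappa_tconj[OF g] by simp
  qed
  have Niso: "\<kappa> b b' = 0" if b: "b \<in> N" "b' \<in> N" for b b'
  proof -
    have g: "b \<in> \<gg>" "b' \<in> \<gg>" and "(tconj b, 0) \<in> P" "(tconj b', 0) \<in> P" using b by (auto simp: N_def)
    then have "\<kappa> (tconj b) (tconj b') = 0" using P_iso[of "(tconj b, 0)" "(tconj b', 0)"] by (simp add: pair_form_def kappa_zero lie_alg_closed(1))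
    then show ?thesis using kappa_tconj[OF g] by simp
  qed
  have ctr: "courant_triv A K \<kappa> (0, b) p = rsec b p" if "b \<in> \<gg>" for b p
    using courant_triv_eq[OF lie_alg_closed(1) that, of p] by (simp add: lsec_linear)
  have ctl: "courant_triv A K \<kappa> (a, 0) p = lsec (- a) p" if "a \<in> \<gg>" for a p
    using courant_triv_eq[OF that lie_alg_closed(1), of p] by (simp add: rsec_linear)
  have plus: "ell_plus_bar A Jp Jm p = {rsec b p | b. b \<in> M}" for p
  proof (intro equalityI subsetI)
    fix u assume "u \<in> ell_plus_bar A Jp Jm p"
    then obtain w where w: "u = gconj w" "w \<in> eigenbundle A Jp p" "w \<in> eigenbundle A Jm p" unfolding ell_plus_bar_def by blast
    obtain x where x: "x \<in> P" "w = courant_triv A K \<kappa> x p" using w(2) eP by auto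
    obtain y where y: "y \<in> Q" "w = courant_triv A K \<kappa> y p" using w(3) eQ by auto
    obtain a b a' b' where ab: "x = (a, b)" "y = (a', b')" by (metis surj_pair)
    have g: "a \<in> \<gg>" "b \<in> \<gg>" "a' \<in> \<gg>" "b' \<in> \<gg>" using P_sub Q_sub x y ab by auto
    \<comment> \<open>The trivialization is injective, so \<open>w\<close> comes from one pair of
      constants that lies in both \<open>P\<close> and \<open>Q\<close>.\<close>
    have xy: "a = a' \<and> b = b'" by (rule courant_triv_inj[OF g, where p = p]) (use x y ab in auto)
    have a0: "a = 0" by (rule courant_triv_graph(1)[OF g(1,2), where p = p]) (use eigen_graph(1)[OF w(2,3)] x ab in auto)
    have "tconj b \<in> M" using x(1) y(1) ab xy a0 g lie_alg_tconj by (simp add: M_def)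
    moreover have "u = rsec (tconj b) p" using w(1) x(2) ab a0 ctr[OF g(2)] rsec_linear(4)[OF g(2)] by simp
    ultimately show "u \<in> {rsec b p | b. b \<in> M}" by blast
  next
    fix u assume "u \<in> {rsec b p | b. b \<in> M}"
    then obtain b where b: "b \<in> M" "u = rsec b p" by auto
    then have bg: "b \<in> \<gg>" "tconj b \<in> \<gg>" using lie_alg_tconj by (auto simp: M_def)
    have "rsec (tconj b) p \<in> eigenbundle A Jp p \<inter> eigenbundle A Jm p"
      unfolding eP eQ ctr[OF bg(2), symmetric] using b(1) by (auto simp: M_def)
    moreover have "u = gconj (rsec (tconj b) p)" using rsec_linear(4)[OF bg(1), of p] b(2) by simp
    ultimately show "u \<in> ell_plus_bar A Jp Jm p" unfolding ell_plus_bar_def by blast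
  qed
  have minus: "ell_minus_bar A Jp Jm p = {lsec a p | a. a \<in> N}" for p
  proof (intro equalityI subsetI)
    fix u assume "u \<in> ell_minus_bar A Jp Jm p"
    then obtain z w where w: "u = gconj z" "z \<in> eigenbundle A Jp p" "z = gconj w" "w \<in> eigenbundle A Jm p" unfolding ell_minus_bar_def by blast
    obtain x where x: "x \<in> P" "z = courant_triv A K \<kappa> x p" using w(2) eP by auto
    obtain y where y: "y \<in> Q" "w = courant_triv A K \<kappa> y p" using w(4) eQ by auto
    obtain a b a' b' where ab: "x = (a, b)" "y = (a', b')" by (metis surj_pair)
    have g: "a \<in> \<gg>" "b \<in> \<gg>" "a' \<in> \<gg>" "b' \<in> \<gg>" using P_sub Q_sub x y ab by auto
    have "gconj (courant_triv A K \<kappa> (a', b') p) = courant_triv A K \<kappa> (tconj a', tconj b') p"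
    proof -
      have "gconj (u + v) = gconj u + gconj v" if "u = rsec b' p" "v = lsec (- a') p" for u v
      proof -
        have "fst u \<in> tangent A p" by (simp add: that rsec_def right_field_tangent g)
        then show ?thesis by (auto simp: gconj_def tconj_add)
      qed
      then show ?thesis unfolding courant_triv_eq[OF g(3,4)] courant_triv_eq[OF lie_alg_tconj[OF g(3)] lie_alg_tconj[OF g(4)]]
        using rsec_linear(4)[OF g(4), of p] lsec_linear(4)[OF lie_alg_closed(5)[OF g(3)], of p] by (simp add: tconj_minus)
    qed
    then have "courant_triv A K \<kappa> (a, b) p = courant_triv A K \<kappa> (tconj a', tconj b') p" using x y ab w(3) by simp
    then have xy: "a = tconj a' \<and> b = tconj b'" by (rule courant_triv_inj[OF g(1,2) lie_alg_tconj[OF g(3)] lie_alg_tconj[OF g(4)]])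
    have b0: "b = 0" by (rule courant_triv_graph(2)[OF g(1,2), where p = p]) (use eigen_graph(2)[OF w(2,3,4)] x ab in auto)
    have b0': "b' = 0" using b0 xy by (metis tconj_tconj tconj_zero)
    have aN: "a' \<in> N" using x(1) y(1) ab xy b0 b0' g by (simp add: N_def)
    have "u = gconj (lsec (- tconj a') p)" using w(1) x(2) ab b0 xy ctl[OF g(1)] by simp
    also have "\<dots> = lsec (- a') p"
      using lsec_linear(4)[OF lie_alg_closed(5)[OF lie_alg_tconj[OF g(3)]], of p] by (simp add: tconj_minus)
    finally show "u \<in> {lsec a p | a. a \<in> N}" using fvec.subspace_neg[OF N(2) aN] by blast
  next
    fix u assume "u \<in> {lsec a p | a. a \<in> N}"
    then obtain a where a: "a \<in> N" "u = lsec a p" by auto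
    have aN: "- a \<in> N" by (rule fvec.subspace_neg[OF N(2) a(1)])
    then have g: "a \<in> \<gg>" "tconj a \<in> \<gg>" "- a \<in> \<gg>" "- tconj a \<in> \<gg>" using a lie_alg_tconj lie_alg_closed(5) by (auto simp: N_def)
    have 1: "lsec (tconj a) p = courant_triv A K \<kappa> (tconj (- a), 0) p" using ctl[OF g(4), of p] by (simp add: tconj_minus)
    have 2: "lsec a p = courant_triv A K \<kappa> (- a, 0) p" using ctl[OF g(3), of p] by simp
    have "lsec (tconj a) p \<in> eigenbundle A Jp p" unfolding eP 1 using aN by (auto simp: N_def)
    moreover have "lsec a p \<in> eigenbundle A Jm p" unfolding eQ 2 using aN by (auto simp: N_def)
    moreover have "lsec (tconj a) p = gconj (lsec a p)" by (rule lsec_linear(4)[OF g(1)])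
    ultimately show "u \<in> ell_minus_bar A Jp Jm p" unfolding ell_minus_bar_def a(2) by (metis IntI gconj_gconj imageI)
  qed
  show thesis
    by (rule that[OF M _ _ N]; intro ballI allI Miso Niso plus minus; assumption)
qed

text \<open>The lift lies on the graph of \<open>\<sigma>\<close>, the fixed space of
  \<open>- Jp Jm\<close>. Since \<open>Jp\<close> commutes with \<open>Jm\<close> it preserves this
  graph, so the condition on the anchor alone, type \<open>(0,1)\<close> for \<open>I_plus\<close>,
  already forces \<open>Jp u = - i u\<close>. On the graph \<open>Jm\<close> acts as
  \<open>Jp\<close>.\<close>

lemma lift_plus:
  assumes X: "X \<in> vfields01 A (I_plus A Jp \<sigma>)"
  shows "\<exists>s\<in>sections_in A (ell_plus_bar A Jp Jm). \<forall>q. fst (s q) = X q"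
proof (intro bexI[of _ "\<lambda>q. (X q, flat A \<sigma> q (X q))"] allI)
  have vX: "X \<in> vfields A" and IX: "\<And>q. fst (Jp q (X q, flat A \<sigma> q (X q))) = cscale (- \<i>) (X q)"
    using X by (auto simp: vfields01_def I_plus_def)
  have "(X q, flat A \<sigma> q (X q)) \<in> ell_plus_bar A Jp Jm q" for q
  proof -
    let ?u = "(X q, flat A \<sigma> q (X q))"
    have tX: "X q \<in> tangent A q" by (rule vfieldsD(1)[OF vX])
    have ut: "?u \<in> gtangent A q" using tX flat_cotangent[OF sigma_riemannian tX] by (simp add: gtangent_def)
    note Jut = generalized_complexD(1)[OF Jp ut] and Jmt = generalized_complexD(1)[OF Jm ut]
    have uu: "- Jp q (Jm q ?u) = ?u" using metric[OF ut] sharp_flat[OF manifold sigma_riemannian tX] by simp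
    then have JJ: "Jp q (Jm q ?u) = gscale (-1) ?u" by (simp only: gscale_uminus) (metis minus_minus)
    have "- Jp q (Jm q (Jp q ?u)) = Jp q ?u"
    proof -
      have "Jp q (Jm q (Jp q ?u)) = Jp q (gscale (-1) ?u)" using commute[OF ut] JJ by simp
      then show ?thesis using generalized_complexD(3)[OF Jp ut, of "-1"] by (simp add: gscale_uminus)
    qed
    then have "snd (Jp q ?u) = flat A \<sigma> q (fst (Jp q ?u))" using metric[OF Jut] by (metis snd_conv)
    then have ju: "Jp q ?u = gscale (- \<i>) ?u"
      using IX[of q] flat_linear(2)[OF sigma_riemannian tX tX, of "- \<i>"] by (simp add: prod_eq_iff gscale_def)
    have jm: "Jm q ?u = gscale (- \<i>) ?u"
    proof -
      have "- Jm q ?u = Jp q (gscale (-1) ?u)" using generalized_complexD(4)[OF Jp Jmt] JJ by simp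
      then have "- Jm q ?u = - Jp q ?u" using generalized_complexD(3)[OF Jp ut, of "-1"] by (simp add: gscale_uminus)
      then show ?thesis using ju by (metis minus_minus)
    qed
    have "gconj ?u \<in> eigenbundle A Jp q \<inter> eigenbundle A Jm q"
      unfolding eigenbundle_def mem_Collect_eq Int_iff generalized_complexD(2)[OF Jp ut] generalized_complexD(2)[OF Jm ut]
        ju jm gconj_gscale
      using gconj_gtangent[OF manifold ut] by simp
    then show ?thesis unfolding ell_plus_bar_def by (metis gconj_gconj imageI)
  qed
  then show "(\<lambda>q. (X q, flat A \<sigma> q (X q))) \<in> sections_in A (ell_plus_bar A Jp Jm)"
    using vX fl_oneform[OF vX] by (simp add: sections_in_def gsections_def)
qed simp

text \<open>As for \<open>lift_plus\<close>, on the graph of \<open>- \<sigma>\<close>, where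
  \<open>Jp Jm\<close> is the identity. There \<open>Jm\<close> acts as \<open>- Jp\<close>, so the
  lift itself is an \<open>i\<close>-eigenvector of \<open>Jm\<close> while its conjugate is one of
  \<open>Jp\<close>.\<close>

lemma lift_minus:
  assumes X: "X \<in> vfields01 A (I_minus A Jp \<sigma>)"
  shows "\<exists>s\<in>sections_in A (ell_minus_bar A Jp Jm). \<forall>q. fst (s q) = X q"
proof (intro bexI[of _ "\<lambda>q. (X q, flat A \<sigma> q (cscale (-1) (X q)))"] allI)
  have vX: "X \<in> vfields A" using X by (simp add: vfields01_def)
  have tX: "X q \<in> tangent A q" for q by (rule vfieldsD(1)[OF vX])
  \<comment> \<open>The 1-form of the lift is written as \<open>flat\<close> of a negated vector, so
    that the general facts on \<open>flat\<close> and \<open>sharp\<close> apply to it;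
    \<open>neg\<close> translates to the negative of \<open>flat\<close>.\<close>
  have neg: "flat A \<sigma> q (cscale (-1) v) = - flat A \<sigma> q v" if "v \<in> tangent A q" for q v
    using flat_linear(2)[OF sigma_riemannian that that, of "-1"] by (simp add: fvec.scale_minus_left)
  have IX: "fst (Jp q (X q, flat A \<sigma> q (cscale (-1) (X q)))) = cscale (- \<i>) (X q)" for q
    unfolding neg[OF tX] using X by (simp add: vfields01_def I_minus_def)
  have "(X q, flat A \<sigma> q (cscale (-1) (X q))) \<in> ell_minus_bar A Jp Jm q" for q
  proof -
    let ?u = "(X q, flat A \<sigma> q (cscale (-1) (X q)))"
    note tm = tangent_closed(3)[OF tX, of "-1" q]
    have ut: "?u \<in> gtangent A q" using tX flat_cotangent[OF sigma_riemannian tm] by (simp add: gtangent_def)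
    note Jut = generalized_complexD(1)[OF Jp ut] and Jmt = generalized_complexD(1)[OF Jm ut]
    have "- Jp q (Jm q ?u) = (cscale (-1) (X q), flat A \<sigma> q (X q))"
      using metric[OF ut] sharp_flat[OF manifold sigma_riemannian tm] by simp
    then have "- Jp q (Jm q ?u) = - ?u" unfolding neg[OF tX] by (simp add: fvec.scale_minus_left)
    then have JJ: "Jp q (Jm q ?u) = ?u" by (metis minus_minus)
    have "- Jp q (Jm q (Jp q ?u)) = - Jp q ?u" using commute[OF ut] JJ by simp
    then have "snd (- Jp q ?u) = flat A \<sigma> q (fst (Jp q ?u))" using metric[OF Jut] by simp
    from arg_cong[OF this, of uminus] have "snd (Jp q ?u) = - flat A \<sigma> q (cscale (- \<i>) (X q))"
      unfolding IX snd_uminus minus_minus .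
    then have ju: "Jp q ?u = gscale (- \<i>) ?u"
      unfolding neg[OF tX] using IX[of q, unfolded neg[OF tX]] flat_cscale[OF tX[of q], of "- \<i>"]
      by (simp add: prod_eq_iff gscale_def fvec.scale_minus_left fvec.scale_minus_right)
    have jm: "Jm q ?u = gscale \<i> ?u"
    proof -
      have "- Jm q ?u = Jp q ?u" using generalized_complexD(4)[OF Jp Jmt] JJ by simp
      then have "Jm q ?u = - gscale (- \<i>) ?u" unfolding ju by (metis minus_minus)
      then show ?thesis by (simp add: gvec.scale_minus_left)
    qed
    have "gconj ?u \<in> eigenbundle A Jp q"
      unfolding eigenbundle_def mem_Collect_eq generalized_complexD(2)[OF Jp ut] ju gconj_gscale
      using gconj_gtangent[OF manifold ut] by simp
    moreover have "?u \<in> eigenbundle A Jm q" using ut jm by (simp add: eigenbundle_def)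
    ultimately show ?thesis unfolding ell_minus_bar_def by (metis IntI gconj_gconj imageI)
  qed
  moreover have "(\<lambda>q. flat A \<sigma> q (cscale (-1) (X q))) \<in> oneforms A"
  proof (rule flat_oneform[OF sigma_riemannian])
    show "(\<lambda>q. cscale (-1) (X q)) \<in> vfields A"
      unfolding vfields_def
    proof (intro CollectI conjI allI ballI)
      show "cscale (-1) (X p) \<in> tangent A p" for p by (rule tangent_closed(3)[OF tX])
      show "(\<lambda>p. cscale (-1) (X p) f) \<in> smooth_funs A" if "f \<in> smooth_funs A" for f
        using smooth_funs_minus[OF manifold vfieldsD(2)[OF vX that]] by (simp add: cscale_def)
    qed
  qed
  ultimately show "(\<lambda>q. (X q, flat A \<sigma> q (cscale (-1) (X q)))) \<in> sections_in A (ell_minus_bar A Jp Jm)"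
    using vX by (simp add: sections_in_def gsections_def)
qed simp

lemma holomorphically_trivial_A:
  "holomorphically_trivial A (I_plus A Jp \<sigma>) (A_plus A Jp Jm) (dbar_plus A \<gamma> Jp Jm)"
  "holomorphically_trivial A (I_minus A Jp \<sigma>) (A_minus A Jp Jm) (dbar_minus A \<gamma> Jp Jm)"
proof -
  obtain M N where M: "M \<subseteq> \<gg>" "fvec.subspace M" "\<forall>b\<in>M. \<forall>b'\<in>M. \<kappa> b b' = 0"
      "\<forall>p. ell_plus_bar A Jp Jm p = {rsec b p | b. b \<in> M}"
    and N: "N \<subseteq> \<gg>" "fvec.subspace N" "\<forall>a\<in>N. \<forall>a'\<in>N. \<kappa> a a' = 0"
      "\<forall>p. ell_minus_bar A Jp Jm p = {lsec a p | a. a \<in> N}"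
    by (rule ell_bars)
  obtain m e where e: "hermitian_basis M m e" using hermitian_basis_exists[OF M(1,2)] by blast
  obtain r a where a: "hermitian_basis N r a" using hermitian_basis_exists[OF N(1,2)] by blast
  have eM: "e k \<in> M" if "k < m" for k using e that by (simp add: hermitian_basis_def)
  have aN: "a k \<in> N" if "k < r" for k using a that by (simp add: hermitian_basis_def)
  have eg: "e k \<in> \<gg>" "tconj (e k) \<in> \<gg>" if "k < m" for k using eM[OF that] M(1) lie_alg_tconj by auto
  have ag: "a k \<in> \<gg>" "tconj (a k) \<in> \<gg>" "- tconj (a k) \<in> \<gg>" if "k < r" for k
    using aN[OF that] N(1) lie_alg_tconj lie_alg_closed(5) by auto
  have ee: "\<kappa> (e k) (tconj (e l)) = (if k = l then 1 else 0)" if "k < m" "l < m" for k l using e that by (simp add: hermitian_basis_def)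
  \<comment> \<open>The pairing of left sections is \<open>- \<kappa>\<close>, so the sections dual
    to \<open>lsec (a k)\<close> are those of the negated conjugates.\<close>
  have aa: "\<kappa> (a k) (- tconj (a l)) = (if k = l then -1 else 0)" if "k < r" "l < r" for k l
    using a that kappa_minus(2)[OF ag(1)[OF that(1)] ag(2)[OF that(2)]] by (simp add: hermitian_basis_def)
  have plus: "ell_plus_bar A Jp Jm p = {\<Sum>k<m. gscale (h k) (rsec (e k) p) | h. True}" for p
    unfolding M(4)[rule_format] by (rule sec_span(1)[OF M(1,2) e])
  have minus: "ell_minus_bar A Jp Jm p = {\<Sum>k<r. gscale (h k) (lsec (a k) p) | h. True}" for p
    unfolding N(4)[rule_format] by (rule sec_span(2)[OF N(1,2) a])
  have br: "lie_br (\<lambda>q. fst (rsec b q)) (\<lambda>q. fst (lsec c q)) p = 0" "lie_br (\<lambda>q. fst (lsec c q)) (\<lambda>q. fst (rsec b q)) p = 0"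
    if "b \<in> \<gg>" "c \<in> \<gg>" for b c p
    using lie_br_right_left[OF that] lie_br_left_right[OF that(2,1)] by (simp_all add: rsec_def lsec_def)
  show "holomorphically_trivial A (I_plus A Jp \<sigma>) (A_plus A Jp Jm) (dbar_plus A \<gamma> Jp Jm)"
    unfolding A_plus_def dbar_plus_def
  proof (rule quotient_holomorphically_trivial[where m = m and r = r and f = "\<lambda>k. rsec (e k)" and f' = "\<lambda>k. rsec (tconj (e k))"
      and g = "\<lambda>i. lsec (a i)" and C = "\<lambda>i. lsec (- tconj (a i))"])
    show "ell_sum_bar A Jp Jm p = ell_plus_bar A Jp Jm p + {\<Sum>i<r. gscale (x i) (lsec (a i) p) | x. True}" for p
      unfolding ell_sum_bar_def minus ..
  qed (simp_all add: plus rsec_gsections lsec_gsections eg ag gpair_sec ee aa M(3) eM br defect_right_left lift_plus)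
  \<comment> \<open>The two dual pairs of families exchange their roles: the left pair now serves as
    \<open>f\<close>, \<open>f'\<close> and the right pair as \<open>g\<close>,
    \<open>C\<close>.\<close>
  show "holomorphically_trivial A (I_minus A Jp \<sigma>) (A_minus A Jp Jm) (dbar_minus A \<gamma> Jp Jm)"
    unfolding A_minus_def dbar_minus_def
  proof (rule quotient_holomorphically_trivial[where m = r and r = m and f = "\<lambda>i. lsec (a i)" and f' = "\<lambda>i. lsec (- tconj (a i))"
      and g = "\<lambda>k. rsec (e k)" and C = "\<lambda>k. rsec (tconj (e k))"])
    show "ell_sum_bar A Jp Jm p = ell_minus_bar A Jp Jm p + {\<Sum>i<m. gscale (x i) (rsec (e i) p) | x. True}" for p
      unfolding ell_sum_bar_def plus by (rule add.commute)
  qed (simp_all add: minus rsec_gsections lsec_gsections eg ag gpair_sec ee aa N(3) aN br defect_left_right lift_minus)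
qed

end

theorem proposition5p27:
  fixes A :: "('k::{t2_space, second_countable_topology}, 'e::real_normed_vector) atlas"
    and K :: "'k monoid"
    and \<kappa> :: "'k tvec \<Rightarrow> 'k tvec \<Rightarrow> complex"
    and Jp Jm :: "'k \<Rightarrow> 'k gvec \<Rightarrow> 'k gvec"
  assumes "lie_group A K"
    and "compact (UNIV :: 'k set)"
    and "connected (UNIV :: 'k set)"
    and "even (dim (UNIV :: 'e set))"
    and "kappa_form A K \<kappa>"
    and "lie_algebraic_generalized_kaehler A K \<kappa> Jp Jm"
  shows "holomorphically_trivial A (I_plus A Jp (sigma_metric A K \<kappa>))
           (A_plus A Jp Jm) (dbar_plus A (cartan_form A K \<kappa>) Jp Jm)
       \<and> holomorphically_trivial A (I_minus A Jp (sigma_metric A K \<kappa>))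
           (A_minus A Jp Jm) (dbar_minus A (cartan_form A K \<kappa>) Jp Jm)"
proof -
  interpret lie_algebraic_gk A K \<kappa> Jp Jm
    by unfold_locales fact+
  show ?thesis using holomorphically_trivial_A by blast
qed

end
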